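(* Let $t\in\mathbb{C}\setminus\{0\}$. Then the map $$\phi:\left\{(k,m)\ \middle|\ k\in\mathbb{N}_0,\ l\in\mathbb{N}_0,\ m=(m_1,\dots,m_l)\in\{1,\dots,k\}^l,\ m_{i+1}-m_i\ge2\text{ for all }1\le i\le l-1\right\}\to\left\{\begin{matrix}\text{isomorphism classes of non-zero}\\ \text{indecomposable objects in }\underline{\mathrm{Rep}}(B_t^{\#+})\end{matrix}\right\}$$ with $\phi((k,m))=\mathcal{L}_{p_{k,m}}(V_{\mathrm{triv}})$ is a bijection.
   Context: For $k,l\in\mathbb{N}_0$ let $P(k,l)$ be the set of set partitions of $\{1,\dots,k,1',\dots,l'\}$ ($k$ upper points, $l$ lower points). Operations: the tensor product $p\otimes q$ is horizontal concatenation; the involution $p^*\in P(l,k)$ swaps upper and lower points; for $p\in P(k,l)$, $q\in P(l,m)$, stack $p$ above $q$, identifying the lower points of $p$ with the upper points of $q$; $q\cdot p\in P(k,m)$ is the induced partition of the outer points by connected components, and $\ell(q,p)$ is the number of connected components containing only middle points. A category of partitions $\mathcal{C}$ is a collection of subsets $\mathcal{C}(k,l)\subseteq P(k,l)$ containing $\{\{1,2\}\}\in P(2,0)$ and $\{\{1,1'\}\}\in P(1,1)$ and closed under $\otimes$, $*$ and $\cdot$. $NC_b^\#$ is the category of partitions generated by $\{\{1'\},\{2'\}\}\in P(0,2)$ (the smallest category of partitions containing it). Explicitly, it consists of the non-crossing partitions (no crossing of blocks when points are arranged on a circle in the order $1,\dots,k,l',\dots,1'$) with all blocks of size one or two, an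 even number of blocks of size one, and such that the number of points lying between any two connected points on the circle is even. For $t\in\mathbb{C}$ and $\mathcal{C}$ a category of partitions, $\underline{\mathrm{Rep}}_0(\mathcal{C},t)$ is the $\mathbb{C}$-linear category with objects $[k]$, $k\in\mathbb{N}_0$, $\mathrm{Hom}([k],[l])=\mathbb{C}\,\mathcal{C}(k,l)$, and composition extending $qp:=t^{\ell(q,p)}\,q\cdot p$; $\underline{\mathrm{Rep}}(\mathcal{C},t)$ is its Karoubi envelope (idempotent completion of the additive completion). $\underline{\mathrm{Rep}}(B_t^{\#+}):=\underline{\mathrm{Rep}}(NC_b^\#,t)$. For an idempotent $e\in\mathrm{End}([k])$, $([k],e)$ denotes its image. For $(k,m)$ as in the claim (with $l=0$ giving the empty sequence), $p_{k,m}\in NC_b^\#(k,k)$ is the partition whose blocks are $\{i,i'\}$ for $i\in\{1,\dots,k\}\setminus\{m_1,\dots,m_l\}$ and the singletons $\{m_j\}$, $\{m_j'\}$ for $1\le j\le l$. Objects: a through-block is a block containing both upper and lower points; $t(p)$ is the number of through-blocks. The partition $p=p_{k,m}$ is projective, i.e. $p=p_0^*\cdot p_0$ for some $p_0\in P(k,t(p))$. With $E=\mathrm{End}([k])$, let $I_p\subseteq pEp$ be the ideal of elements that are linear combinations of partitions with fewer than $t(p)$ through-blocks. Then $pEp/I_p\cong\mathbb{C}$, with unit the class of $t^{-\ell(p,p)}p$ (this is the group algebra of the trivial group, whose trivial representation is $V_{\mathrm{triv}}$). Let $\mathcal{L}_p\in pEp$ be a primitive idempotent lifting this unit (unique up to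 conjugation); $\mathcal{L}_p(V_{\mathrm{triv}})$ is the isomorphism class of $([k],\mathcal{L}_p)$. *)

theory Defs
  imports Complex_Main "HOL-Library.Disjoint_Sets" "HOL-Library.Function_Algebras"
begin

section \<open>Categories of partitions\<close>

datatype point = Up nat | Lo nat

type_synonym part = "point set set"

definition points :: "nat \<Rightarrow> nat \<Rightarrow> point set" where
  "points k l = Up ` {1..k} \<union> Lo ` {1..l}"

definition P :: "nat \<Rightarrow> nat \<Rightarrow> part set" where
  "P k l = {p. partition_on (points k l) p}"

fun shift :: "nat \<Rightarrow> nat \<Rightarrow> point \<Rightarrow> point" where
  "shift k l (Up i) = Up (k + i)"
| "shift k l (Lo i) = Lo (l + i)"

text \<open>The numbers \<open>k\<close>, \<open>l\<close> are those of the left-hand factor \<open>p \<in> P k l\<close>.\<close>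

definition tensor :: "nat \<Rightarrow> nat \<Rightarrow> part \<Rightarrow> part \<Rightarrow> part" where
  "tensor k l p q = p \<union> (\<lambda>b. shift k l ` b) ` q"

fun flip :: "point \<Rightarrow> point" where
  "flip (Up i) = Lo i"
| "flip (Lo i) = Up i"

definition star :: "part \<Rightarrow> part" where
  "star p = (\<lambda>b. flip ` b) ` p"

text \<open>Points of the diagram with \<open>p\<close> stacked above \<open>q\<close>: the lower points of \<open>p\<close> and the
  upper points of \<open>q\<close> both become middle points.\<close>

datatype spoint = Top nat | Mid nat | Bot nat

fun upper_half :: "point \<Rightarrow> spoint" where
  "upper_half (Up i) = Top i"
| "upper_half (Lo i) = Mid i"

fun lower_half :: "point \<Rightarrow> spoint" where
  "lower_half (Up i) = Mid i"
| "lower_half (Lo i) = Bot i"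

definition stack :: "part \<Rightarrow> part \<Rightarrow> spoint set set" where
  "stack q p = (\<lambda>b. upper_half ` b) ` p \<union> (\<lambda>b. lower_half ` b) ` q"

definition components :: "part \<Rightarrow> part \<Rightarrow> spoint set set" where
  "components q p = \<Union>(stack q p) // (\<Union>b\<in>stack q p. b \<times> b)\<^sup>+"

text \<open>As for maps, \<open>p \<in> P k l\<close> is applied first: \<open>pcomp q p\<close> is \<open>q \<cdot> p\<close> and \<open>loops q p\<close>
  is the number of components consisting of middle points only.\<close>

definition pcomp :: "part \<Rightarrow> part \<Rightarrow> part" where
  "pcomp q p = (\<lambda>c. {Up i |i. Top i \<in> c} \<union> {Lo i |i. Bot i \<in> c}) ` components q p - {{}}"

definition loops :: "part \<Rightarrow> part \<Rightarrow> nat" where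
  "loops q p = card {c \<in> components q p. c \<subseteq> range Mid}"

definition partition_category :: "(nat \<Rightarrow> nat \<Rightarrow> part set) \<Rightarrow> bool" where
  "partition_category C \<longleftrightarrow>
     (\<forall>k l. C k l \<subseteq> P k l) \<and>
     {{Up 1, Up 2}} \<in> C 2 0 \<and> {{Up 1, Lo 1}} \<in> C 1 1 \<and>
     (\<forall>k l k' l' p q. p \<in> C k l \<longrightarrow> q \<in> C k' l' \<longrightarrow> tensor k l p q \<in> C (k + k') (l + l')) \<and>
     (\<forall>k l p. p \<in> C k l \<longrightarrow> star p \<in> C l k) \<and>
     (\<forall>k l m p q. p \<in> C k l \<longrightarrow> q \<in> C l m \<longrightarrow> pcomp q p \<in> C k m)"

definition NCb_sharp :: "nat \<Rightarrow> nat \<Rightarrow> part set" where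
  "NCb_sharp k l = \<Inter>{C k l |C. partition_category C \<and> {{Lo 1}, {Lo 2}} \<in> C 0 2}"

definition through_blocks :: "part \<Rightarrow> nat" where
  "through_blocks p = card {b \<in> p. (\<exists>i. Up i \<in> b) \<and> (\<exists>j. Lo j \<in> b)}"

definition id_part :: "nat \<Rightarrow> part" where
  "id_part k = {{Up i, Lo i} |i. i \<in> {1..k}}"

section \<open>Preadditive categories\<close>

text \<open>\<open>Hom x y\<close> is an additive subgroup of the type \<open>'m\<close>; thus zero morphisms and sums of
  morphisms are those of \<open>'m\<close>. A value of type \<open>'m\<close> need not determine its source and target,
  so \<open>Comp x y z g f\<close>, the composite of \<open>f : x \<rightarrow> y\<close> and \<open>g : y \<rightarrow> z\<close>, names the objects.\<close>

record ('o, 'm) preadd =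
  Ob :: "'o set"
  Hom :: "'o \<Rightarrow> 'o \<Rightarrow> 'm set"
  Id :: "'o \<Rightarrow> 'm"
  Comp :: "'o \<Rightarrow> 'o \<Rightarrow> 'o \<Rightarrow> 'm \<Rightarrow> 'm \<Rightarrow> 'm"

definition isomorphic :: "('o, 'm::ab_group_add) preadd \<Rightarrow> 'o \<Rightarrow> 'o \<Rightarrow> bool" where
  "isomorphic \<A> x y \<longleftrightarrow>
     (\<exists>f \<in> Hom \<A> x y. \<exists>g \<in> Hom \<A> y x.
        Comp \<A> x y x g f = Id \<A> x \<and> Comp \<A> y x y f g = Id \<A> y)"

definition iso_rel :: "('o, 'm::ab_group_add) preadd \<Rightarrow> ('o \<times> 'o) set" where
  "iso_rel \<A> = {(x, y). x \<in> Ob \<A> \<and> y \<in> Ob \<A> \<and> isomorphic \<A> x y}"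

definition zero_object :: "('o, 'm::ab_group_add) preadd \<Rightarrow> 'o \<Rightarrow> bool" where
  "zero_object \<A> x \<longleftrightarrow>
     x \<in> Ob \<A> \<and> (\<forall>y \<in> Ob \<A>. (\<exists>!f. f \<in> Hom \<A> x y) \<and> (\<exists>!f. f \<in> Hom \<A> y x))"

definition direct_sum :: "('o, 'm::ab_group_add) preadd \<Rightarrow> 'o \<Rightarrow> 'o \<Rightarrow> 'o \<Rightarrow> bool" where
  "direct_sum \<A> x y z \<longleftrightarrow>
     (\<exists>i \<in> Hom \<A> y x. \<exists>j \<in> Hom \<A> z x. \<exists>p \<in> Hom \<A> x y. \<exists>q \<in> Hom \<A> x z.
        Comp \<A> y x y p i = Id \<A> y \<and> Comp \<A> z x z q j = Id \<A> z \<and>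
        Comp \<A> z x y p j = 0 \<and> Comp \<A> y x z q i = 0 \<and>
        Comp \<A> x y x i p + Comp \<A> x z x j q = Id \<A> x)"

definition indecomposable :: "('o, 'm::ab_group_add) preadd \<Rightarrow> 'o \<Rightarrow> bool" where
  "indecomposable \<A> x \<longleftrightarrow>
     x \<in> Ob \<A> \<and>
     (\<forall>y \<in> Ob \<A>. \<forall>z \<in> Ob \<A>. direct_sum \<A> x y z \<longrightarrow> zero_object \<A> y \<or> zero_object \<A> z)"

definition indecomposable_classes :: "('o, 'm::ab_group_add) preadd \<Rightarrow> 'o set set" where
  "indecomposable_classes \<A> =
     {iso_rel \<A> `` {x} |x. x \<in> Ob \<A> \<and> indecomposable \<A> x \<and> \<not> zero_object \<A> x}"

text \<open>Objects are finite sequences (formal direct sums) of objects; morphisms are matrices, with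
  the entry \<open>A i j\<close> going from the \<open>j\<close>-th summand of the source to the \<open>i\<close>-th summand of the
  target. Entries outside the index range are \<open>0\<close>, so that equality of morphisms is equality
  of functions.\<close>

definition additive_completion ::
    "('o, 'm::ab_group_add) preadd \<Rightarrow> ('o list, nat \<Rightarrow> nat \<Rightarrow> 'm) preadd" where
  "additive_completion \<A> = \<lparr>
     Ob = {xs. set xs \<subseteq> Ob \<A>},
     Hom = (\<lambda>xs ys. {A.
       (\<forall>i j. i < length ys \<and> j < length xs \<longrightarrow> A i j \<in> Hom \<A> (xs ! j) (ys ! i)) \<and>
       (\<forall>i j. \<not> (i < length ys \<and> j < length xs) \<longrightarrow> A i j = 0)}),
     Id = (\<lambda>xs i j. if i = j \<and> i < length xs then Id \<A> (xs ! i) else 0),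
     Comp = (\<lambda>xs ys zs B A i j.
       if i < length zs \<and> j < length xs
       then \<Sum>n<length ys. Comp \<A> (xs ! j) (ys ! n) (zs ! i) (B i n) (A n j)
       else 0) \<rparr>"

definition idempotent_completion ::
    "('o, 'm::ab_group_add) preadd \<Rightarrow> ('o \<times> 'm, 'm) preadd" where
  "idempotent_completion \<A> = \<lparr>
     Ob = {(x, e). x \<in> Ob \<A> \<and> e \<in> Hom \<A> x x \<and> Comp \<A> x x x e e = e},
     Hom = (\<lambda>(x, e) (y, f). {a \<in> Hom \<A> x y. Comp \<A> x x y a e = a \<and> Comp \<A> x y y f a = a}),
     Id = (\<lambda>(x, e). e),
     Comp = (\<lambda>(x, e) (y, f) (z, g). Comp \<A> x y z) \<rparr>"

definition karoubi ::
    "('o, 'm::ab_group_add) preadd \<Rightarrow> ('o list \<times> (nat \<Rightarrow> nat \<Rightarrow> 'm), nat \<Rightarrow> nat \<Rightarrow> 'm) preadd" where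
  "karoubi \<A> = idempotent_completion (additive_completion \<A>)"

text \<open>For an endomorphism \<open>e\<close> of \<open>x\<close> in the original category: the pair consisting of the
  one-term sequence \<open>x\<close> and the \<open>1 \<times> 1\<close> matrix \<open>e\<close>.\<close>

definition image_object :: "'o \<Rightarrow> 'm::ab_group_add \<Rightarrow> 'o list \<times> (nat \<Rightarrow> nat \<Rightarrow> 'm)" where
  "image_object x e = ([x], \<lambda>i j. if i = 0 \<and> j = 0 then e else 0)"

section \<open>Interpolating partition categories\<close>

text \<open>A formal linear combination of partitions is its coefficient function; \<open>C k l\<close> is finite,
  so no finiteness condition on the support is needed. The object \<open>[k]\<close> is the number \<open>k\<close>.\<close>

type_synonym lincomb = "part \<Rightarrow> complex"

definition basis :: "part \<Rightarrow> lincomb" where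
  "basis p = (\<lambda>q. if q = p then 1 else 0)"

definition Rep0 :: "(nat \<Rightarrow> nat \<Rightarrow> part set) \<Rightarrow> complex \<Rightarrow> (nat, lincomb) preadd" where
  "Rep0 C t = \<lparr>
     Ob = UNIV,
     Hom = (\<lambda>k l. {f. \<forall>p. p \<notin> C k l \<longrightarrow> f p = 0}),
     Id = (\<lambda>k. basis (id_part k)),
     Comp = (\<lambda>k l m g f r.
       \<Sum>p\<in>C k l. \<Sum>q\<in>C l m. g q * f p * t ^ loops q p * basis (pcomp q p) r) \<rparr>"

definition Rep :: "(nat \<Rightarrow> nat \<Rightarrow> part set) \<Rightarrow> complex \<Rightarrow>
    (nat list \<times> (nat \<Rightarrow> nat \<Rightarrow> lincomb), nat \<Rightarrow> nat \<Rightarrow> lincomb) preadd" where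
  "Rep C t = karoubi (Rep0 C t)"

definition RepB :: "complex \<Rightarrow>
    (nat list \<times> (nat \<Rightarrow> nat \<Rightarrow> lincomb), nat \<Rightarrow> nat \<Rightarrow> lincomb) preadd" where
  "RepB t = Rep NCb_sharp t"

section \<open>Lifted idempotents\<close>

abbreviation mult :: "complex \<Rightarrow> nat \<Rightarrow> lincomb \<Rightarrow> lincomb \<Rightarrow> lincomb" where
  "mult t k g f \<equiv> Comp (Rep0 NCb_sharp t) k k k g f"

definition corner :: "complex \<Rightarrow> nat \<Rightarrow> part \<Rightarrow> lincomb set" where
  "corner t k p =
     {mult t k (basis p) (mult t k x (basis p)) |x. x \<in> Hom (Rep0 NCb_sharp t) k k}"

definition lower_ideal :: "complex \<Rightarrow> nat \<Rightarrow> part \<Rightarrow> lincomb set" where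
  "lower_ideal t k p =
     {x \<in> corner t k p. \<forall>q. x q \<noteq> 0 \<longrightarrow> through_blocks q < through_blocks p}"

definition primitive_idempotent :: "complex \<Rightarrow> nat \<Rightarrow> lincomb set \<Rightarrow> lincomb \<Rightarrow> bool" where
  "primitive_idempotent t k R e \<longleftrightarrow>
     e \<in> R \<and> mult t k e e = e \<and> e \<noteq> 0 \<and>
     (\<forall>e1 \<in> R. \<forall>e2 \<in> R.
        mult t k e1 e1 = e1 \<and> mult t k e2 e2 = e2 \<and>
        mult t k e1 e2 = 0 \<and> mult t k e2 e1 = 0 \<and> e = e1 + e2 \<longrightarrow> e1 = 0 \<or> e2 = 0)"

definition lifted_idempotent :: "complex \<Rightarrow> nat \<Rightarrow> part \<Rightarrow> lincomb \<Rightarrow> bool" where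
  "lifted_idempotent t k p e \<longleftrightarrow>
     primitive_idempotent t k (corner t k p) e \<and>
     e - (\<lambda>q. inverse (t ^ loops p p) * basis p q) \<in> lower_ideal t k p"

definition p_part :: "nat \<Rightarrow> nat list \<Rightarrow> part" where
  "p_part k m = {{Up i, Lo i} |i. i \<in> {1..k} - set m}
     \<union> {{Up i} |i. i \<in> set m} \<union> {{Lo i} |i. i \<in> set m}"

definition index_pairs :: "(nat \<times> nat list) set" where
  "index_pairs = {(k, m). set m \<subseteq> {1..k} \<and>
     (\<forall>i. Suc i < length m \<longrightarrow> int (m ! Suc i) - int (m ! i) \<ge> 2)}"

text \<open>All objects isomorphic to the image of some lifted idempotent. This is a single isomorphism
  class exactly because lifted idempotents exist and are unique up to conjugation; the definition
  avoids choosing one of them, and if existence or uniqueness failed its value would not be an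
  isomorphism class.\<close>

definition phi :: "complex \<Rightarrow> nat \<times> nat list \<Rightarrow>
    (nat list \<times> (nat \<Rightarrow> nat \<Rightarrow> lincomb)) set" where
  "phi t = (\<lambda>(k, m). \<Union>{iso_rel (RepB t) `` {image_object k e} |e.
     lifted_idempotent t k (p_part k m) e})"

end

theory Submission
  imports Defs
begin

text \<open>
  A partition is determined by the labellings of its points that are constant on blocks, and
  \<open>q \<cdot> p\<close> corresponds to the composite of the two relations between labellings of the rows. Counting
  labellings of the middle row by truth values gives \<open>2 ^ loops q p\<close>, whence the associativity of
  the composition including the powers of \<open>t\<close>.

  Label the pair blocks of a partition by letters and the singletons by one common letter. If the
  partition lies in \<open>NCb_sharp\<close>, then its two rows, read as words in a free product of groups of
  order two, have the same value; this property is visibly stable under the category operations.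
  Hence if no row contains two adjacent equal letters, the rows agree and the partition is some
  \<open>p_part k m\<close> with \<open>(k, m) \<in> index_pairs\<close>. Cancelling adjacent equal letters shows that every
  partition in \<open>NCb_sharp\<close> factors through some \<open>p_part k m\<close> without more through-blocks.

  The morphism spaces are finite-dimensional, so by Fitting's lemma indecomposable objects of the
  Karoubi envelope have local endomorphism rings. An indecomposable object is therefore a retract of
  the image of some \<open>p_part k m\<close>. If the number of through-blocks is minimal, it is isomorphic to the
  image of the lifted idempotent, and the filtration by through-blocks separates these images.
\<close>

section \<open>Partitions and labellings\<close>

text \<open>\<open>NCb_sharp\<close> is an intersection, so its elements are not given explicitly.
  It is enclosed between \<open>balanced\<close>, which only has to recognise partitions without
  cancellation, and the partitions that can be built from the generators. The gap of two in
  \<open>index_pairs\<close> is the reducedness of the word of a row: all singletons carry one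
  letter, so two neighbouring ones would cancel. For \<open>p = p_part k m\<close> the decisive fact
  is that \<open>p\<close> is the only partition with as many through-blocks as \<open>p\<close> in
  the support of the corner. The coefficient at \<open>p\<close>, rescaled by
  \<open>t ^ loops p p\<close>, is therefore the algebra map from the corner to its quotient, the
  complex numbers, and a lifted idempotent is a primitive idempotent with nonzero coefficient at
  \<open>p\<close>. Here \<open>t \<noteq> 0\<close> enters: it makes \<open>p\<close> proportional
  to an idempotent. Nonvanishing of this coefficient also gives a lower bound: a lifted image that
  is a retract of the image of some \<open>p_part n s\<close> forces more through-blocks there, or
  the same pair. The remainder beside the lifted idempotent uses strictly fewer, so the descent ends
  and the classes stay apart.\<close>

definition sat :: "part \<Rightarrow> (nat \<Rightarrow> 'a) \<Rightarrow> (nat \<Rightarrow> 'a) \<Rightarrow> bool" where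
  "sat p x y \<longleftrightarrow> (\<forall>b\<in>p. \<forall>u\<in>b. \<forall>v\<in>b. case_point x y u = case_point x y v)"

lemma satD:
  "sat p x y \<Longrightarrow> b \<in> p \<Longrightarrow> u \<in> b \<Longrightarrow> v \<in> b \<Longrightarrow> case_point x y u = case_point x y v"
  unfolding sat_def by (drule (1) bspec)+

lemma P_iff: "p \<in> P k l \<longleftrightarrow> partition_on (points k l) p"
  by (simp add: P_def)

lemma finite_points [simp]: "finite (points k l)"
  by (simp add: points_def)

lemma points_simps [simp]:
  "Up i \<in> points k l \<longleftrightarrow> i \<in> {1..k}" "Lo i \<in> points k l \<longleftrightarrow> i \<in> {1..l}"
  by (auto simp: points_def)

lemma finite_P [simp]: "finite (P k l)"
proof -
  have "P k l \<subseteq> Pow (Pow (points k l))"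
    unfolding P_def partition_on_def by blast
  then show ?thesis
    by (rule finite_subset) simp
qed

lemma P_block_subset: "p \<in> P k l \<Longrightarrow> b \<in> p \<Longrightarrow> b \<subseteq> points k l"
  by (auto simp: P_iff partition_on_def)

lemma P_block_eq: "p \<in> P k l \<Longrightarrow> b \<in> p \<Longrightarrow> c \<in> p \<Longrightarrow> u \<in> b \<Longrightarrow> u \<in> c \<Longrightarrow> b = c"
  by (auto simp: P_iff partition_on_def disjoint_def)

lemma P_block_ne: "p \<in> P k l \<Longrightarrow> b \<in> p \<Longrightarrow> b \<noteq> {}"
  by (auto simp: P_iff partition_on_def)

lemma P_obtain_block:
  assumes "p \<in> P k l" "u \<in> points k l"
  obtains b where "b \<in> p" "u \<in> b"
  using assms by (auto simp: P_iff partition_on_def)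

lemma P_finite_block: "p \<in> P k l \<Longrightarrow> b \<in> p \<Longrightarrow> finite b"
  using P_block_subset finite_points finite_subset by metis

lemma P_finite: "p \<in> P k l \<Longrightarrow> finite p"
  by (metis P_iff finite_elements finite_points)

lemma PI:
  assumes "\<And>b. b \<in> p \<Longrightarrow> b \<noteq> {}" "\<And>b. b \<in> p \<Longrightarrow> b \<subseteq> points k l"
    and "\<And>u. u \<in> points k l \<Longrightarrow> \<exists>b\<in>p. u \<in> b"
    and "\<And>b c u. b \<in> p \<Longrightarrow> c \<in> p \<Longrightarrow> u \<in> b \<Longrightarrow> u \<in> c \<Longrightarrow> b = c"
  shows "p \<in> P k l"
  unfolding P_iff
proof (rule partition_onI)
  show "\<Union>p = points k l"
    using assms(2,3) by blast
  show "disjnt b c" if "b \<in> p" "c \<in> p" "b \<noteq> c" for b c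
    using assms(4) that by (auto simp: disjnt_def)
qed (use assms(1) in auto)

lemma sat_cong:
  assumes "p \<in> P k l" "\<And>i. i \<in> {1..k} \<Longrightarrow> x i = x' i" "\<And>i. i \<in> {1..l} \<Longrightarrow> y i = y' i"
  shows "sat p x y \<longleftrightarrow> sat p x' y'"
proof -
  have *: "case_point x y u = case_point x' y' u" if "b \<in> p" "u \<in> b" for b u
    using P_block_subset[OF assms(1) that(1)] that(2) assms(2,3)
    by (cases u) auto
  then show ?thesis
    unfolding sat_def by (intro ball_cong refl) (simp add: *)
qed

lemma case_point_Up_Lo: "case_point (X \<circ> Up) (X \<circ> Lo) = X"
  by (auto simp: fun_eq_iff split: point.split)

lemma sat_Up_Lo: "sat p (X \<circ> Up) (X \<circ> Lo) \<longleftrightarrow> (\<forall>b\<in>p. \<forall>u\<in>b. \<forall>v\<in>b. X u = X v)"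
  by (simp add: sat_def case_point_Up_Lo)

lemma sat_indicator:
  assumes "p \<in> P k l" "b \<in> p"
  shows "sat p ((\<lambda>u. u \<in> b) \<circ> Up) ((\<lambda>u. u \<in> b) \<circ> Lo)"
  unfolding sat_Up_Lo using P_block_eq[OF assms(1)] assms(2) by blast

text \<open>The indicator of a block \<open>b\<close> of \<open>p\<close> respects
  \<open>p'\<close>, so the block \<open>c\<close> of \<open>p'\<close> through a point of
  \<open>b\<close> lies inside \<open>b\<close>; the indicator of \<open>c\<close> gives the
  converse. Two labels therefore suffice to tell partitions apart.\<close>

lemma P_eqI:
  assumes p: "p \<in> P k l" "p' \<in> P k l"
    and eq: "\<And>x y :: nat \<Rightarrow> bool. sat p x y \<longleftrightarrow> sat p' x y"
  shows "p = p'"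
proof -
  have sub: "p \<subseteq> p'" if p: "p \<in> P k l" "p' \<in> P k l"
    and eq: "\<And>x y :: nat \<Rightarrow> bool. sat p x y \<longleftrightarrow> sat p' x y" for p p'
  proof
    fix b assume b: "b \<in> p"
    obtain u where u: "u \<in> b"
      using P_block_ne[OF p(1) b] by blast
    obtain c where c: "c \<in> p'" "u \<in> c"
      using P_obtain_block[OF p(2)] P_block_subset[OF p(1) b] u by blast
    have "\<forall>d\<in>p'. \<forall>u\<in>d. \<forall>v\<in>d. u \<in> b \<longleftrightarrow> v \<in> b"
      using eq[THEN iffD1, OF sat_indicator[OF p(1) b]] by (simp only: sat_Up_Lo)
    then have "v \<in> b" if "v \<in> c" for v
      using c u that by blast
    moreover have "\<forall>d\<in>p. \<forall>u\<in>d. \<forall>v\<in>d. u \<in> c \<longleftrightarrow> v \<in> c"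
      using eq[THEN iffD2, OF sat_indicator[OF p(2) c(1)]] by (simp only: sat_Up_Lo)
    then have "v \<in> c" if "v \<in> b" for v
      using c b u that by blast
    ultimately have "b = c"
      by (intro set_eqI iffI)
    then show "b \<in> p'"
      using c by simp
  qed
  show ?thesis
    using sub[OF p eq] sub[OF p(2,1) eq[symmetric]] by blast
qed

text \<open>Freedom of a label is a property of the relation \<open>sat p\<close>, so it can be
  traced through compositions, where blocks are awkward to follow.\<close>

lemma singleton_Up_iff:
  assumes p: "p \<in> P k l" and i: "i \<in> {1..k}"
  shows "{Up i} \<in> p \<longleftrightarrow> (\<forall>x y :: nat \<Rightarrow> bool. \<forall>a. sat p x y \<longrightarrow> sat p (x(i := a)) y)"
proof
  assume s: "{Up i} \<in> p"
  show "\<forall>x y :: nat \<Rightarrow> bool. \<forall>a. sat p x y \<longrightarrow> sat p (x(i := a)) y"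
  proof (intro allI impI)
    fix x y :: "nat \<Rightarrow> bool" and a assume *: "sat p x y"
    show "sat p (x(i := a)) y"
      unfolding sat_def
    proof (intro ballI)
      fix b u v assume b: "b \<in> p" "u \<in> b" "v \<in> b"
      show "case_point (x(i := a)) y u = case_point (x(i := a)) y v"
      proof (cases "Up i \<in> b")
        case True
        then have "b = {Up i}"
          using P_block_eq[OF p b(1) s] by blast
        then show ?thesis
          using b by simp
      next
        case False
        then have "case_point (x(i := a)) y w = case_point x y w" if "w \<in> b" for w
          using that by (auto split: point.split)
        then show ?thesis
          using * b unfolding sat_def by metis
      qed
    qed
  qed
next
  assume *: "\<forall>x y :: nat \<Rightarrow> bool. \<forall>a. sat p x y \<longrightarrow> sat p (x(i := a)) y"
  obtain b where b: "b \<in> p" "Up i \<in> b"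
    using P_obtain_block[OF p, of "Up i"] i by auto
  \<comment> \<open>Lowering the indicator of \<open>b\<close> at \<open>Up i\<close> forces the
    value \<open>False\<close> on all of \<open>b\<close>, which leaves no second point.\<close>
  have "sat p (((\<lambda>u. u \<in> b) \<circ> Up)(i := False)) ((\<lambda>u. u \<in> b) \<circ> Lo)"
    using * sat_indicator[OF p b(1)] by blast
  then have *: "case_point (((\<lambda>u. u \<in> b) \<circ> Up)(i := False)) ((\<lambda>u. u \<in> b) \<circ> Lo) v =
      case_point (((\<lambda>u. u \<in> b) \<circ> Up)(i := False)) ((\<lambda>u. u \<in> b) \<circ> Lo) (Up i)" if "v \<in> b" for v
    unfolding sat_def using b that by blast
  have "v = Up i" if "v \<in> b" for v
    using *[OF that] that by (cases v) (auto split: if_splits)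
  then show "{Up i} \<in> p"
    using b by (metis insertI1 is_singletonI' is_singleton_def singletonD empty_iff)
qed

section \<open>Involution and tensor product\<close>

lemma flip_flip [simp]: "flip (flip u) = u"
  by (cases u) auto

lemma flip_points: "flip ` points k l = points l k"
  by (force simp: points_def image_Un image_image)

lemma inj_flip: "inj flip"
  by (metis flip_flip injI)

lemma inj_shift: "inj (shift k l)"
proof
  fix u v assume "shift k l u = shift k l v"
  then show "u = v"
    by (cases u; cases v) auto
qed

lemma star_star [simp]: "star (star p) = p"
  by (simp add: star_def image_image)

lemma star_in_iff: "b \<in> star p \<longleftrightarrow> flip ` b \<in> p"
  by (auto simp: star_def image_image image_iff intro!: bexI[of _ "flip ` b"])

lemma star_P: "p \<in> P k l \<Longrightarrow> star p \<in> P l k"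
proof -
  assume p: "p \<in> P k l"
  then have "partition_on (flip ` points k l) ((`) flip ` p - {{}})"
    by (intro partition_on_inj_image) (auto simp: P_iff intro: inj_on_subset[OF inj_flip])
  moreover have "{} \<notin> (`) flip ` p"
    using P_block_ne[OF p] by blast
  ultimately have "partition_on (flip ` points k l) ((`) flip ` p)"
    by simp
  then show ?thesis
    by (simp add: P_iff star_def flip_points)
qed

lemma case_point_flip: "case_point x y (flip u) = case_point y x u"
  by (cases u) auto

lemma sat_star: "sat (star p) x y \<longleftrightarrow> sat p y x"
  by (simp add: sat_def star_def case_point_flip)

lemma shift_points: "points k l \<union> shift k l ` points k' l' = points (k + k') (l + l')"
proof (rule set_eqI)
  have *: "Up i = shift k l (Up (i - k))" if "i > k" for i
    using that by simp
  have **: "Lo i = shift k l (Lo (i - l))" if "i > l" for i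
    using that by simp
  show "u \<in> points k l \<union> shift k l ` points k' l' \<longleftrightarrow> u \<in> points (k + k') (l + l')" for u
  proof (cases u)
    case (Up i)
    have "Up i \<in> shift k l ` points k' l' \<longleftrightarrow> k < i \<and> i \<le> k + k'"
      using *[of i] by (auto simp: points_def simp del: shift.simps intro!: image_eqI) auto
    then show ?thesis
      using Up by auto
  next
    case (Lo i)
    have "Lo i \<in> shift k l ` points k' l' \<longleftrightarrow> l < i \<and> i \<le> l + l'"
      using **[of i] by (auto simp: points_def simp del: shift.simps intro!: image_eqI) auto
    then show ?thesis
      using Lo by auto
  qed
qed

lemma tensor_P:
  assumes p: "p \<in> P k l" and q: "q \<in> P k' l'"
  shows "tensor k l p q \<in> P (k + k') (l + l')"
proof -
  have "partition_on (shift k l ` points k' l') ((`) (shift k l) ` q - {{}})"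
    using q by (intro partition_on_inj_image) (auto simp: P_iff intro: inj_on_subset[OF inj_shift])
  moreover have "{} \<notin> (`) (shift k l) ` q"
    using P_block_ne[OF q] by blast
  ultimately have q': "partition_on (shift k l ` points k' l') ((`) (shift k l) ` q)"
    by simp
  have d: "points k l \<inter> shift k l ` points k' l' = {}"
    by (auto simp: points_def)
  have "partition_on (points k l \<union> shift k l ` points k' l') (p \<union> (`) (shift k l) ` q)"
  proof -
    have "disjoint (p \<union> (`) (shift k l) ` q)"
      using p q' d unfolding partition_on_def P_iff by (intro disjoint_union) simp_all
    then show ?thesis
      using p q' unfolding partition_on_def P_iff by simp
  qed
  then show ?thesis
    by (simp add: P_iff tensor_def shift_points)
qed

lemma case_point_shift: "case_point x y (shift k l u) = case_point (\<lambda>i. x (k + i)) (\<lambda>i. y (l + i)) u"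
  by (cases u) auto

lemma sat_tensor:
  "sat (tensor k l p q) x y \<longleftrightarrow> sat p x y \<and> sat q (\<lambda>i. x (k + i)) (\<lambda>i. y (l + i))"
  by (simp add: sat_def tensor_def ball_Un case_point_shift)

subsection \<open>Composition\<close>

definition spoints :: "nat \<Rightarrow> nat \<Rightarrow> nat \<Rightarrow> spoint set" where
  "spoints k l m = Top ` {1..k} \<union> Mid ` {1..l} \<union> Bot ` {1..m}"

lemma spoints_simps [simp]:
  "Top i \<in> spoints k l m \<longleftrightarrow> i \<in> {1..k}" "Mid i \<in> spoints k l m \<longleftrightarrow> i \<in> {1..l}"
  "Bot i \<in> spoints k l m \<longleftrightarrow> i \<in> {1..m}"
  by (auto simp: spoints_def)

lemma inj_upper_half: "inj upper_half"
proof
  fix u v assume "upper_half u = upper_half v"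
  then show "u = v"
    by (cases u; cases v) auto
qed

lemma inj_lower_half: "inj lower_half"
proof
  fix u v assume "lower_half u = lower_half v"
  then show "u = v"
    by (cases u; cases v) auto
qed

locale composable =
  fixes p q :: part and k l m :: nat
  assumes p: "p \<in> P k l" and q: "q \<in> P l m"
begin

lemma Union_stack: "\<Union>(stack q p) = spoints k l m"
proof -
  have "\<Union>(stack q p) = upper_half ` \<Union>p \<union> lower_half ` \<Union>q"
    unfolding stack_def by blast
  also have "\<dots> = upper_half ` points k l \<union> lower_half ` points l m"
    using p q by (simp add: P_iff partition_on_def)
  finally have "\<Union>(stack q p) = upper_half ` points k l \<union> lower_half ` points l m" .
  then show ?thesis
    by (auto simp: points_def spoints_def image_Un image_image)
qed

definition linked :: "spoint rel" where
  "linked = (\<Union>b\<in>stack q p. b \<times> b)\<^sup>+"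

lemma equiv_linked: "equiv (spoints k l m) linked"
proof (rule equivI)
  have "(\<Union>b\<in>stack q p. b \<times> b) \<subseteq> spoints k l m \<times> spoints k l m"
    using Union_stack by blast
  then show "linked \<subseteq> spoints k l m \<times> spoints k l m"
    unfolding linked_def by (rule trancl_subset_Sigma)
  show "refl_on (spoints k l m) linked"
    unfolding refl_on_def linked_def using Union_stack by blast
  have "sym (\<Union>b\<in>stack q p. b \<times> b)"
    by (auto simp: sym_def)
  then show "sym linked"
    unfolding linked_def by (rule sym_trancl)
  show "trans linked"
    by (simp add: linked_def)
qed

lemma components_eq: "components q p = spoints k l m // linked"
  by (simp add: components_def Union_stack linked_def)

lemma partition_components: "partition_on (spoints k l m) (components q p)"
  unfolding components_eq by (rule partition_on_quotient[OF equiv_linked])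

lemma component_subset: "c \<in> components q p \<Longrightarrow> c \<subseteq> spoints k l m"
  using partition_components by (auto simp: partition_on_def)

lemma component_eq:
  "c \<in> components q p \<Longrightarrow> d \<in> components q p \<Longrightarrow> u \<in> c \<Longrightarrow> u \<in> d \<Longrightarrow> c = d"
  using partition_components by (auto simp: partition_on_def disjoint_def)

lemma component_ne: "c \<in> components q p \<Longrightarrow> c \<noteq> {}"
  using partition_components by (auto simp: partition_on_def)

lemma obtain_component:
  assumes "u \<in> spoints k l m"
  obtains c where "c \<in> components q p" "u \<in> c"
  using assms partition_components by (auto simp: partition_on_def)

lemma finite_components: "finite (components q p)"
  using partition_components by (rule finite_elements[rotated]) (simp add: spoints_def)

lemma component_linked: "c \<in> components q p \<Longrightarrow> u \<in> c \<Longrightarrow> v \<in> c \<Longrightarrow> (u, v) \<in> linked"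
  unfolding components_eq using quotient_eq_iff[OF equiv_linked, of c c u v] by auto

text \<open>Constancy passes along chains of overlapping blocks, so labellings of the stack may be
  tested on components.\<close>

lemma constant_on_components:
  "(\<forall>b\<in>stack q p. \<forall>u\<in>b. \<forall>v\<in>b. w u = w v) \<longleftrightarrow>
   (\<forall>c\<in>components q p. \<forall>u\<in>c. \<forall>v\<in>c. w u = w v)"
proof
  assume *: "\<forall>b\<in>stack q p. \<forall>u\<in>b. \<forall>v\<in>b. w u = w v"
  have "w u = w v" if "(u, v) \<in> linked" for u v
    using that unfolding linked_def
    by (induction rule: trancl_induct) (use * in fastforce)+
  then show "\<forall>c\<in>components q p. \<forall>u\<in>c. \<forall>v\<in>c. w u = w v"
    using component_linked by blast
next
  assume *: "\<forall>c\<in>components q p. \<forall>u\<in>c. \<forall>v\<in>c. w u = w v"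
  show "\<forall>b\<in>stack q p. \<forall>u\<in>b. \<forall>v\<in>b. w u = w v"
  proof (intro ballI)
    fix b u v assume b: "b \<in> stack q p" "u \<in> b" "v \<in> b"
    then have "(u, v) \<in> linked"
      unfolding linked_def by blast
    moreover have "u \<in> spoints k l m"
      using b Union_stack by blast
    ultimately have "linked `` {u} \<in> components q p" "u \<in> linked `` {u}" "v \<in> linked `` {u}"
      unfolding components_eq using equiv_class_self[OF equiv_linked] by (auto intro: quotientI)
    then show "w u = w v"
      using * by blast
  qed
qed

lemma sat_stack:
  "sat p x y \<and> sat q y z \<longleftrightarrow>
   (\<forall>c\<in>components q p. \<forall>u\<in>c. \<forall>v\<in>c. case_spoint x y z u = case_spoint x y z v)"
proof -
  have *: "case_spoint x y z (upper_half u) = case_point x y u"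
    "case_spoint x y z (lower_half u) = case_point y z u" for u
    by (cases u; simp)+
  show ?thesis
    unfolding constant_on_components[symmetric] stack_def sat_def by (simp add: ball_Un *)
qed

lemma sat_stackD:
  assumes "sat p x y" "sat q y z" "c \<in> components q p" "u \<in> c" "v \<in> c"
  shows "case_spoint x y z u = case_spoint x y z v"
  using sat_stack[THEN iffD1, OF conjI[OF assms(1,2)], THEN bspec, THEN bspec, THEN bspec, OF assms(3-5)] .

definition outer :: "spoint set \<Rightarrow> point set" where
  "outer c = {Up i |i. Top i \<in> c} \<union> {Lo i |i. Bot i \<in> c}"

lemma outer_simps [simp]: "Up i \<in> outer c \<longleftrightarrow> Top i \<in> c" "Lo i \<in> outer c \<longleftrightarrow> Bot i \<in> c"
  by (auto simp: outer_def)

lemma outer_empty_iff: "outer c = {} \<longleftrightarrow> c \<subseteq> range Mid"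
  unfolding outer_def by (auto simp: subset_iff image_iff) (metis spoint.exhaust)

lemma pcomp_eq: "pcomp q p = outer ` components q p - {{}}"
  by (simp add: pcomp_def outer_def[abs_def])

lemma pcomp_P: "pcomp q p \<in> P k m"
proof (rule PI)
  show "b \<noteq> {}" if "b \<in> pcomp q p" for b
    using that by (simp add: pcomp_eq)
  show "b \<subseteq> points k m" if b: "b \<in> pcomp q p" for b
  proof
    fix u assume "u \<in> b"
    then show "u \<in> points k m"
      using b component_subset by (cases u) (fastforce simp: pcomp_eq)+
  qed
  show "\<exists>b\<in>pcomp q p. u \<in> b" if u: "u \<in> points k m" for u
  proof -
    have "(case u of Up i \<Rightarrow> Top i | Lo i \<Rightarrow> Bot i) \<in> spoints k l m"
      using u by (cases u) auto
    then obtain c where c: "c \<in> components q p" "(case u of Up i \<Rightarrow> Top i | Lo i \<Rightarrow> Bot i) \<in> c"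
      by (rule obtain_component)
    then have "u \<in> outer c"
      by (cases u) auto
    then show ?thesis
      using c by (auto simp: pcomp_eq)
  qed
  show "b = c" if "b \<in> pcomp q p" "c \<in> pcomp q p" "u \<in> b" "u \<in> c" for b c u
    using that component_eq by (cases u) (fastforce simp: pcomp_eq)+
qed

lemma sat_pcompD:
  assumes "sat p x y" "sat q y z"
  shows "sat (pcomp q p) x z"
  unfolding sat_def
proof (intro ballI)
  fix b u v assume "b \<in> pcomp q p" "u \<in> b" "v \<in> b"
  then obtain c where c: "c \<in> components q p" "u \<in> outer c" "v \<in> outer c"
    by (auto simp: pcomp_eq)
  from sat_stackD[OF assms c(1), of "case u of Up i \<Rightarrow> Top i | Lo i \<Rightarrow> Bot i" "case v of Up i \<Rightarrow> Top i | Lo i \<Rightarrow> Bot i"]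
  show "case_point x z u = case_point x z v"
    using c by (cases u; cases v) auto
qed

text \<open>The values on the components consisting of middle points are free; \<open>d\<close> prescribes them.\<close>

definition fill :: "(nat \<Rightarrow> 'a) \<Rightarrow> (nat \<Rightarrow> 'a) \<Rightarrow> (spoint set \<Rightarrow> 'a) \<Rightarrow> nat \<Rightarrow> 'a" where
  "fill x z d j = (let c = (THE c. c \<in> components q p \<and> Mid j \<in> c) in
     if outer c = {} then d c else case_point x z (SOME u. u \<in> outer c))"

lemma fill_eq:
  assumes "c \<in> components q p" "Mid j \<in> c"
  shows "fill x z d j = (if outer c = {} then d c else case_point x z (SOME u. u \<in> outer c))"
proof -
  have "(THE c. c \<in> components q p \<and> Mid j \<in> c) = c"
  proof (rule the_equality)
    show "d = c" if "d \<in> components q p \<and> Mid j \<in> d" for d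
      by (rule component_eq) (use assms that in simp_all)
  qed (simp add: assms)
  then show ?thesis
    unfolding fill_def Let_def by simp
qed

lemma sat_fill:
  assumes "sat (pcomp q p) x z"
  shows "sat p x (fill x z d) \<and> sat q (fill x z d) z"
  unfolding sat_stack
proof (intro ballI)
  fix c u v assume c: "c \<in> components q p" "u \<in> c" "v \<in> c"
  \<comment> \<open>The common value on \<open>c\<close>: prescribed by \<open>d\<close> if there
    are no outer points, otherwise read off at any outer point, since \<open>outer c\<close> is then
    a block of the composite.\<close>
  define a where "a = (if outer c = {} then d c else case_point x z (SOME u. u \<in> outer c))"
  have "case_spoint x (fill x z d) z u = a" if "u \<in> c" for u
  proof -
    have *: "case_point x z w = a" if "w \<in> outer c" for w
    proof -
      have "outer c \<in> pcomp q p"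
        using that c by (auto simp: pcomp_eq)
      moreover have "(SOME u. u \<in> outer c) \<in> outer c"
        using that by (rule someI)
      ultimately show ?thesis
        using satD[OF assms, of "outer c" w "SOME u. u \<in> outer c"] that by (auto simp: a_def)
    qed
    show ?thesis
    proof (cases u)
      case (Top i)
      then show ?thesis using *[of "Up i"] that by simp
    next
      case (Mid i)
      then show ?thesis using fill_eq[OF c(1), of i x z d] that by (simp add: a_def)
    next
      case (Bot i)
      then show ?thesis using *[of "Lo i"] that by simp
    qed
  qed
  then show "case_spoint x (fill x z d) z u = case_spoint x (fill x z d) z v"
    using c by metis
qed

lemma sat_pcomp: "sat (pcomp q p) x z \<longleftrightarrow> (\<exists>y. sat p x y \<and> sat q y z)"
  using sat_pcompD sat_fill by blast

text \<open>A component that meets an outer row has its value forced, while each component of middle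
  points chooses a truth value freely. This turns statements about \<open>loops\<close> into counts
  of labellings; subsets of \<open>{1..l}\<close> encode the labels of the middle row so that only
  finitely many occur.\<close>

lemma card_fillings:
  fixes x z :: "nat \<Rightarrow> bool"
  assumes xz: "sat (pcomp q p) x z"
  shows "card {Y. Y \<subseteq> {1..l} \<and> sat p x (\<lambda>j. j \<in> Y) \<and> sat q (\<lambda>j. j \<in> Y) z} = 2 ^ loops q p"
    (is "card ?A = _")
proof -
  define M where "M = {c \<in> components q p. c \<subseteq> range Mid}"
  define F where "F S = {j \<in> {1..l}. fill x z (\<lambda>c. c \<in> S) j}" for S
  have "bij_betw F (Pow M) ?A"
    unfolding bij_betw_def
  proof (intro conjI)
    show "inj_on F (Pow M)"
    proof (rule inj_onI)
      fix S T assume *: "S \<in> Pow M" "T \<in> Pow M" "F S = F T"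
      have "c \<in> S \<longleftrightarrow> c \<in> T" if cM: "c \<in> M" for c
      proof -
        obtain j where j: "Mid j \<in> c"
          using cM component_ne[of c] unfolding M_def by blast
        have c: "c \<in> components q p" "outer c = {}"
          using that by (auto simp: M_def outer_empty_iff)
        have "j \<in> {1..l}"
          using component_subset[OF c(1)] j by auto
        then have "j \<in> F R \<longleftrightarrow> c \<in> R" for R
          using fill_eq[OF c(1) j, of x z] c(2) by (simp add: F_def)
        then show ?thesis
          using *(3) by blast
      qed
      then show "S = T"
        using * by blast
    qed
    show "F ` Pow M = ?A"
    proof (intro equalityI subsetI)
      fix Y assume "Y \<in> F ` Pow M"
      then obtain S where Y: "Y = F S"
        by blast
      have "sat p x (\<lambda>j. j \<in> Y) \<longleftrightarrow> sat p x (fill x z (\<lambda>c. c \<in> S))"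
        "sat q (\<lambda>j. j \<in> Y) z \<longleftrightarrow> sat q (fill x z (\<lambda>c. c \<in> S)) z"
        by (rule sat_cong[OF p] sat_cong[OF q]; simp add: Y F_def)+
      then show "Y \<in> ?A"
        using sat_fill[OF xz] by (auto simp: Y F_def)
    next
      fix Y assume Y: "Y \<in> ?A"
      \<comment> \<open>The preimage of \<open>Y\<close> under \<open>F\<close>: the purely middle
        components on which \<open>Y\<close> is true.\<close>
      define S where "S = {c \<in> M. \<exists>j. Mid j \<in> c \<and> j \<in> Y}"
      have const: "case_spoint x (\<lambda>j. j \<in> Y) z u = case_spoint x (\<lambda>j. j \<in> Y) z v"
        if "c \<in> components q p" "u \<in> c" "v \<in> c" for c u v
        using sat_stackD[OF _ _ that] Y by blast
      have "fill x z (\<lambda>c. c \<in> S) j \<longleftrightarrow> j \<in> Y" if j: "j \<in> {1..l}" for j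
      proof -
        obtain c where c: "c \<in> components q p" "Mid j \<in> c"
          using obtain_component[of "Mid j"] j by auto
        show ?thesis
        proof (cases "outer c = {}")
          case True
          then have "c \<in> S \<longleftrightarrow> (\<exists>i. Mid i \<in> c \<and> i \<in> Y)"
            using c(1) by (simp add: S_def M_def outer_empty_iff)
          also have "\<dots> \<longleftrightarrow> j \<in> Y"
          proof -
            have "j \<in> Y \<longleftrightarrow> i \<in> Y" if "Mid i \<in> c" for i
              using const[OF c(1) c(2) that] by simp
            then show ?thesis
              using c(2) by blast
          qed
          finally show ?thesis
            using True fill_eq[OF c, of x z] by simp
        next
          case False
          define w where "w = (SOME u. u \<in> outer c)"
          have "w \<in> outer c"
            unfolding w_def using False by (simp add: some_in_eq)
          then have "case_point x z w \<longleftrightarrow> j \<in> Y"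
            using const[OF c(1) c(2), of "case w of Up i \<Rightarrow> Top i | Lo i \<Rightarrow> Bot i"]
            by (cases w) auto
          then show ?thesis
            using False fill_eq[OF c, of x z] by (simp add: w_def)
        qed
      qed
      then have "Y = F S"
        using Y by (auto simp: F_def)
      moreover have "S \<in> Pow M"
        by (auto simp: S_def)
      ultimately show "Y \<in> F ` Pow M"
        by blast
    qed
  qed
  then have "card ?A = card (Pow M)"
    by (rule bij_betw_same_card[symmetric])
  also have "\<dots> = 2 ^ loops q p"
    using finite_components by (simp add: card_Pow M_def loops_def)
  finally show ?thesis .
qed

end

lemmas pcomp_P = composable.pcomp_P[OF composable.intro]
lemmas sat_pcomp = composable.sat_pcomp[OF composable.intro]
lemmas sat_pcompD = composable.sat_pcompD[OF composable.intro]
lemmas card_fillings = composable.card_fillings[OF composable.intro]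

text \<open>Both sides ask for labellings of the two inner rows, so this is associativity of
  relational composition.\<close>

lemma pcomp_assoc:
  assumes "p \<in> P k l" "q \<in> P l m" "r \<in> P m n"
  shows "pcomp r (pcomp q p) = pcomp (pcomp r q) p"
proof (rule P_eqI)
  show "pcomp r (pcomp q p) \<in> P k n" "pcomp (pcomp r q) p \<in> P k n"
    using assms pcomp_P by blast+
  show "sat (pcomp r (pcomp q p)) x y \<longleftrightarrow> sat (pcomp (pcomp r q) p) x y" for x y :: "nat \<Rightarrow> bool"
    using assms pcomp_P[OF assms(1,2)] pcomp_P[OF assms(2,3)] by (auto simp: sat_pcomp)
qed

lemma sat_const [simp]: "sat p (\<lambda>_. a) (\<lambda>_. a)"
proof -
  have "case_point (\<lambda>_. a) (\<lambda>_. a) u = a" for u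
    by (cases u) auto
  then show ?thesis
    by (simp add: sat_def)
qed

text \<open>Double counting of the pairs of labellings of the two inner rows: fibring over either
  row gives 2 to the power of one side. The outer rows are constantly \<open>False\<close>, which is
  always admissible.\<close>

lemma loops_assoc:
  assumes p: "p \<in> P k l" and q: "q \<in> P l m" and r: "r \<in> P m n"
  shows "loops q p + loops r (pcomp q p) = loops r q + loops (pcomp r q) p"
proof -
  let ?o = "\<lambda>_::nat. False" and ?i = "\<lambda>Y (j::nat). j \<in> Y"
  let ?A = "{(Y, Z). Y \<subseteq> {1..l} \<and> Z \<subseteq> {1..m} \<and> sat p ?o (?i Y) \<and> sat q (?i Y) (?i Z) \<and> sat r (?i Z) ?o}"
  let ?B = "{Z. Z \<subseteq> {1..m} \<and> sat (pcomp q p) ?o (?i Z) \<and> sat r (?i Z) ?o}"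
  let ?C = "\<lambda>Z. {Y. Y \<subseteq> {1..l} \<and> sat p ?o (?i Y) \<and> sat q (?i Y) (?i Z)}"
  let ?B' = "{Y. Y \<subseteq> {1..l} \<and> sat p ?o (?i Y) \<and> sat (pcomp r q) (?i Y) ?o}"
  let ?C' = "\<lambda>Y. {Z. Z \<subseteq> {1..m} \<and> sat q (?i Y) (?i Z) \<and> sat r (?i Z) ?o}"
  have pq: "pcomp q p \<in> P k m" "pcomp r q \<in> P l n"
    using assms pcomp_P by blast+
  have "?A = prod.swap ` (SIGMA Z:?B. ?C Z)"
    by (auto simp: sat_pcomp[OF p q] image_iff)
  then have "card ?A = card (SIGMA Z:?B. ?C Z)"
    by (simp add: card_image)
  also have "\<dots> = (\<Sum>Z\<in>?B. card (?C Z))"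
    by (rule card_SigmaI) auto
  also have "\<dots> = (\<Sum>Z\<in>?B. 2 ^ loops q p)"
    by (rule sum.cong[OF refl]) (use card_fillings[OF p q] in auto)
  also have "\<dots> = 2 ^ (loops q p + loops r (pcomp q p))"
    using card_fillings[OF pq(1) r, of ?o ?o] by (simp add: power_add)
  finally have 1: "card ?A = 2 ^ (loops q p + loops r (pcomp q p))" .
  have "?A = (SIGMA Y:?B'. ?C' Y)"
    by (auto simp: sat_pcomp[OF q r])
  then have "card ?A = card (SIGMA Y:?B'. ?C' Y)"
    by simp
  also have "\<dots> = (\<Sum>Y\<in>?B'. card (?C' Y))"
    by (rule card_SigmaI) auto
  also have "\<dots> = (\<Sum>Y\<in>?B'. 2 ^ loops r q)"
    by (rule sum.cong[OF refl]) (use card_fillings[OF q r] in auto)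
  also have "\<dots> = 2 ^ (loops r q + loops (pcomp r q) p)"
    using card_fillings[OF p pq(2), of ?o ?o] by (simp add: power_add)
  finally show ?thesis
    using 1 by simp
qed

lemma star_pcomp:
  assumes "p \<in> P k l" "q \<in> P l m"
  shows "star (pcomp q p) = pcomp (star p) (star q)"
proof (rule P_eqI)
  show "star (pcomp q p) \<in> P m k" "pcomp (star p) (star q) \<in> P m k"
    using assms star_P pcomp_P by blast+
  show "sat (star (pcomp q p)) x y \<longleftrightarrow> sat (pcomp (star p) (star q)) x y" for x y :: "nat \<Rightarrow> bool"
    unfolding sat_star sat_pcomp[OF assms] sat_pcomp[OF star_P[OF assms(2)] star_P[OF assms(1)]] by auto
qed

lemma p_part_P: "set m \<subseteq> {1..k} \<Longrightarrow> p_part k m \<in> P k k"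
proof (rule PI)
  fix u assume "u \<in> points k k"
  then obtain i where i: "i \<in> {1..k}" "u = Up i \<or> u = Lo i"
    by (cases u) auto
  then have "{Up i} \<in> p_part k m \<and> {Lo i} \<in> p_part k m \<or> {Up i, Lo i} \<in> p_part k m"
    by (cases "i \<in> set m") (auto simp: p_part_def)
  then show "\<exists>b\<in>p_part k m. u \<in> b"
    using i(2) by blast
qed (auto simp: p_part_def)

lemma sat_p_part:
  "sat (p_part k m) x y \<longleftrightarrow> (\<forall>i\<in>{1..k} - set m. x i = y i)"
proof
  assume *: "sat (p_part k m) x y"
  show "\<forall>i\<in>{1..k} - set m. x i = y i"
  proof
    fix i assume "i \<in> {1..k} - set m"
    then have "{Up i, Lo i} \<in> p_part k m"
      by (auto simp: p_part_def)
    from satD[OF * this, of "Up i" "Lo i"] show "x i = y i"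
      by simp
  qed
next
  assume *: "\<forall>i\<in>{1..k} - set m. x i = y i"
  show "sat (p_part k m) x y"
    unfolding sat_def
  proof (intro ballI)
    fix b u v assume "b \<in> p_part k m" "u \<in> b" "v \<in> b"
    then show "case_point x y u = case_point x y v"
      using * by (auto simp: p_part_def)
  qed
qed

lemma p_part_Nil: "p_part k [] = id_part k"
  by (simp add: p_part_def id_part_def)

lemma id_part_P: "id_part k \<in> P k k"
  using p_part_P[of "[]" k] by (simp add: p_part_Nil)

lemma sat_id_part: "sat (id_part k) x y \<longleftrightarrow> (\<forall>i\<in>{1..k}. x i = y i)"
  using sat_p_part[of k "[]" x y] by (simp add: p_part_Nil)

lemma pcomp_id_right:
  assumes "p \<in> P k l"
  shows "pcomp p (id_part k) = p"
proof (rule P_eqI)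
  show "pcomp p (id_part k) \<in> P k l" "p \<in> P k l"
    using assms id_part_P pcomp_P by blast+
  fix x z :: "nat \<Rightarrow> bool"
  have "sat p y z \<longleftrightarrow> sat p x z" if "\<forall>i\<in>{1..k}. x i = y i" for y
    using that by (intro sat_cong[OF assms]) auto
  then show "sat (pcomp p (id_part k)) x z \<longleftrightarrow> sat p x z"
    unfolding sat_pcomp[OF id_part_P assms] sat_id_part by blast
qed

lemma star_id_part: "star (id_part k) = id_part k"
  by (rule P_eqI[OF star_P[OF id_part_P] id_part_P]) (auto simp: sat_star sat_id_part)

lemma pcomp_id_left:
  assumes "p \<in> P k l"
  shows "pcomp (id_part l) p = p"
  using star_pcomp[OF assms id_part_P] pcomp_id_right[OF star_P[OF assms]]
  by (metis star_star star_id_part)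

text \<open>With both outer rows labelled \<open>False\<close>, the identity leaves exactly one
  labelling of the middle row, so \<open>2 ^ loops\<close> is 1.\<close>

lemma loops_id_right:
  assumes "p \<in> P k l"
  shows "loops p (id_part k) = 0"
proof -
  have "{Y. Y \<subseteq> {1..k} \<and> sat (id_part k) (\<lambda>_. False) (\<lambda>j. j \<in> Y) \<and> sat p (\<lambda>j. j \<in> Y) (\<lambda>_. False)} = {{}}"
    by (auto simp: sat_id_part)
  then have "2 ^ loops p (id_part k) = (1::nat)"
    using card_fillings[OF id_part_P assms, of "\<lambda>_. False" "\<lambda>_. False"] by simp
  then show ?thesis
    by simp
qed

lemma loops_id_left:
  assumes "p \<in> P k l"
  shows "loops (id_part l) p = 0"
proof -
  have "{Y. Y \<subseteq> {1..l} \<and> sat p (\<lambda>_. False) (\<lambda>j. j \<in> Y) \<and> sat (id_part l) (\<lambda>j. j \<in> Y) (\<lambda>_. False)} = {{}}"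
    by (auto simp: sat_id_part)
  then have "2 ^ loops (id_part l) p = (1::nat)"
    using card_fillings[OF assms id_part_P, of "\<lambda>_. False" "\<lambda>_. False"] by simp
  then show ?thesis
    by simp
qed

subsection \<open>Through-blocks\<close>

lemma through_blocks_star: "through_blocks (star p) = through_blocks p"
proof -
  let ?T = "\<lambda>p. {b \<in> p. (\<exists>i. Up i \<in> b) \<and> (\<exists>j. Lo j \<in> b)}"
  have *: "(`) flip ` ?T p \<subseteq> ?T (star p)" for p
  proof
    fix b assume "b \<in> (`) flip ` ?T p"
    then obtain c i j where c: "b = flip ` c" "c \<in> p" "Up i \<in> c" "Lo j \<in> c"
      by auto
    have "flip (Up i) \<in> b" "flip (Lo j) \<in> b"
      using c by blast+
    then show "b \<in> ?T (star p)"
      using c by (auto simp: star_def)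
  qed
  have "?T (star p) = (`) flip ` (`) flip ` ?T (star p)"
    by (simp add: image_image)
  also have "\<dots> \<subseteq> (`) flip ` ?T p"
    using *[of "star p"] by (intro image_mono) simp
  finally have "?T (star p) = (`) flip ` ?T p"
    using *[of p] by blast
  moreover have "inj_on ((`) flip) A" for A
    using inj_flip by (simp add: inj_on_image_eq_iff inj_on_def inj_image_eq_iff)
  ultimately show ?thesis
    by (simp add: through_blocks_def card_image)
qed

text \<open>A through-block of the composite shares an upper point with a through-block of
  \<open>p\<close>: otherwise the labelling true exactly on its upper points could be continued by
  \<open>False\<close> everywhere below, separating its upper from its lower points. Choosing such a
  block of \<open>p\<close> is injective, because all upper points of one block of \<open>p\<close>
  lie in the same block of the composite.\<close>

lemma through_blocks_pcomp_le_right: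
  assumes p: "p \<in> P k l" and q: "q \<in> P l m"
  shows "through_blocks (pcomp q p) \<le> through_blocks p"
proof -
  let ?T = "\<lambda>p. {b \<in> p. (\<exists>i. Up i \<in> b) \<and> (\<exists>j. Lo j \<in> b)}"
  note qp = pcomp_P[OF p q]
  have same: "Up i \<in> B \<longleftrightarrow> Up i' \<in> B"
    if B: "B \<in> pcomp q p" and b: "b \<in> p" "Up i \<in> b" "Up i' \<in> b" for B b i i'
  proof -
    obtain y where "sat p ((\<lambda>u. u \<in> B) \<circ> Up) y"
      using sat_indicator[OF qp B] sat_pcomp[OF p q] by blast
    from satD[OF this b] show ?thesis
      by simp
  qed
  have "\<exists>b\<in>?T p. \<exists>i. Up i \<in> b \<and> Up i \<in> B" if B: "B \<in> ?T (pcomp q p)" for B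
  proof (rule ccontr)
    assume no: "\<not> ?thesis"
    let ?x = "\<lambda>i. Up i \<in> B"
    have "sat p ?x (\<lambda>_. False)"
      unfolding sat_def
    proof (intro ballI)
      fix b u v assume b: "b \<in> p" "u \<in> b" "v \<in> b"
      show "case_point ?x (\<lambda>_. False) u = case_point ?x (\<lambda>_. False) v"
      proof -
        have no': "Up i \<notin> B" if "Up i \<in> b" "Lo j \<in> b" for i j
          using no b(1) that by blast
        have same': "Up i \<in> B \<longleftrightarrow> Up i' \<in> B" if "Up i \<in> b" "Up i' \<in> b" for i i'
          using same[OF _ b(1) that] B by blast
        show ?thesis
        proof (cases u)
          case u: (Up i)
          show ?thesis
          proof (cases v)
            case v: (Up j)
            show ?thesis
              using same'[of i j] b(2,3) by (simp add: u v)
          next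
            case v: (Lo j)
            show ?thesis
              using no'[of i j] b(2,3) by (simp add: u v)
          qed
        next
          case u: (Lo i)
          show ?thesis
            using no'[of _ i] b(2,3) by (cases v) (simp_all add: u)
        qed
      qed
    qed
    then have "sat (pcomp q p) ?x (\<lambda>_. False)"
      by (rule sat_pcompD[OF p q _ sat_const])
    moreover obtain i j where "Up i \<in> B" "Lo j \<in> B"
      using B by blast
    ultimately show False
      using B satD[of "pcomp q p" ?x "\<lambda>_. False" B "Up i" "Lo j"] by simp
  qed
  then have "\<forall>B\<in>?T (pcomp q p). \<exists>b. b \<in> ?T p \<and> (\<exists>i. Up i \<in> b \<and> Up i \<in> B)"
    by blast
  from bchoice[OF this] obtain f
    where f: "\<And>B. B \<in> ?T (pcomp q p) \<Longrightarrow> f B \<in> ?T p \<and> (\<exists>i. Up i \<in> f B \<and> Up i \<in> B)"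
    by blast
  have "inj_on f (?T (pcomp q p))"
  proof (rule inj_onI)
    fix B B' assume B: "B \<in> ?T (pcomp q p)" "B' \<in> ?T (pcomp q p)" "f B = f B'"
    obtain i where i: "Up i \<in> f B" "Up i \<in> B"
      using f[OF B(1)] by blast
    obtain i' where i': "Up i' \<in> f B" "Up i' \<in> B'"
      using f[OF B(2)] B(3) by auto
    have "Up i' \<in> B"
      using same[of B "f B" i i'] i i' f[OF B(1)] B(1) by blast
    then show "B = B'"
      using P_block_eq[OF qp] B(1,2) i'(2) by blast
  qed
  moreover have "f ` ?T (pcomp q p) \<subseteq> ?T p"
    using f by blast
  ultimately show ?thesis
    unfolding through_blocks_def using P_finite[OF p] by (intro card_inj_on_le) auto
qed

lemma through_blocks_pcomp_le_left:
  assumes "p \<in> P k l" "q \<in> P l m"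
  shows "through_blocks (pcomp q p) \<le> through_blocks q"
  using through_blocks_pcomp_le_right[OF star_P[OF assms(2)] star_P[OF assms(1)]]
  by (metis star_pcomp[OF assms] through_blocks_star)

lemma through_blocks_p_part:
  assumes "set m \<subseteq> {1..k}"
  shows "through_blocks (p_part k m) = card ({1..k} - set m)"
proof -
  have "{b \<in> p_part k m. (\<exists>i. Up i \<in> b) \<and> (\<exists>j. Lo j \<in> b)} = (\<lambda>i. {Up i, Lo i}) ` ({1..k} - set m)"
    by (auto simp: p_part_def)
  moreover have "inj_on (\<lambda>i. {Up i, Lo i}) A" for A
    by (auto simp: inj_on_def doubleton_eq_iff)
  ultimately show ?thesis
    by (simp add: through_blocks_def card_image)
qed

subsection \<open>Unions of two matchings\<close>

text \<open>A component of the union of two matchings is a path or a cycle. A vertex missed by one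
  of the matchings is an end of a path, and a path has at most one other end.\<close>

lemma two_matchings_aux:
  fixes E F :: "'v rel"
  assumes "sym E" "sym F" "single_valued E" "single_valued F" and s: "s \<notin> Domain F"
    and uv: "(s, u) \<in> (E \<union> F)\<^sup>*" "(s, v) \<in> (E \<union> F)\<^sup>*" "u \<noteq> s" "v \<noteq> s"
    "u \<notin> Domain E \<or> u \<notin> Domain F" "v \<notin> Domain E \<or> v \<notin> Domain F"
  shows "u = v"
proof -
  text \<open>Walk along the path from \<open>s\<close>, using the edges of \<open>E\<close> and \<open>F\<close> alternately; the flag
    records which kind comes next. The walk is deterministic.\<close>
  define R where "R = {((a, True), (b, False)) |a b. (a, b) \<in> E} \<union> {((a, False), (b, True)) |a b. (a, b) \<in> F}"
  have sv: "single_valued R"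
    using assms(3,4) by (auto simp: R_def single_valued_def)
  \<comment> \<open>A state other than the start was entered by an edge of the kind opposite to the
    one that comes next.\<close>
  have arr: "(a, f) = (s, True) \<or> (\<exists>b. (b, a) \<in> (if f then F else E) \<and> ((s, True), (b, \<not> f)) \<in> R\<^sup>*)"
    if "((s, True), (a, f)) \<in> R\<^sup>*" for a f
    using that by (cases rule: rtranclE) (auto simp: R_def)
  have reach: "\<exists>f. ((s, True), (a, f)) \<in> R\<^sup>*" if "(s, a) \<in> (E \<union> F)\<^sup>*" for a
    using that
  proof (induction rule: rtrancl_induct)
    case (step a b)
    then obtain f where f: "((s, True), (a, f)) \<in> R\<^sup>*"
      by blast
    have "((a, f), (b, \<not> f)) \<in> R \<or> (\<exists>g. ((s, True), (b, g)) \<in> R\<^sup>*)"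
    proof (cases "(a, b) \<in> (if f then E else F)")
      case True
      then show ?thesis by (cases f) (auto simp: R_def)
    next
      case False
      then have ab: "(a, b) \<in> (if f then F else E)"
        using step by (cases f) auto
      then have "(a, f) \<noteq> (s, True)"
        using s by auto
      then obtain b' where b': "(b', a) \<in> (if f then F else E)" "((s, True), (b', \<not> f)) \<in> R\<^sup>*"
        using arr[OF f] by blast
      \<comment> \<open>An edge of the kind just used leads back to the previous vertex, which has
        already been visited.\<close>
      have "b' = b"
        using ab b'(1) assms(1-4) unfolding sym_def single_valued_def by (cases f) (simp, metis)+
      then show ?thesis
        using b' by blast
    qed
    then show ?case
      using f by (metis rtrancl.rtrancl_into_rtrancl)
  qed auto
  \<comment> \<open>Such a vertex is entered by one kind of edge and has none of the other, so the
    walk stops there; a deterministic walk has only one final state.\<close>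
  have stuck: "(a, f) \<notin> Domain R"
    if "((s, True), (a, f)) \<in> R\<^sup>*" "a \<noteq> s" "a \<notin> Domain E \<or> a \<notin> Domain F" for a f
  proof -
    have "a \<in> Domain (if f then F else E)"
      using arr[OF that(1)] that(2) symD[OF assms(1)] symD[OF assms(2)] by (cases f) (auto; blast)+
    then show ?thesis
      using that(3) by (cases f) (auto simp: R_def)
  qed
  obtain f g where fg: "((s, True), (u, f)) \<in> R\<^sup>*" "((s, True), (v, g)) \<in> R\<^sup>*"
    using reach uv by blast
  then have "((u, f), (v, g)) \<in> R\<^sup>* \<or> ((v, g), (u, f)) \<in> R\<^sup>*"
    by (rule single_valued_confluent[OF sv])
  moreover have "(u, f) \<notin> Domain R" "(v, g) \<notin> Domain R"
    using stuck fg uv by blast+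
  ultimately have "(u, f) = (v, g)"
    by (metis converse_rtranclE Domain.DomainI)
  then show ?thesis
    by simp
qed

lemma two_matchings:
  fixes E F :: "'v rel"
  assumes "sym E" "sym F" "single_valued E" "single_valued F" "s \<notin> Domain E \<or> s \<notin> Domain F"
    and "(s, u) \<in> (E \<union> F)\<^sup>*" "(s, v) \<in> (E \<union> F)\<^sup>*" "u \<noteq> s" "v \<noteq> s"
    "u \<notin> Domain E \<or> u \<notin> Domain F" "v \<notin> Domain E \<or> v \<notin> Domain F"
  shows "u = v"
  using assms(5)
proof
  assume "s \<notin> Domain F"
  then show ?thesis
    using two_matchings_aux[of E F s u v] assms by blast
next
  assume "s \<notin> Domain E"
  then show ?thesis
    using two_matchings_aux[of F E s u v] assms by (simp add: Un_commute disj_commute)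
qed

subsection \<open>Words of involutions\<close>

definition push :: "'a \<Rightarrow> 'a list \<Rightarrow> 'a list" where
  "push a w = (case w of [] \<Rightarrow> [a] | b # v \<Rightarrow> if a = b then v else a # w)"

text \<open>The reduced words are the elements of the free product of copies of the group of order two,
  one for each letter, and \<open>push\<close> is left multiplication by a letter.\<close>

definition same_product :: "'a list \<Rightarrow> 'a list \<Rightarrow> bool" where
  "same_product u v \<longleftrightarrow> (\<forall>w. distinct_adj w \<longrightarrow> foldr push u w = foldr push v w)"

lemma distinct_adj_push: "distinct_adj w \<Longrightarrow> distinct_adj (push a w)"
  by (auto simp: push_def distinct_adj_Cons split: list.split)

lemma push_push: "distinct_adj w \<Longrightarrow> push a (push a w) = w"
  by (auto simp: push_def distinct_adj_Cons split: list.split)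

lemma distinct_adj_foldr_push: "distinct_adj w \<Longrightarrow> distinct_adj (foldr push u w)"
  by (induction u) (auto intro: distinct_adj_push)

lemma same_product_append:
  "same_product u v \<Longrightarrow> same_product u' v' \<Longrightarrow> same_product (u @ u') (v @ v')"
  by (simp add: same_product_def distinct_adj_foldr_push)

lemma foldr_push_reduced: "distinct_adj u \<Longrightarrow> foldr push u [] = u"
  by (induction u) (auto simp: push_def distinct_adj_Cons split: list.split)

text \<open>A reduced word is recovered from its action by applying it to the empty word.\<close>

lemma same_product_reduced:
  "same_product u v \<Longrightarrow> distinct_adj u \<Longrightarrow> distinct_adj v \<Longrightarrow> u = v"
  unfolding same_product_def by (metis foldr_push_reduced distinct_adj_Nil)

text \<open>Labels are sets so that \<open>{}\<close> can be the common letter of all singletons,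
  while a larger block can serve as its own letter.\<close>

definition adapted :: "part \<Rightarrow> (nat \<Rightarrow> 'a set) \<Rightarrow> (nat \<Rightarrow> 'a set) \<Rightarrow> bool" where
  "adapted p x y \<longleftrightarrow> sat p x y \<and> (\<forall>u. {u} \<in> p \<longrightarrow> case_point x y u = {})"

definition word :: "(nat \<Rightarrow> 'a) \<Rightarrow> nat \<Rightarrow> 'a list" where
  "word x k = map x [1..<Suc k]"

lemma length_word [simp]: "length (word x k) = k"
  by (simp add: word_def)

lemma nth_word [simp]: "i < k \<Longrightarrow> word x k ! i = x (Suc i)"
  by (simp add: word_def del: upt_Suc)

lemma word_add: "word x (k + k') = word x k @ word (\<lambda>i. x (k + i)) k'"
  by (rule nth_equalityI) (auto simp: nth_append)

lemma word_eq_iff: "word x k = word y l \<longleftrightarrow> k = l \<and> (\<forall>i\<in>{1..k}. x i = y i)"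
proof
  assume *: "word x k = word y l"
  then have "k = l"
    by (metis length_word)
  moreover have "x i = y i" if "i \<in> {1..k}" for i
  proof -
    obtain j where "i = Suc j" "j < k"
      using \<open>i \<in> {1..k}\<close> by (cases i) auto
    then show ?thesis
      using arg_cong[OF *, of "\<lambda>w. w ! j"] \<open>k = l\<close> by simp
  qed
  ultimately show "k = l \<and> (\<forall>i\<in>{1..k}. x i = y i)"
    by blast
qed (auto simp: word_def)

lemma distinct_adj_word:
  "distinct_adj (word x k) \<longleftrightarrow> (\<forall>i. 1 \<le> i \<and> i < k \<longrightarrow> x i \<noteq> x (Suc i))"
proof
  assume *: "distinct_adj (word x k)"
  show "\<forall>i. 1 \<le> i \<and> i < k \<longrightarrow> x i \<noteq> x (Suc i)"
  proof (intro allI impI)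
    fix i assume "1 \<le> i \<and> i < k"
    then obtain j where "i = Suc j" "Suc j < k"
      by (cases i) auto
    then show "x i \<noteq> x (Suc i)"
      using distinct_adj_nth[OF *, of j] by simp
  qed
qed (auto simp: distinct_adj_conv_nth)

text \<open>The non-crossing condition and the parity condition on the pair blocks are both expressed
  through the words read off from the two rows.\<close>

definition balanced :: "nat \<Rightarrow> nat \<Rightarrow> part set" where
  "balanced k l = {p \<in> P k l. (\<forall>b\<in>p. card b \<le> 2) \<and>
     (\<forall>x y :: nat \<Rightarrow> point set. adapted p x y \<longrightarrow> same_product (word x k) (word y l))}"

section \<open>Components of a composite as paths\<close>

context composable
begin

text \<open>The condition \<open>a \<noteq> b\<close> discards singleton blocks, so that the ends of
  paths show up as points outside a domain.\<close>

definition upper_edges :: "spoint rel" where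
  "upper_edges = {(a, b). a \<noteq> b \<and> {a, b} \<in> (`) upper_half ` p}"

definition lower_edges :: "spoint rel" where
  "lower_edges = {(a, b). a \<noteq> b \<and> {a, b} \<in> (`) lower_half ` q}"

lemma upper_block_eq:
  assumes "b \<in> (`) upper_half ` p" "c \<in> (`) upper_half ` p" "u \<in> b" "u \<in> c"
  shows "b = c"
proof -
  obtain b' c' where *: "b = upper_half ` b'" "c = upper_half ` c'" "b' \<in> p" "c' \<in> p"
    using assms by blast
  obtain s t where "u = upper_half s" "s \<in> b'" "u = upper_half t" "t \<in> c'"
    using * assms by blast
  then show ?thesis
    using * P_block_eq[OF p] inj_upper_half by (metis injD)
qed

lemma lower_block_eq:
  assumes "b \<in> (`) lower_half ` q" "c \<in> (`) lower_half ` q" "u \<in> b" "u \<in> c"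
  shows "b = c"
proof -
  obtain b' c' where *: "b = lower_half ` b'" "c = lower_half ` c'" "b' \<in> q" "c' \<in> q"
    using assms by blast
  obtain s t where "u = lower_half s" "s \<in> b'" "u = lower_half t" "t \<in> c'"
    using * assms by blast
  then show ?thesis
    using * P_block_eq[OF q] inj_lower_half by (metis injD)
qed

lemma sym_edges: "sym upper_edges" "sym lower_edges"
  by (auto simp: sym_def upper_edges_def lower_edges_def insert_commute)

lemma single_valued_upper: "single_valued upper_edges"
proof (rule single_valuedI)
  fix a b c assume *: "(a, b) \<in> upper_edges" "(a, c) \<in> upper_edges"
  then have "{a, b} = {a, c}"
    by (intro upper_block_eq[of _ _ a]) (simp_all add: upper_edges_def)
  then show "b = c"
    using * by (auto simp: upper_edges_def doubleton_eq_iff)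
qed

lemma single_valued_lower: "single_valued lower_edges"
proof (rule single_valuedI)
  fix a b c assume *: "(a, b) \<in> lower_edges" "(a, c) \<in> lower_edges"
  then have "{a, b} = {a, c}"
    by (intro lower_block_eq[of _ _ a]) (simp_all add: lower_edges_def)
  then show "b = c"
    using * by (auto simp: lower_edges_def doubleton_eq_iff)
qed

fun spoint_of :: "point \<Rightarrow> spoint" where
  "spoint_of (Up i) = Top i"
| "spoint_of (Lo i) = Bot i"

lemma spoint_of_eq_iff [simp]: "spoint_of u = spoint_of v \<longleftrightarrow> u = v"
  by (cases u; cases v) auto

lemma spoint_of_in [simp]: "spoint_of u \<in> c \<longleftrightarrow> u \<in> outer c"
  by (cases u) auto

lemma spoint_of_neq_Mid [simp]: "spoint_of u \<noteq> Mid j" "Mid j \<noteq> spoint_of u"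
  by (cases u; simp)+

text \<open>The possible ends of a path: outer points belong to one diagram only, and a middle point
  is an end if it is a singleton on one side.\<close>

definition extremal :: "spoint \<Rightarrow> bool" where
  "extremal a \<longleftrightarrow> a \<notin> Domain upper_edges \<or> a \<notin> Domain lower_edges"

lemma Top_not_lower: "Top i \<notin> Domain lower_edges"
proof
  assume "Top i \<in> Domain lower_edges"
  then obtain c b where "c \<in> q" "lower_half ` c = {Top i, b}"
    unfolding lower_edges_def by (auto simp: eq_commute[of _ "lower_half ` _"])
  then obtain u where "Top i = lower_half u"
    by blast
  then show False
    by (cases u) auto
qed

lemma Bot_not_upper: "Bot i \<notin> Domain upper_edges"
proof
  assume "Bot i \<in> Domain upper_edges"
  then obtain c b where "c \<in> p" "upper_half ` c = {Bot i, b}"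
    unfolding upper_edges_def by (auto simp: eq_commute[of _ "upper_half ` _"])
  then obtain u where "Bot i = upper_half u"
    by blast
  then show False
    by (cases u) auto
qed

lemma extremal_spoint_of: "extremal (spoint_of u)"
  using Top_not_lower Bot_not_upper by (cases u) (simp_all add: extremal_def)

lemma singleton_upper:
  assumes "{u} \<in> p"
  shows "upper_half u \<notin> Domain upper_edges"
proof
  assume "upper_half u \<in> Domain upper_edges"
  then obtain v where v: "upper_half u \<noteq> v" "{upper_half u, v} \<in> (`) upper_half ` p"
    by (auto simp: upper_edges_def)
  moreover have "{upper_half u} \<in> (`) upper_half ` p"
    using imageI[OF assms, of "(`) upper_half"] by simp
  ultimately have "{upper_half u} = {upper_half u, v}"
    using upper_block_eq by (metis insertI1)
  then show False
    using v by (simp add: doubleton_eq_iff insert_eq_iff)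
qed

lemma singleton_lower:
  assumes "{u} \<in> q"
  shows "lower_half u \<notin> Domain lower_edges"
proof
  assume "lower_half u \<in> Domain lower_edges"
  then obtain v where v: "lower_half u \<noteq> v" "{lower_half u, v} \<in> (`) lower_half ` q"
    by (auto simp: lower_edges_def)
  moreover have "{lower_half u} \<in> (`) lower_half ` q"
    using imageI[OF assms, of "(`) lower_half"] by simp
  ultimately have "{lower_half u} = {lower_half u, v}"
    using lower_block_eq by (metis insertI1)
  then show False
    using v by (simp add: doubleton_eq_iff insert_eq_iff)
qed

end

locale small_blocks = composable +
  assumes small: "\<And>b. b \<in> p \<Longrightarrow> card b \<le> 2" "\<And>b. b \<in> q \<Longrightarrow> card b \<le> 2"
begin

lemma linked_edges:
  assumes "(a, b) \<in> linked"
  shows "(a, b) \<in> (upper_edges \<union> lower_edges)\<^sup>*"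
proof -
  have "(u, v) \<in> (upper_edges \<union> lower_edges)\<^sup>*" if c: "c \<in> stack q p" "u \<in> c" "v \<in> c" for u v c
  proof (cases "u = v")
    case False
    have "finite c \<and> card c \<le> 2"
      using c(1) unfolding stack_def
    proof
      assume "c \<in> (`) upper_half ` p"
      then obtain d where d: "d \<in> p" "c = upper_half ` d"
        by blast
      show ?thesis
        using d P_finite_block[OF p d(1)] small(1)[OF d(1)]
        by (simp add: card_image inj_on_subset[OF inj_upper_half])
    next
      assume "c \<in> (`) lower_half ` q"
      then obtain d where d: "d \<in> q" "c = lower_half ` d"
        by blast
      show ?thesis
        using d P_finite_block[OF q d(1)] small(2)[OF d(1)]
        by (simp add: card_image inj_on_subset[OF inj_lower_half])
    qed
    then have "{u, v} = c"
      using c False by (intro card_seteq) auto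
    then have "(u, v) \<in> upper_edges \<union> lower_edges"
      using c(1) False by (auto simp: stack_def upper_edges_def lower_edges_def)
    then show ?thesis
      by blast
  qed simp
  then have "(\<Union>b\<in>stack q p. b \<times> b) \<subseteq> (upper_edges \<union> lower_edges)\<^sup>*"
    by blast
  then have "linked \<subseteq> ((upper_edges \<union> lower_edges)\<^sup>*)\<^sup>+"
    unfolding linked_def by (rule trancl_mono_subset)
  then show ?thesis
    using assms by auto
qed

lemma component_edges:
  "c \<in> components q p \<Longrightarrow> u \<in> c \<Longrightarrow> v \<in> c \<Longrightarrow> (u, v) \<in> (upper_edges \<union> lower_edges)\<^sup>*"
  using linked_edges component_linked by blast

text \<open>Since blocks have at most two points, a component is a path or a cycle. Hence it
  contains at most two outer points, and at most one if it also ends in the middle row.\<close>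

lemma at_most_two_extremal:
  assumes "c \<in> components q p" "s \<in> c" "u \<in> c" "v \<in> c" "extremal s" "extremal u" "extremal v"
    "u \<noteq> s" "v \<noteq> s"
  shows "u = v"
  using assms component_edges[OF assms(1,2,3)] component_edges[OF assms(1,2,4)]
  by (intro two_matchings[OF sym_edges single_valued_upper single_valued_lower, of s])
    (simp_all add: extremal_def)

lemma card_pcomp:
  assumes "b \<in> pcomp q p"
  shows "card b \<le> 2"
proof -
  obtain c where c: "c \<in> components q p" "b = outer c" "b \<noteq> {}"
    using assms by (auto simp: pcomp_eq)
  then obtain u where u: "u \<in> b"
    by blast
  have "\<exists>v. b \<subseteq> {u, v}"
  proof (cases "b = {u}")
    case False
    then obtain v where v: "v \<in> b" "v \<noteq> u"
      using u by blast
    have "w = v" if "w \<in> b" "w \<noteq> u" for w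
      using at_most_two_extremal[OF c(1), of "spoint_of u" "spoint_of w" "spoint_of v"] c u v that
      by (simp add: extremal_spoint_of)
    then show ?thesis
      by blast
  qed auto
  then obtain v where "b \<subseteq> {u, v}"
    by blast
  then have "card b \<le> card {u, v}"
    by (intro card_mono) auto
  also have "\<dots> \<le> 2"
    by (simp add: card_insert_if)
  finally show ?thesis .
qed

lemma isolated_outer:
  assumes "spoint_of u \<notin> Domain (upper_edges \<union> lower_edges)" "u \<in> points k m"
  shows "{u} \<in> pcomp q p"
proof -
  have "spoint_of u \<in> spoints k l m"
    using assms(2) by (cases u) auto
  then obtain c where c: "c \<in> components q p" "spoint_of u \<in> c"
    by (rule obtain_component)
  have "v = spoint_of u" if "v \<in> c" for v
    using component_edges[OF c that] assms(1) by (metis converse_rtranclE Domain.DomainI)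
  then have "outer c = {u}"
    using c(2) by (metis spoint_of_eq_iff spoint_of_in singletonI subsetI subset_singletonD
        singletonD equals0D subset_antisym insert_subset empty_subsetI)
  then show ?thesis
    using c(1) by (auto simp: pcomp_eq)
qed

text \<open>A middle point that is a singleton on one side ends its path. If the component has an
  outer point, this is the other end and thus a singleton of the composite, labelled
  \<open>{}\<close>; otherwise the label is free. Either way the middle singletons can receive the
  letter \<open>{}\<close>.\<close>

lemma adapted_pcomp:
  assumes xz: "adapted (pcomp q p) x z"
  shows "\<exists>y. adapted p x y \<and> adapted q y z"
proof -
  \<comment> \<open>Components of middle points get \<open>{}\<close>, because such a component may
    end in singletons.\<close>
  define y where "y = fill x z (\<lambda>_. {})"
  have sat: "sat (pcomp q p) x z" and single: "\<And>u. {u} \<in> pcomp q p \<Longrightarrow> case_point x z u = {}"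
    using xz by (auto simp: adapted_def)
  have sats: "sat p x y" "sat q y z"
    using sat_fill[OF sat] by (auto simp: y_def)
  have mid: "y j = {}" if j: "extremal (Mid j)" "j \<in> {1..l}" for j
  proof -
    obtain c where c: "c \<in> components q p" "Mid j \<in> c"
      using obtain_component[of "Mid j"] j(2) by auto
    show ?thesis
    proof (cases "outer c = {}")
      case True
      then show ?thesis
        using fill_eq[OF c, of x z] by (simp add: y_def)
    next
      case False
      then obtain u where u: "u \<in> outer c"
        by blast
      have "v = u" if "v \<in> outer c" for v
        using at_most_two_extremal[OF c(1), of "spoint_of u" "Mid j" "spoint_of v"] c u that j(1)
        by (auto simp: extremal_spoint_of)
      then have 1: "outer c = {u}"
        using u by blast
      then have "{u} \<in> pcomp q p"
        using c(1) by (auto simp: pcomp_eq)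
      then show ?thesis
        using fill_eq[OF c, of x z] single 1 by (simp add: y_def)
    qed
  qed
  have "case_point x y u = {}" if u: "{u} \<in> p" for u
  proof (cases u)
    case (Up i)
    then have "{Up i} \<in> pcomp q p"
      using isolated_outer[of "Up i"] singleton_upper[OF u] Top_not_lower[of i] P_block_subset[OF p u]
      by auto
    then show ?thesis
      using single Up by fastforce
  next
    case (Lo j)
    then show ?thesis
      using mid[of j] singleton_upper[OF u] P_block_subset[OF p u] by (simp add: extremal_def)
  qed
  moreover have "case_point y z u = {}" if u: "{u} \<in> q" for u
  proof (cases u)
    case (Lo i)
    then have "{Lo i} \<in> pcomp q p"
      using isolated_outer[of "Lo i"] singleton_lower[OF u] Bot_not_upper[of i] P_block_subset[OF q u]
      by auto
    then show ?thesis
      using single Lo by fastforce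
  next
    case (Up j)
    then show ?thesis
      using mid[of j] singleton_lower[OF u] P_block_subset[OF q u] by (simp add: extremal_def)
  qed
  ultimately show ?thesis
    using sats unfolding adapted_def by blast
qed

end

section \<open>The balanced partitions form a category\<close>

lemma balanced_pcomp:
  assumes "p \<in> balanced k l" "q \<in> balanced l m"
  shows "pcomp q p \<in> balanced k m"
proof -
  interpret small_blocks p q k l m
    using assms by unfold_locales (auto simp: balanced_def)
  have "same_product (word x k) (word z m)"
    if "adapted (pcomp q p) x z" for x z :: "nat \<Rightarrow> point set"
  proof -
    obtain y where "adapted p x y" "adapted q y z"
      using adapted_pcomp[OF \<open>adapted (pcomp q p) x z\<close>] by blast
    then have "same_product (word x k) (word y l)" "same_product (word y l) (word z m)"
      using assms by (simp_all add: balanced_def)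
    then show ?thesis
      by (simp add: same_product_def)
  qed
  then show ?thesis
    using pcomp_P card_pcomp by (simp add: balanced_def)
qed

lemma balanced_star: "p \<in> balanced k l \<Longrightarrow> star p \<in> balanced l k"
proof -
  assume p: "p \<in> balanced k l"
  have adapted: "adapted p y x" if "adapted (star p) x y" for x y :: "nat \<Rightarrow> point set"
    unfolding adapted_def
  proof (intro conjI allI impI)
    show "sat p y x"
      using that by (simp add: adapted_def sat_star)
    fix u assume "{u} \<in> p"
    then have "{flip u} \<in> star p"
      by (simp add: star_in_iff)
    then have "case_point x y (flip u) = {}"
      using that by (simp add: adapted_def)
    then show "case_point y x u = {}"
      by (simp add: case_point_flip)
  qed
  have "same_product (word x l) (word y k)" if "adapted (star p) x y" for x y :: "nat \<Rightarrow> point set"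
  proof -
    have "same_product (word y k) (word x l)"
      using p adapted[OF that] by (simp add: balanced_def)
    then show ?thesis
      by (simp add: same_product_def)
  qed
  moreover have "card b \<le> 2" if "b \<in> star p" for b
    using p that by (auto simp: balanced_def star_def card_image inj_on_subset[OF inj_flip])
  ultimately show ?thesis
    using p star_P by (simp add: balanced_def)
qed

lemma balanced_tensor:
  assumes p: "p \<in> balanced k l" and q: "q \<in> balanced k' l'"
  shows "tensor k l p q \<in> balanced (k + k') (l + l')"
proof -
  have "same_product (word x (k + k')) (word y (l + l'))"
    if *: "adapted (tensor k l p q) x y" for x y :: "nat \<Rightarrow> point set"
    unfolding word_add
  proof (rule same_product_append)
    have "adapted p x y"
      using * unfolding adapted_def sat_tensor by (simp add: tensor_def)
    then show "same_product (word x k) (word y l)"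
      using p by (simp add: balanced_def)
    have "adapted q (\<lambda>i. x (k + i)) (\<lambda>i. y (l + i))"
      unfolding adapted_def
    proof (intro conjI allI impI)
      show "sat q (\<lambda>i. x (k + i)) (\<lambda>i. y (l + i))"
        using * by (simp add: adapted_def sat_tensor)
      fix u assume "{u} \<in> q"
      then have "{shift k l u} \<in> tensor k l p q"
        using imageI[of "{u}" q "(`) (shift k l)"] by (simp add: tensor_def)
      then have "case_point x y (shift k l u) = {}"
        using * by (simp add: adapted_def)
      then show "case_point (\<lambda>i. x (k + i)) (\<lambda>i. y (l + i)) u = {}"
        by (simp add: case_point_shift)
    qed
    then show "same_product (word (\<lambda>i. x (k + i)) k') (word (\<lambda>i. y (l + i)) l')"
      using q by (simp add: balanced_def)
  qed
  moreover have "card b \<le> 2" if "b \<in> tensor k l p q" for b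
    using p q that by (auto simp: balanced_def tensor_def card_image inj_on_subset[OF inj_shift])
  ultimately show ?thesis
    using p q tensor_P by (simp add: balanced_def)
qed

lemma word_2: "word x 2 = [x 1, x 2]"
  by (rule nth_equalityI) (auto simp: numeral_2_eq_2 less_Suc_eq)

lemma cap_P: "{{Up 1, Up 2}} \<in> P 2 0"
  by (rule PI) (auto simp: points_def)

lemma singles_P: "{{Lo 1}, {Lo 2}} \<in> P 0 2"
  by (rule PI) (auto simp: points_def)

lemma id1_P: "{{Up 1, Lo 1}} \<in> P 1 1"
  by (rule PI) (auto simp: points_def)

lemma cap_balanced: "{{Up 1, Up 2}} \<in> balanced 2 0"
proof -
  have "same_product (word x 2) (word y 0)" if "adapted {{Up 1, Up 2}} x y" for x y :: "nat \<Rightarrow> point set"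
  proof -
    have "x 2 = x 1"
      using that satD[of "{{Up 1, Up 2}}" x y "{Up 1, Up 2}" "Up 2" "Up 1"] by (simp add: adapted_def)
    then have "word x 2 = [x 1, x 1]"
      by (simp add: word_2)
    then show ?thesis
      by (simp add: word_def same_product_def push_push)
  qed
  then show ?thesis
    using cap_P by (simp add: balanced_def card_insert_if)
qed

lemma singles_balanced: "{{Lo 1}, {Lo 2}} \<in> balanced 0 2"
proof -
  have "same_product (word x 0) (word y 2)" if "adapted {{Lo 1}, {Lo 2}} x y" for x y :: "nat \<Rightarrow> point set"
  proof -
    have "y 1 = {}" "y 2 = {}"
      using that by (auto simp: adapted_def)
    then have "word y 2 = [{}, {}]"
      by (simp add: word_2)
    then show ?thesis
      by (simp add: word_def same_product_def push_push)
  qed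
  then show ?thesis
    using singles_P by (simp add: balanced_def)
qed

lemma id1_balanced: "{{Up 1, Lo 1}} \<in> balanced 1 1"
proof -
  have "same_product (word x 1) (word y 1)" if "adapted {{Up 1, Lo 1}} x y" for x y :: "nat \<Rightarrow> point set"
  proof -
    have "x 1 = y 1"
      using that satD[of "{{Up 1, Lo 1}}" x y "{Up 1, Lo 1}" "Up 1" "Lo 1"] by (simp add: adapted_def)
    then show ?thesis
      by (simp add: word_def same_product_def)
  qed
  then show ?thesis
    using id1_P by (simp add: balanced_def card_insert_if)
qed

lemma partition_category_balanced: "partition_category balanced"
  unfolding partition_category_def
  by (intro conjI allI impI cap_balanced id1_balanced balanced_tensor balanced_star balanced_pcomp) (auto simp: balanced_def)

section \<open>Closure properties of the smallest category\<close>

lemma NCb_sharp_iff: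
  "p \<in> NCb_sharp k l \<longleftrightarrow>
   (\<forall>C. partition_category C \<longrightarrow> {{Lo 1}, {Lo 2}} \<in> C 0 2 \<longrightarrow> p \<in> C k l)"
  unfolding NCb_sharp_def by blast

lemma NCb_sharp_subset_balanced: "NCb_sharp k l \<subseteq> balanced k l"
  using partition_category_balanced singles_balanced by (auto simp: NCb_sharp_iff simp del: One_nat_def)

lemma NCb_sharp_P: "p \<in> NCb_sharp k l \<Longrightarrow> p \<in> P k l"
  using NCb_sharp_subset_balanced[of k l] unfolding balanced_def by blast

lemma finite_NCb_sharp [simp]: "finite (NCb_sharp k l)"
  by (rule finite_subset[OF _ finite_P]) (auto intro: NCb_sharp_P)

lemma singles_NCb_sharp: "{{Lo 1}, {Lo 2}} \<in> NCb_sharp 0 2"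
  unfolding NCb_sharp_iff by blast

lemma cap_NCb_sharp: "{{Up 1, Up 2}} \<in> NCb_sharp 2 0"
  unfolding NCb_sharp_iff partition_category_def by simp

lemma id1_NCb_sharp: "{{Up 1, Lo 1}} \<in> NCb_sharp 1 1"
  unfolding NCb_sharp_iff partition_category_def by simp

lemma tensor_NCb_sharp:
  assumes "p \<in> NCb_sharp k l" "q \<in> NCb_sharp k' l'"
  shows "tensor k l p q \<in> NCb_sharp (k + k') (l + l')"
  unfolding NCb_sharp_iff
proof (intro allI impI)
  fix C assume *: "partition_category C" "{{Lo 1}, {Lo 2}} \<in> C 0 2"
  then have "p \<in> C k l" "q \<in> C k' l'"
    using assms unfolding NCb_sharp_iff by simp_all
  then show "tensor k l p q \<in> C (k + k') (l + l')"
    using *(1) unfolding partition_category_def by simp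
qed

lemma star_NCb_sharp:
  assumes "p \<in> NCb_sharp k l"
  shows "star p \<in> NCb_sharp l k"
  unfolding NCb_sharp_iff
proof (intro allI impI)
  fix C assume *: "partition_category C" "{{Lo 1}, {Lo 2}} \<in> C 0 2"
  then have "p \<in> C k l"
    using assms unfolding NCb_sharp_iff by simp
  then show "star p \<in> C l k"
    using *(1) unfolding partition_category_def by simp
qed

lemma pcomp_NCb_sharp:
  assumes "p \<in> NCb_sharp k l" "q \<in> NCb_sharp l m"
  shows "pcomp q p \<in> NCb_sharp k m"
  unfolding NCb_sharp_iff
proof (intro allI impI)
  fix C assume *: "partition_category C" "{{Lo 1}, {Lo 2}} \<in> C 0 2"
  then have "p \<in> C k l" "q \<in> C l m"
    using assms unfolding NCb_sharp_iff by simp_all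
  then show "pcomp q p \<in> C k m"
    using *(1) unfolding partition_category_def by blast
qed

subsection \<open>Normal forms\<close>

lemma index_pairs_sorted:
  assumes "(k, m) \<in> index_pairs"
  shows "sorted_wrt (\<lambda>i j. i + 2 \<le> j) m"
proof -
  have "transp (\<lambda>i j :: nat. i + 2 \<le> j)"
    by (auto simp: transp_def)
  moreover have "m ! i + 2 \<le> m ! Suc i" if "Suc i < length m" for i
  proof -
    have "int (m ! Suc i) - int (m ! i) \<ge> 2"
      using assms that by (simp add: index_pairs_def)
    then show ?thesis
      by linarith
  qed
  ultimately show ?thesis
    by (simp add: sorted_wrt_iff_nth_Suc_transp)
qed

lemma index_pairs_subset: "(k, m) \<in> index_pairs \<Longrightarrow> set m \<subseteq> {1..k}"
  by (simp add: index_pairs_def)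

lemma index_pairs_not_adjacent:
  assumes "(k, m) \<in> index_pairs" "i \<in> set m"
  shows "Suc i \<notin> set m"
proof
  assume "Suc i \<in> set m"
  then obtain a b where ab: "a < length m" "m ! a = i" "b < length m" "m ! b = Suc i"
    using assms(2) by (metis in_set_conv_nth)
  have *: "m ! c + 2 \<le> m ! d" if "c < d" "d < length m" for c d
    using sorted_wrt_nth_less[OF index_pairs_sorted[OF assms(1)] that] .
  show False
    using *[of a b] *[of b a] ab by (cases a b rule: linorder_cases) auto
qed

lemma index_pairs_unique:
  assumes "(k, m) \<in> index_pairs" "(k', m') \<in> index_pairs" "set m = set m'"
  shows "m = m'"
proof -
  have "sorted_wrt (<) n" if "(k, n) \<in> index_pairs" for k n
    by (rule sorted_wrt_mono_rel[OF _ index_pairs_sorted[OF that]]) auto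
  then show ?thesis
    using assms strict_sorted_equal by blast
qed

text \<open>The most discriminating adapted labelling: every larger block is its own letter, and
  only the singletons share one.\<close>

definition generic :: "part \<Rightarrow> point \<Rightarrow> point set" where
  "generic q u = (if {u} \<in> q then {} else \<Union>{b \<in> q. u \<in> b})"

lemma generic_eq:
  assumes "q \<in> P k l" "b \<in> q" "u \<in> b"
  shows "generic q u = (if b = {u} then {} else b)"
proof -
  have "{c \<in> q. u \<in> c} = {b}"
    using assms P_block_eq[OF assms(1)] by blast
  moreover have "{u} \<in> q \<longleftrightarrow> b = {u}"
    using assms P_block_eq[OF assms(1)] by blast
  ultimately show ?thesis
    by (simp add: generic_def)
qed

lemma adapted_generic:
  assumes "q \<in> P k l"
  shows "adapted q (generic q \<circ> Up) (generic q \<circ> Lo)"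
  unfolding adapted_def sat_Up_Lo case_point_Up_Lo
proof (intro conjI ballI allI impI)
  fix b u v assume "b \<in> q" "u \<in> b" "v \<in> b"
  then show "generic q u = generic q v"
    using generic_eq[OF assms] by auto
qed (simp add: generic_def)

lemma generic_eqD:
  assumes q: "q \<in> P k l" "\<And>b. b \<in> q \<Longrightarrow> card b \<le> 2" and uv: "u \<in> points k l" "v \<in> points k l" "u \<noteq> v"
    and eq: "generic q u = generic q v"
  shows "{u, v} \<in> q \<or> {u} \<in> q \<and> {v} \<in> q"
proof -
  obtain b c where bc: "b \<in> q" "u \<in> b" "c \<in> q" "v \<in> c"
    using uv P_obtain_block[OF q(1)] by metis
  show ?thesis
  proof (cases "b = {u} \<or> c = {v}")
    case True
    have "b \<noteq> {}" "c \<noteq> {}"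
      using bc by auto
    then have "b = {u} \<and> c = {v}"
      using True eq generic_eq[OF q(1) bc(1,2)] generic_eq[OF q(1) bc(3,4)] by (auto split: if_splits)
    then show ?thesis
      using bc by simp
  next
    case False
    then have "b = c"
      using eq generic_eq[OF q(1) bc(1,2)] generic_eq[OF q(1) bc(3,4)] by simp
    then have "{u, v} = b"
      using bc q(2)[OF bc(1)] uv(3) P_finite_block[OF q(1) bc(1)] by (intro card_seteq) auto
    then show ?thesis
      using bc by simp
  qed
qed

lemma P_subset_eq:
  assumes "p \<in> P k l" "q \<in> P k l" "p \<subseteq> q"
  shows "p = q"
proof
  show "q \<subseteq> p"
  proof
    fix b assume b: "b \<in> q"
    then obtain u where u: "u \<in> b"
      using P_block_ne[OF assms(2)] by blast
    then obtain c where "c \<in> p" "u \<in> c"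
      using P_obtain_block[OF assms(1)] P_block_subset[OF assms(2) b] by blast
    then show "b \<in> p"
      using P_block_eq[OF assms(2) b _ u] assms(3) by blast
  qed
qed fact

text \<open>For blocks of size at most two, these are the places where the upper row has two
  adjacent equal letters under \<open>generic q\<close>, that is, where its word cancels.\<close>

definition reducible :: "part \<Rightarrow> nat \<Rightarrow> bool" where
  "reducible q k \<longleftrightarrow> (\<exists>i. 1 \<le> i \<and> i < k \<and>
     ({Up i, Up (Suc i)} \<in> q \<or> {Up i} \<in> q \<and> {Up (Suc i)} \<in> q))"

lemma star_doubleton_Up: "{Up i, Up j} \<in> star q \<longleftrightarrow> {Lo i, Lo j} \<in> q"
  and star_singleton_Up: "{Up i} \<in> star q \<longleftrightarrow> {Lo i} \<in> q"
  by (simp_all add: star_in_iff)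

text \<open>If neither row cancels, the two generic words are reduced with the same product, hence
  equal. Then \<open>Up i\<close> and \<open>Lo i\<close> carry the same letter, so they form a pair
  or are both singletons, and irreducibility keeps the singletons apart.\<close>

lemma normal_form_cases:
  assumes "q \<in> balanced k l"
  shows "reducible q k \<or> reducible (star q) l \<or> (k = l \<and> (\<exists>m. (k, m) \<in> index_pairs \<and> q = p_part k m))"
proof (cases "reducible q k \<or> reducible (star q) l")
  case False
  have P: "q \<in> P k l" and small: "\<And>b. b \<in> q \<Longrightarrow> card b \<le> 2"
    using assms by (auto simp: balanced_def)
  define x where "x = generic q \<circ> Up"
  define y where "y = generic q \<circ> Lo"
  have "x i \<noteq> x (Suc i)" if "1 \<le> i" "i < k" for i
    using False generic_eqD[OF P small, of "Up i" "Up (Suc i)"] that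
    by (auto simp: x_def reducible_def)
  moreover have "y i \<noteq> y (Suc i)" if "1 \<le> i" "i < l" for i
    using False generic_eqD[OF P small, of "Lo i" "Lo (Suc i)"] that
    by (auto simp: y_def reducible_def star_doubleton_Up star_singleton_Up)
  moreover have "same_product (word x k) (word y l)"
    using assms adapted_generic[OF P] by (simp add: balanced_def x_def y_def)
  ultimately have "word x k = word y l"
    by (intro same_product_reduced) (auto simp: distinct_adj_word)
  then have kl: "k = l" and "\<forall>i\<in>{1..k}. x i = y i"
    by (simp_all add: word_eq_iff)
  then have xy: "generic q (Up i) = generic q (Lo i)" if "i \<in> {1..k}" for i
    using that by (simp add: x_def y_def)
  define S where "S = {i \<in> {1..k}. {Up i} \<in> q}"
  define m where "m = sorted_list_of_set S"
  have [simp]: "set m = S"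
    by (simp add: m_def S_def)
  have "(k, m) \<in> index_pairs"
    unfolding index_pairs_def
  proof (clarsimp, intro conjI allI impI)
    show "S \<subseteq> {Suc 0..k}"
      by (auto simp: S_def)
    fix i assume i: "Suc i < length m"
    have "m ! i < m ! Suc i"
      using i strict_sorted_list_of_set[of S] unfolding m_def by (auto intro: sorted_wrt_nth_less)
    moreover have "m ! Suc i \<noteq> Suc (m ! i)"
    proof
      assume *: "m ! Suc i = Suc (m ! i)"
      have "m ! i \<in> S" "Suc (m ! i) \<in> S"
        using i *[symmetric] \<open>set m = S\<close> by (metis Suc_lessD nth_mem)+
      then show False
        using False by (auto simp: S_def reducible_def)
    qed
    ultimately show "2 \<le> int (m ! Suc i) - int (m ! i)"
      by linarith
  qed
  moreover have "p_part k m = q"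
  proof (rule P_subset_eq)
    show "p_part k m \<in> P k k"
      by (rule p_part_P) (auto simp: S_def)
    show "q \<in> P k k"
      using P kl by simp
    have pair: "{Up i, Lo i} \<in> q \<or> {Up i} \<in> q \<and> {Lo i} \<in> q" if "i \<in> {1..k}" for i
      using generic_eqD[OF P small, of "Up i" "Lo i"] xy[OF that] that kl by auto
    have "{Up i, Lo i} \<in> q" if "i \<in> {1..k} - S" for i
      using pair[of i] that by (auto simp: S_def)
    moreover have "{Lo i} \<in> q" if "i \<in> S" for i
    proof (rule ccontr)
      assume "{Lo i} \<notin> q"
      then have "{Up i, Lo i} \<in> q" "{Up i} \<in> q"
        using pair[of i] that by (auto simp: S_def)
      then show False
        using P_block_eq[OF P, of "{Up i, Lo i}" "{Up i}" "Up i"] by auto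
    qed
    ultimately show "p_part k m \<subseteq> q"
      by (auto simp: p_part_def S_def)
  qed
  ultimately show ?thesis
    using kl by blast
qed blast

text \<open>A free upper label of \<open>p\<close> stays free in the composite, with the same middle
  labels as witness.\<close>

lemma singleton_pcomp:
  assumes p: "p \<in> P k l" and q: "q \<in> P l n" and s: "{Up i} \<in> p"
  shows "{Up i} \<in> pcomp q p"
proof -
  have i: "i \<in> {1..k}"
    using P_block_subset[OF p s] by simp
  show ?thesis
    unfolding singleton_Up_iff[OF pcomp_P[OF p q] i]
  proof (intro allI impI)
    fix x z :: "nat \<Rightarrow> bool" and a assume "sat (pcomp q p) x z"
    then obtain y where y: "sat p x y" "sat q y z"
      unfolding sat_pcomp[OF p q] by blast
    have "sat p (x(i := a)) y"
      using singleton_Up_iff[OF p i] s y(1) by simp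
    then show "sat (pcomp q p) (x(i := a)) z"
      using y(2) by (rule sat_pcompD[OF p q])
  qed
qed

text \<open>Distinct through-blocks use distinct upper points outside \<open>m\<close>, and there
  are as many of them as such points; so every point outside \<open>m\<close> lies on a
  through-block. A cancellation would put one of these points into a block without lower
  points.\<close>

lemma not_reducible:
  assumes r: "r \<in> P k l" "\<And>b. b \<in> r \<Longrightarrow> card b \<le> 2" and m: "(k, m) \<in> index_pairs"
    and single: "\<And>i. i \<in> set m \<Longrightarrow> {Up i} \<in> r"
    and t: "through_blocks r = card ({1..k} - set m)"
  shows "\<not> reducible r k"
proof -
  let ?T = "{b \<in> r. (\<exists>i. Up i \<in> b) \<and> (\<exists>j. Lo j \<in> b)}"
  define f where "f b = (SOME i. Up i \<in> b)" for b
  have f: "Up (f b) \<in> b" if "b \<in> ?T" for b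
    using that unfolding f_def by (auto intro: someI_ex)
  have inj: "inj_on f ?T"
  proof (rule inj_onI)
    fix b c assume "b \<in> ?T" "c \<in> ?T" "f b = f c"
    then show "b = c"
      using P_block_eq[OF r(1), of b c "Up (f b)"] f[of b] f[of c] by auto
  qed
  have sub: "f ` ?T \<subseteq> {1..k} - set m"
  proof
    fix i assume "i \<in> f ` ?T"
    then obtain b where b: "b \<in> ?T" "i = f b"
      by blast
    have "{Up i} \<notin> r"
    proof
      assume "{Up i} \<in> r"
      then have "b = {Up i}"
        using P_block_eq[OF r(1), of b "{Up i}" "Up i"] b f[OF b(1)] by auto
      then show False
        using b by auto
    qed
    moreover have "i \<in> {1..k}"
      using P_block_subset[OF r(1), of b] b f[OF b(1)] by auto
    ultimately show "i \<in> {1..k} - set m"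
      using single by blast
  qed
  have "f ` ?T = {1..k} - set m"
    using t by (intro card_seteq[OF _ sub]) (simp_all add: card_image[OF inj] through_blocks_def)
  then have through: "\<exists>b\<in>?T. Up i \<in> b" if "i \<in> {1..k} - set m" for i
  proof -
    have "i \<in> f ` ?T"
      using that \<open>f ` ?T = {1..k} - set m\<close> by simp
    then obtain b where "b \<in> ?T" "i = f b"
      by (rule imageE)
    then show ?thesis
      using f[of b] by (intro bexI[of _ b]) simp_all
  qed
  show ?thesis
  proof
    assume "reducible r k"
    then obtain i where i: "1 \<le> i" "i < k"
      "{Up i, Up (Suc i)} \<in> r \<or> {Up i} \<in> r \<and> {Up (Suc i)} \<in> r"
      by (auto simp: reducible_def)
    \<comment> \<open>Of two neighbouring points at least one lies outside \<open>m\<close>.\<close>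
    define j where "j = (if i \<in> set m then Suc i else i)"
    have j: "j \<in> {1..k} - set m"
      using i index_pairs_not_adjacent[OF m, of i] by (auto simp: j_def)
    have "\<exists>c\<in>r. c \<subseteq> range Up \<and> Up j \<in> c"
      using i(3)
    proof
      assume "{Up i, Up (Suc i)} \<in> r"
      then show ?thesis
        by (rule bexI[rotated]) (auto simp: j_def)
    next
      assume "{Up i} \<in> r \<and> {Up (Suc i)} \<in> r"
      then have "{Up j} \<in> r"
        by (simp add: j_def)
      then show ?thesis
        by (rule bexI[rotated]) auto
    qed
    then obtain c where "c \<in> r" "c \<subseteq> range Up" "Up j \<in> c"
      by blast
    moreover obtain b where "b \<in> ?T" "Up j \<in> b"
      using through[OF j] by blast
    ultimately have "b = c" "b \<in> ?T"
      using P_block_eq[OF r(1), of b c "Up j"] by auto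
    then show False
      using \<open>c \<subseteq> range Up\<close> by auto
  qed
qed

lemma star_p_part:
  assumes "set m \<subseteq> {1..k}"
  shows "star (p_part k m) = p_part k m"
proof (rule P_eqI[OF star_P p_part_P])
  show "sat (star (p_part k m)) x y \<longleftrightarrow> sat (p_part k m) x y" for x y :: "nat \<Rightarrow> bool"
    unfolding sat_star sat_p_part by (intro ball_cong refl eq_commute)
qed (use assms p_part_P in auto)

lemma singleton_p_part: "{Up i} \<in> p_part k m \<longleftrightarrow> i \<in> set m"
  by (auto simp: p_part_def)

text \<open>If no through-block is lost, both rows of \<open>p_part n m \<cdot> q \<cdot> p_part k m'\<close> are reduced.\<close>

lemma p_part_sandwich:
  assumes q: "q \<in> NCb_sharp k n" and ind: "(n, m) \<in> index_pairs" "(k, m') \<in> index_pairs"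
    and pC: "p_part n m \<in> NCb_sharp n n" "p_part k m' \<in> NCb_sharp k k"
    and r: "r = pcomp (p_part n m) (pcomp q (p_part k m'))"
    and t: "through_blocks r = through_blocks (p_part n m)"
      "through_blocks r = through_blocks (p_part k m')"
  shows "k = n \<and> m = m' \<and> r = p_part n m"
proof -
  have rN: "r \<in> NCb_sharp k n"
    unfolding r by (intro pcomp_NCb_sharp[OF _ pC(1)] pcomp_NCb_sharp[OF pC(2)] q)
  then have rD: "r \<in> balanced k n"
    using NCb_sharp_subset_balanced by blast
  have rP: "r \<in> P k n" and small: "\<And>b. b \<in> r \<Longrightarrow> card b \<le> 2"
    using rD by (auto simp: balanced_def)
  note qP = NCb_sharp_P[OF q] and mP = NCb_sharp_P[OF pC(1)] and mP' = NCb_sharp_P[OF pC(2)]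
  note m = index_pairs_subset[OF ind(1)] and m' = index_pairs_subset[OF ind(2)]
  have up: "{Up i} \<in> r" if "i \<in> set m'" for i
    unfolding r pcomp_assoc[OF mP' qP mP]
    by (rule singleton_pcomp[OF mP' pcomp_P[OF qP mP]]) (simp add: singleton_p_part that)
  have "star r = pcomp (pcomp (p_part k m') (star q)) (p_part n m)"
    unfolding r star_pcomp[OF pcomp_P[OF mP' qP] mP] star_pcomp[OF mP' qP] star_p_part[OF m] star_p_part[OF m'] ..
  then have lo: "{Up i} \<in> star r" if "i \<in> set m" for i
    using singleton_pcomp[OF mP pcomp_P[OF star_P[OF qP] mP'], of i] that by (simp add: singleton_p_part)
  have "\<not> reducible r k"
    using up t(2) through_blocks_p_part[OF m'] by (intro not_reducible[OF rP small ind(2)]) auto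
  moreover have "\<not> reducible (star r) n"
  proof (rule not_reducible[OF star_P[OF rP] _ ind(1)])
    show "card b \<le> 2" if "b \<in> star r" for b
      using balanced_star[OF rD] that by (simp add: balanced_def)
    show "through_blocks (star r) = card ({1..n} - set m)"
      using t(1) through_blocks_p_part[OF m] by (simp add: through_blocks_star)
  qed (use lo in auto)
  ultimately obtain s where kn: "k = n" and s: "(k, s) \<in> index_pairs" "r = p_part k s"
    using normal_form_cases[OF rD] by blast
  \<comment> \<open>The singletons inherited from the outer factors give an inclusion, and the count
    of through-blocks turns it into an equality.\<close>
  have eq: "set s = set v" if "set v \<subseteq> set s" "through_blocks r = card ({1..k} - set v)" for v
  proof -
    note sk = index_pairs_subset[OF s(1)]
    have "{1..k} - set s = {1..k} - set v"
      using that through_blocks_p_part[OF sk] by (intro card_seteq) (auto simp: s(2))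
    then show ?thesis
      using that(1) sk by blast
  qed
  have "set s = set m'"
    using up t(2) through_blocks_p_part[OF m'] by (intro eq) (auto simp: s(2) singleton_p_part)
  moreover have "set s = set m"
    using lo t(1) through_blocks_p_part[OF m] kn
    by (intro eq) (auto simp: s(2) singleton_p_part star_p_part[OF index_pairs_subset[OF s(1)[unfolded kn]]])
  ultimately show ?thesis
    using index_pairs_unique ind s kn by metis
qed

subsection \<open>Factorization through reduced partitions\<close>

lemma P_0_0: "p \<in> P 0 0 \<Longrightarrow> p = {}"
  by (auto simp: P_iff points_def partition_on_def)

lemma id_part_NCb_sharp: "id_part k \<in> NCb_sharp k k"
proof (induction k)
  case 0
  \<comment> \<open>Any partition of the empty set of points is empty, so every member of
    \<open>NCb_sharp 0 0\<close> is the identity of 0.\<close>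
  have "pcomp (star {{Lo 1}, {Lo 2}}) {{Lo 1}, {Lo 2}} \<in> NCb_sharp 0 0"
    using singles_NCb_sharp star_NCb_sharp pcomp_NCb_sharp by blast
  moreover have "id_part 0 = {}"
    by (simp add: id_part_def)
  ultimately show ?case
    using P_0_0 NCb_sharp_P by metis
next
  case (Suc k)
  have "tensor k k (id_part k) {{Up 1, Lo 1}} = id_part (Suc k)"
    by (auto simp: tensor_def id_part_def le_Suc_eq)
  then show ?case
    using tensor_NCb_sharp[OF Suc id1_NCb_sharp] by simp
qed

lemma sat_id1: "sat {{Up 1, Lo 1}} x y \<longleftrightarrow> x 1 = y 1"
  and sat_cap: "sat {{Up 1, Up 2}} x y \<longleftrightarrow> x 1 = x 2"
  and sat_singles: "sat {{Lo 1}, {Lo 2}} x y"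
  unfolding sat_def by auto

text \<open>A rotation of the generator: place it to the right of a strand and cap the strand with
  the first new singleton. The upper point is then cut off, and the second singleton remains as the
  lower point.\<close>

lemma singles_1_1_NCb_sharp: "{{Up 1}, {Lo 1}} \<in> NCb_sharp 1 1"
proof -
  let ?a = "tensor 1 1 {{Up 1, Lo 1}} {{Lo 1}, {Lo 2}}" and ?b = "tensor 2 0 {{Up 1, Up 2}} {{Up 1, Lo 1}}"
  have a: "?a \<in> NCb_sharp 1 3" and b: "?b \<in> NCb_sharp 3 1"
    using tensor_NCb_sharp[OF id1_NCb_sharp singles_NCb_sharp]
      tensor_NCb_sharp[OF cap_NCb_sharp id1_NCb_sharp] by (simp_all del: One_nat_def)
  have "pcomp ?b ?a = {{Up 1}, {Lo 1}}"
  proof (rule P_eqI)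
    show "pcomp ?b ?a \<in> P 1 1"
      using pcomp_NCb_sharp[OF a b] by (rule NCb_sharp_P)
    show "{{Up 1}, {Lo 1}} \<in> P 1 1"
      by (rule PI) (auto simp: points_def)
    fix x z :: "nat \<Rightarrow> bool"
    \<comment> \<open>The first two middle points hang on the upper point, the third one on the
      lower point.\<close>
    have "sat ?a x (\<lambda>i. if i = 3 then z 1 else x 1)" "sat ?b (\<lambda>i. if i = 3 then z 1 else x 1) z"
      unfolding sat_tensor sat_id1 sat_cap using sat_singles by simp_all
    then have "sat (pcomp ?b ?a) x z"
      by (rule sat_pcompD[OF NCb_sharp_P[OF a] NCb_sharp_P[OF b]])
    moreover have "sat {{Up 1}, {Lo 1}} x z"
      by (simp add: sat_def)
    ultimately show "sat (pcomp ?b ?a) x z \<longleftrightarrow> sat {{Up 1}, {Lo 1}} x z"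
      by simp
  qed
  then show ?thesis
    using pcomp_NCb_sharp[OF a b] by simp
qed

lemma p_part_NCb_sharp: "set m \<subseteq> {1..k} \<Longrightarrow> p_part k m \<in> NCb_sharp k k"
proof (induction k arbitrary: m)
  case 0
  then show ?case
    using id_part_NCb_sharp[of 0] by (simp add: p_part_Nil)
next
  case (Suc k)
  let ?m = "filter (\<lambda>i. i \<le> k) m"
  have IH: "p_part k ?m \<in> NCb_sharp k k"
    using Suc.prems by (intro Suc.IH) auto
  show ?case
  proof (cases "Suc k \<in> set m")
    case True
    have "tensor k k (p_part k ?m) {{Up 1}, {Lo 1}} = p_part (Suc k) m"
      using True Suc.prems by (auto simp: tensor_def p_part_def le_Suc_eq)
    then show ?thesis
      using tensor_NCb_sharp[OF IH singles_1_1_NCb_sharp] by simp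
  next
    case False
    have "tensor k k (p_part k ?m) {{Up 1, Lo 1}} = p_part (Suc k) m"
      using False Suc.prems by (auto simp: tensor_def p_part_def le_Suc_eq)
    then show ?thesis
      using tensor_NCb_sharp[OF IH id1_NCb_sharp] by simp
  qed
qed

lemma sat_modify:
  assumes "sat q z w"
    and "\<And>b. b \<in> q \<Longrightarrow> (\<forall>v\<in>b. case_point u w v = case_point z w v) \<or>
      (\<exists>a. \<forall>v\<in>b. case_point u w v = a)"
  shows "sat q u w"
  unfolding sat_def
proof (intro ballI)
  fix b s t assume b: "b \<in> q" "s \<in> b" "t \<in> b"
  show "case_point u w s = case_point u w t"
    using assms(2)[OF b(1)]
  proof
    assume "\<forall>v\<in>b. case_point u w v = case_point z w v"
    then show ?thesis
      using satD[OF assms(1) b] b by simp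
  qed (use b in auto)
qed

text \<open>The partition \<open>a\<close> repeats the cancelling pair or the two singletons of
  \<open>q\<close> between identity strands. Applying \<open>star a\<close> after \<open>a\<close>
  changes labels only at these two points, so \<open>q\<close> absorbs it, and
  \<open>pcomp q (star a)\<close> serves as \<open>q'\<close>.\<close>

lemma reduction:
  assumes q: "q \<in> NCb_sharp k l" and red: "reducible q k"
  shows "\<exists>q' a. q' \<in> NCb_sharp (k - 2) l \<and> a \<in> NCb_sharp k (k - 2) \<and> q = pcomp q' a \<and>
    through_blocks q' \<le> through_blocks q"
proof -
  obtain i' where i': "1 \<le> i'" "i' < k"
    "{Up i', Up (Suc i')} \<in> q \<or> {Up i'} \<in> q \<and> {Up (Suc i')} \<in> q"
    using red by (auto simp: reducible_def)
  \<comment> \<open>The numbers of points before and after the two that cancel.\<close>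
  define i j where "i = i' - 1" and "j = k - Suc i'"
  have k: "k = i + (2 + j)" and k2: "k - 2 = i + (0 + j)"
    using i' by (auto simp: i_def j_def)
  have blocks: "{Up (i + 1), Up (i + 2)} \<in> q \<or> {Up (i + 1)} \<in> q \<and> {Up (i + 2)} \<in> q"
    using i' by (simp add: i_def)
  define s where "s = (if {Up (i + 1), Up (i + 2)} \<in> q then {{Up 1, Up 2}} else star {{Lo 1}, {Lo 2}})"
  have s: "s \<in> NCb_sharp 2 0"
    using cap_NCb_sharp star_NCb_sharp[OF singles_NCb_sharp] by (simp add: s_def)
  define a where "a = tensor i i (id_part i) (tensor 2 0 s (id_part j))"
  have "a \<in> NCb_sharp (i + (2 + j)) (i + (0 + j))"
    unfolding a_def by (intro tensor_NCb_sharp id_part_NCb_sharp s)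
  then have a: "a \<in> NCb_sharp k (k - 2)"
    unfolding k2 k[symmetric] .
  have sat_a: "sat a x y \<longleftrightarrow> (\<forall>c\<in>{1..i}. x c = y c) \<and>
      ({Up (i + 1), Up (i + 2)} \<in> q \<longrightarrow> x (i + 1) = x (i + 2)) \<and> (\<forall>c\<in>{1..j}. x (i + (2 + c)) = y (i + c))"
    for x y :: "nat \<Rightarrow> bool"
    unfolding a_def sat_tensor sat_id_part s_def
    by (simp add: sat_star sat_singles sat_cap del: One_nat_def)
  note qP = NCb_sharp_P[OF q] and aP = NCb_sharp_P[OF a]
  have aa: "pcomp (star a) a \<in> P k k"
    by (rule pcomp_P[OF aP star_P[OF aP]])
  have "pcomp q (pcomp (star a) a) = q"
  proof (rule P_eqI[OF pcomp_P[OF aa qP] qP])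
    fix x w :: "nat \<Rightarrow> bool"
    show "sat (pcomp q (pcomp (star a) a)) x w \<longleftrightarrow> sat q x w"
    proof
      assume "sat (pcomp q (pcomp (star a) a)) x w"
      then obtain y z where yz: "sat a x y" "sat a z y" "sat q z w"
        unfolding sat_pcomp[OF aa qP] sat_pcomp[OF aP star_P[OF aP]] sat_star by blast
      have eq: "x c = z c" if "c \<in> {1..k}" "c \<noteq> i + 1" "c \<noteq> i + 2" for c
      proof (cases "c \<le> i")
        case True
        then show ?thesis
          using yz(1,2) that unfolding sat_a by simp
      next
        case False
        define d where "d = c - (i + 2)"
        have "c = i + (2 + d)" "d \<in> {1..j}"
          using that False k by (auto simp: d_def)
        then show ?thesis
          using yz(1,2) unfolding sat_a by simp
      qed
      \<comment> \<open>\<open>x\<close> and \<open>z\<close> differ at most at the two cancelled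
        points, whose blocks in \<open>q\<close> contain no other points.\<close>
      show "sat q x w"
      proof (rule sat_modify[OF yz(3)])
        fix b assume b: "b \<in> q"
        show "(\<forall>v\<in>b. case_point x w v = case_point z w v) \<or> (\<exists>a. \<forall>v\<in>b. case_point x w v = a)"
        proof (cases "Up (i + 1) \<in> b \<or> Up (i + 2) \<in> b")
          case True
          then have "b = {Up (i + 1), Up (i + 2)} \<or> b = {Up (i + 1)} \<or> b = {Up (i + 2)}"
            using blocks P_block_eq[OF qP b] by blast
          then show ?thesis
          proof (elim disjE)
            assume b': "b = {Up (i + 1), Up (i + 2)}"
            then have "x (i + 2) = x (i + 1)"
              using yz(1) b unfolding sat_a by simp
            then show ?thesis
              unfolding b' by (intro disjI2 exI[of _ "x (i + 1)"]) simp
          next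
            assume "b = {Up (i + 1)}"
            then show ?thesis
              by (intro disjI2 exI[of _ "x (i + 1)"]) simp
          next
            assume "b = {Up (i + 2)}"
            then show ?thesis
              by (intro disjI2 exI[of _ "x (i + 2)"]) simp
          qed
        next
          case False
          have "case_point x w v = case_point z w v" if v: "v \<in> b" for v
          proof (cases v)
            case (Up c)
            then have "c \<in> {1..k}"
              using P_block_subset[OF qP b] v by auto
            then show ?thesis
              using eq[of c] False v Up by auto
          qed simp
          then show ?thesis
            by blast
        qed
      qed
    next
      assume xw: "sat q x w"
      \<comment> \<open>The labels of \<open>x\<close> with the two cancelled positions left
        out.\<close>
      define y where "y c = (if c \<le> i then x c else x (c + 2))" for c
      have "x (i + 1) = x (i + 2)" if "{Up (i + 1), Up (i + 2)} \<in> q"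
        using satD[OF xw that, of "Up (i + 1)" "Up (i + 2)"] by simp
      then have "sat a x y"
        unfolding sat_a by (auto simp: y_def algebra_simps)
      then have "sat (pcomp (star a) a) x x"
        by (intro sat_pcompD[OF aP star_P[OF aP]]) (simp_all add: sat_star)
      then show "sat (pcomp q (pcomp (star a) a)) x w"
        using xw by (rule sat_pcompD[OF aa qP])
    qed
  qed
  then have "q = pcomp (pcomp q (star a)) a"
    using pcomp_assoc[OF aP star_P[OF aP] qP] by simp
  moreover have "pcomp q (star a) \<in> NCb_sharp (k - 2) l"
    by (rule pcomp_NCb_sharp[OF star_NCb_sharp[OF a] q])
  moreover have "through_blocks (pcomp q (star a)) \<le> through_blocks q"
    by (rule through_blocks_pcomp_le_left[OF star_P[OF aP] qP])
  ultimately show ?thesis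
    using a by blast
qed

text \<open>Each cancellation removes two points from one of the rows, the lower one being treated
  through \<open>star\<close>. The bound on through-blocks is what later drives the descent.\<close>

lemma factorization:
  "q \<in> NCb_sharp k l \<Longrightarrow> \<exists>n m a b. (n, m) \<in> index_pairs \<and> a \<in> NCb_sharp n l \<and> b \<in> NCb_sharp k n \<and>
     q = pcomp a (pcomp (p_part n m) b) \<and> through_blocks (p_part n m) \<le> through_blocks q"
proof (induction "k + l" arbitrary: k l q rule: less_induct)
  case less
  note q = less.prems
  have pos: "2 \<le> k" if "reducible q k" for q k
    using that by (auto simp: reducible_def)
  have "q \<in> balanced k l"
    using q NCb_sharp_subset_balanced by blast
  then consider (upper) "reducible q k" | (lower) "reducible (star q) l"
    | (nf) m where "k = l" "(k, m) \<in> index_pairs" "q = p_part k m"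
    using normal_form_cases by blast
  then show ?case
  proof cases
    case upper
    then obtain q' c where c: "q' \<in> NCb_sharp (k - 2) l" "c \<in> NCb_sharp k (k - 2)" "q = pcomp q' c"
      "through_blocks q' \<le> through_blocks q"
      using reduction[OF q] by blast
    obtain n m a b where *: "(n, m) \<in> index_pairs" "a \<in> NCb_sharp n l" "b \<in> NCb_sharp (k - 2) n"
      "q' = pcomp a (pcomp (p_part n m) b)" "through_blocks (p_part n m) \<le> through_blocks q'"
      using less.hyps[OF _ c(1)] pos[OF upper] by auto
    note pP = p_part_P[OF index_pairs_subset[OF *(1)]]
    note P = NCb_sharp_P[OF *(2)] NCb_sharp_P[OF *(3)] NCb_sharp_P[OF c(2)]
    have "q = pcomp a (pcomp (p_part n m) (pcomp b c))"
      unfolding c(3) *(4) pcomp_assoc[OF P(3) pcomp_P[OF P(2) pP] P(1), symmetric]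
        pcomp_assoc[OF P(3) P(2) pP] ..
    moreover have "pcomp b c \<in> NCb_sharp k n"
      by (rule pcomp_NCb_sharp[OF c(2) *(3)])
    moreover have "through_blocks (p_part n m) \<le> through_blocks q"
      using *(5) c(4) by simp
    ultimately show ?thesis
      using *(1,2) by blast
  next
    case lower
    then obtain q' c where c: "q' \<in> NCb_sharp (l - 2) k" "c \<in> NCb_sharp l (l - 2)" "star q = pcomp q' c"
      "through_blocks q' \<le> through_blocks (star q)"
      using reduction[OF star_NCb_sharp[OF q]] by blast
    obtain n m a b where *: "(n, m) \<in> index_pairs" "a \<in> NCb_sharp n (l - 2)" "b \<in> NCb_sharp k n"
      "star q' = pcomp a (pcomp (p_part n m) b)" "through_blocks (p_part n m) \<le> through_blocks (star q')"
      using less.hyps[OF _ star_NCb_sharp[OF c(1)]] pos[OF lower] by auto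
    note pP = p_part_P[OF index_pairs_subset[OF *(1)]]
    note P = NCb_sharp_P[OF *(2)] NCb_sharp_P[OF *(3)] NCb_sharp_P[OF c(1)] NCb_sharp_P[OF c(2)]
    have "q = pcomp (star c) (star q')"
      using star_pcomp[OF P(4,3)] c(3) by (metis star_star)
    then have "q = pcomp (pcomp (star c) a) (pcomp (p_part n m) b)"
      unfolding *(4) pcomp_assoc[OF pcomp_P[OF P(2) pP] P(1) star_P[OF P(4)]] .
    moreover have "pcomp (star c) a \<in> NCb_sharp n l"
      by (rule pcomp_NCb_sharp[OF *(2) star_NCb_sharp[OF c(2)]])
    moreover have "through_blocks (p_part n m) \<le> through_blocks q"
      using *(5) c(4) by (simp add: through_blocks_star)
    ultimately show ?thesis
      using *(1,3) by blast
  next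
    case nf
    have "p_part k m \<in> P k k"
      using p_part_P[OF index_pairs_subset[OF nf(2)]] .
    then have "q = pcomp (id_part k) (pcomp (p_part k m) (id_part k))"
      by (simp add: nf pcomp_id_left pcomp_id_right)
    then show ?thesis
      using nf id_part_NCb_sharp
      by (intro exI[of _ k] exI[of _ m] exI[of _ "id_part k"]) simp
  qed
qed

lemma sum_fun_apply: "sum f I x = (\<Sum>i\<in>I. f i x)"
  for f :: "'i \<Rightarrow> 'a \<Rightarrow> 'b::comm_monoid_add"
  by (induction I rule: infinite_finite_induct) auto

context vector_space
begin

text \<open>The ambient space may be infinite-dimensional; only \<open>W\<close> lies in a finite
  span. A vector of \<open>W\<close> outside \<open>U\<close> enlarges a basis of
  \<open>U\<close>.\<close>

lemma dim_psubset:
  assumes U: "subspace U" "U \<subset> W" and B: "finite B" "W \<subseteq> span B"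
  shows "dim U < dim W"
proof -
  obtain C where C: "C \<subseteq> U" "independent C" "U \<subseteq> span C" "card C = dim U"
    using basis_exists[of U] by blast
  obtain D where D: "D \<subseteq> W" "independent D" "W \<subseteq> span D" "card D = dim W"
    using basis_exists[of W] by blast
  obtain v where v: "v \<in> W" "v \<notin> U"
    using U by blast
  have "span C \<subseteq> U"
    using C U by (intro span_minimal)
  then have ind: "independent (insert v C)" "v \<notin> C"
    using v C(1) by (auto intro!: independent_insertI[OF _ C(2)])
  have "finite D"
    using independent_span_bound[OF B(1) D(2)] D(1) B(2) by auto
  moreover have "insert v C \<subseteq> span D"
    using v C(1) U D(3) by auto
  ultimately have "finite (insert v C) \<and> card (insert v C) \<le> card D"
    using ind(1) by (intro independent_span_bound)
  then show ?thesis
    using ind(2) C(4) D(4) by (auto simp: card_insert_disjoint)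
qed

end

section \<open>Linear categories with finite-dimensional morphism spaces\<close>

text \<open>Finite dimension is phrased as containment in the span of a finite set: this passes at
  once to the smaller morphism spaces of the idempotent completion, and entry by entry to
  matrices.\<close>

locale lin_cat = vector_space scale
  for scale :: "'f::field \<Rightarrow> 'm::ab_group_add \<Rightarrow> 'm" (infixr "*s" 75) +
  fixes A :: "('o, 'm) preadd"
  assumes subspace_Hom: "x \<in> Ob A \<Longrightarrow> y \<in> Ob A \<Longrightarrow> subspace (Hom A x y)"
    and finite_span: "x \<in> Ob A \<Longrightarrow> y \<in> Ob A \<Longrightarrow> \<exists>B. finite B \<and> Hom A x y \<subseteq> span B"
    and Id_in: "x \<in> Ob A \<Longrightarrow> Id A x \<in> Hom A x x"
    and Comp_in: "x \<in> Ob A \<Longrightarrow> y \<in> Ob A \<Longrightarrow> z \<in> Ob A \<Longrightarrow> f \<in> Hom A x y \<Longrightarrow> g \<in> Hom A y z \<Longrightarrow>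
      Comp A x y z g f \<in> Hom A x z"
    and Comp_assoc: "w \<in> Ob A \<Longrightarrow> x \<in> Ob A \<Longrightarrow> y \<in> Ob A \<Longrightarrow> z \<in> Ob A \<Longrightarrow>
      f \<in> Hom A w x \<Longrightarrow> g \<in> Hom A x y \<Longrightarrow> h \<in> Hom A y z \<Longrightarrow>
      Comp A w x z (Comp A x y z h g) f = Comp A w y z h (Comp A w x y g f)"
    and Id_left: "x \<in> Ob A \<Longrightarrow> y \<in> Ob A \<Longrightarrow> f \<in> Hom A x y \<Longrightarrow> Comp A x y y (Id A y) f = f"
    and Id_right: "x \<in> Ob A \<Longrightarrow> y \<in> Ob A \<Longrightarrow> f \<in> Hom A x y \<Longrightarrow> Comp A x x y f (Id A x) = f"
    and Comp_add_left: "x \<in> Ob A \<Longrightarrow> y \<in> Ob A \<Longrightarrow> z \<in> Ob A \<Longrightarrow> f \<in> Hom A x y \<Longrightarrow>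
      g \<in> Hom A y z \<Longrightarrow> g' \<in> Hom A y z \<Longrightarrow>
      Comp A x y z (g + g') f = Comp A x y z g f + Comp A x y z g' f"
    and Comp_add_right: "x \<in> Ob A \<Longrightarrow> y \<in> Ob A \<Longrightarrow> z \<in> Ob A \<Longrightarrow> f \<in> Hom A x y \<Longrightarrow>
      f' \<in> Hom A x y \<Longrightarrow> g \<in> Hom A y z \<Longrightarrow>
      Comp A x y z g (f + f') = Comp A x y z g f + Comp A x y z g f'"
    and Comp_scale_left: "x \<in> Ob A \<Longrightarrow> y \<in> Ob A \<Longrightarrow> z \<in> Ob A \<Longrightarrow> f \<in> Hom A x y \<Longrightarrow>
      g \<in> Hom A y z \<Longrightarrow> Comp A x y z (c *s g) f = c *s Comp A x y z g f"
    and Comp_scale_right: "x \<in> Ob A \<Longrightarrow> y \<in> Ob A \<Longrightarrow> z \<in> Ob A \<Longrightarrow> f \<in> Hom A x y \<Longrightarrow>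
      g \<in> Hom A y z \<Longrightarrow> Comp A x y z g (c *s f) = c *s Comp A x y z g f"
begin

lemma Hom_zero [simp]: "x \<in> Ob A \<Longrightarrow> y \<in> Ob A \<Longrightarrow> 0 \<in> Hom A x y"
  by (rule subspace_0[OF subspace_Hom])

lemma Hom_add: "x \<in> Ob A \<Longrightarrow> y \<in> Ob A \<Longrightarrow> f \<in> Hom A x y \<Longrightarrow> g \<in> Hom A x y \<Longrightarrow> f + g \<in> Hom A x y"
  by (rule subspace_add[OF subspace_Hom])

lemma Hom_diff: "x \<in> Ob A \<Longrightarrow> y \<in> Ob A \<Longrightarrow> f \<in> Hom A x y \<Longrightarrow> g \<in> Hom A x y \<Longrightarrow> f - g \<in> Hom A x y"
  by (rule subspace_diff[OF subspace_Hom])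

lemma Hom_scale: "x \<in> Ob A \<Longrightarrow> y \<in> Ob A \<Longrightarrow> f \<in> Hom A x y \<Longrightarrow> c *s f \<in> Hom A x y"
  by (rule subspace_scale[OF subspace_Hom])

lemma Hom_sum: "x \<in> Ob A \<Longrightarrow> y \<in> Ob A \<Longrightarrow> (\<And>i. i \<in> I \<Longrightarrow> f i \<in> Hom A x y) \<Longrightarrow> sum f I \<in> Hom A x y"
  by (rule subspace_sum[OF subspace_Hom])

lemma Comp_zero_left:
  assumes "x \<in> Ob A" "y \<in> Ob A" "z \<in> Ob A" "f \<in> Hom A x y"
  shows "Comp A x y z 0 f = 0"
  using Comp_scale_left[OF assms, of 0 0] assms by simp

lemma Comp_zero_right:
  assumes "x \<in> Ob A" "y \<in> Ob A" "z \<in> Ob A" "g \<in> Hom A y z"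
  shows "Comp A x y z g 0 = 0"
  using Comp_scale_right[OF assms(1-3) _ assms(4), of 0 0] assms by simp

lemma Comp_diff_left:
  assumes "x \<in> Ob A" "y \<in> Ob A" "z \<in> Ob A" "f \<in> Hom A x y" "g \<in> Hom A y z" "g' \<in> Hom A y z"
  shows "Comp A x y z (g - g') f = Comp A x y z g f - Comp A x y z g' f"
  using Comp_add_left[OF assms(1-4) Hom_diff[OF assms(2,3,5,6)] assms(6)] by (simp add: algebra_simps)

lemma Comp_diff_right:
  assumes "x \<in> Ob A" "y \<in> Ob A" "z \<in> Ob A" "f \<in> Hom A x y" "f' \<in> Hom A x y" "g \<in> Hom A y z"
  shows "Comp A x y z g (f - f') = Comp A x y z g f - Comp A x y z g f'"
  using Comp_add_right[OF assms(1-3) Hom_diff[OF assms(1,2,4,5)] assms(5,6)] by (simp add: algebra_simps)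

lemma Comp_sum_left:
  assumes "x \<in> Ob A" "y \<in> Ob A" "z \<in> Ob A" "f \<in> Hom A x y" "\<And>i. i \<in> I \<Longrightarrow> g i \<in> Hom A y z"
  shows "Comp A x y z (sum g I) f = (\<Sum>i\<in>I. Comp A x y z (g i) f)"
  using assms(5)
proof (induction I rule: infinite_finite_induct)
  case (insert i I)
  then show ?case
    using Comp_add_left[OF assms(1-4), of "g i" "sum g I"] Hom_sum[OF assms(2,3), of I g] by simp
qed (use assms in \<open>simp_all add: Comp_zero_left\<close>)

lemma Comp_sum_right:
  assumes "x \<in> Ob A" "y \<in> Ob A" "z \<in> Ob A" "g \<in> Hom A y z" "\<And>i. i \<in> I \<Longrightarrow> f i \<in> Hom A x y"
  shows "Comp A x y z g (sum f I) = (\<Sum>i\<in>I. Comp A x y z g (f i))"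
  using assms(5)
proof (induction I rule: infinite_finite_induct)
  case (insert i I)
  then show ?case
    using Comp_add_right[OF assms(1-3) _ _ assms(4), of "f i" "sum f I"] Hom_sum[OF assms(1,2), of I f]
    by simp
qed (use assms in \<open>simp_all add: Comp_zero_right\<close>)

lemma zero_object_iff: "zero_object A x \<longleftrightarrow> x \<in> Ob A \<and> Id A x = 0"
proof
  assume "zero_object A x"
  then have "x \<in> Ob A" "\<exists>!f. f \<in> Hom A x x"
    by (auto simp: zero_object_def)
  then show "x \<in> Ob A \<and> Id A x = 0"
    using Id_in Hom_zero by blast
next
  assume *: "x \<in> Ob A \<and> Id A x = 0"
  have "f = 0" if "y \<in> Ob A" "f \<in> Hom A x y" for f y
    using Id_right[of x y f] Comp_zero_right[of x x y f] * that by simp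
  moreover have "f = 0" if "y \<in> Ob A" "f \<in> Hom A y x" for f y
    using Id_left[of y x f] Comp_zero_left[of y x x f] * that by simp
  ultimately show "zero_object A x"
    using * Hom_zero unfolding zero_object_def by blast
qed

lemma isomorphic_refl: "x \<in> Ob A \<Longrightarrow> isomorphic A x x"
  unfolding isomorphic_def using Id_in Id_left by blast

lemma isomorphic_sym: "isomorphic A x y \<Longrightarrow> isomorphic A y x"
  unfolding isomorphic_def by blast

lemma isomorphic_trans:
  assumes ob: "x \<in> Ob A" "y \<in> Ob A" "z \<in> Ob A" and iso: "isomorphic A x y" "isomorphic A y z"
  shows "isomorphic A x z"
proof -
  obtain f g where f: "f \<in> Hom A x y" "g \<in> Hom A y x" "Comp A x y x g f = Id A x" "Comp A y x y f g = Id A y"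
    using iso(1) unfolding isomorphic_def by blast
  obtain h k where h: "h \<in> Hom A y z" "k \<in> Hom A z y" "Comp A y z y k h = Id A y" "Comp A z y z h k = Id A z"
    using iso(2) unfolding isomorphic_def by blast
  have 1: "Comp A x y z h f \<in> Hom A x z" "Comp A z y x g k \<in> Hom A z x"
    using ob f h by (auto intro: Comp_in)
  have "Comp A x z x (Comp A z y x g k) (Comp A x y z h f) = Comp A x y x g (Comp A x z y k (Comp A x y z h f))"
    using ob f h 1 by (intro Comp_assoc) auto
  also have "Comp A x z y k (Comp A x y z h f) = Comp A x y y (Comp A y z y k h) f"
    using ob f h by (intro Comp_assoc[symmetric]) auto
  finally have 2: "Comp A x z x (Comp A z y x g k) (Comp A x y z h f) = Id A x"
    using ob f h by (simp add: Id_left)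
  have "Comp A z x z (Comp A x y z h f) (Comp A z y x g k) = Comp A z y z h (Comp A z x y f (Comp A z y x g k))"
    using ob f h 1 by (intro Comp_assoc) auto
  also have "Comp A z x y f (Comp A z y x g k) = Comp A z y y (Comp A y x y f g) k"
    using ob f h by (intro Comp_assoc[symmetric]) auto
  finally have "Comp A z x z (Comp A x y z h f) (Comp A z y x g k) = Id A z"
    using ob f h by (simp add: Id_left)
  then show ?thesis
    unfolding isomorphic_def using 1 2 by blast
qed

lemma equiv_iso_rel: "equiv (Ob A) (iso_rel A)"
proof (rule equivI)
  show "iso_rel A \<subseteq> Ob A \<times> Ob A"
    by (auto simp: iso_rel_def)
  show "refl_on (Ob A) (iso_rel A)"
    by (auto simp: refl_on_def iso_rel_def isomorphic_refl)
  show "sym (iso_rel A)"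
    by (auto simp: sym_def iso_rel_def isomorphic_sym)
  show "trans (iso_rel A)"
    unfolding trans_def iso_rel_def using isomorphic_trans by blast
qed

text \<open>The form of indecomposability used throughout: it speaks of a single endomorphism ring
  and makes sense before idempotents split. In the idempotent completion it characterises the
  nonzero indecomposable objects.\<close>

definition connected :: "'o \<Rightarrow> bool" where
  "connected x \<longleftrightarrow> x \<in> Ob A \<and> Id A x \<noteq> 0 \<and>
     (\<forall>e \<in> Hom A x x. Comp A x x x e e = e \<longrightarrow> e = 0 \<or> e = Id A x)"

text \<open>The projection onto the first summand is an idempotent, so it is 0 or the identity, and
  one of the two summands vanishes.\<close>

lemma connected_indecomposable:
  assumes "connected x"
  shows "indecomposable A x \<and> \<not> zero_object A x"
proof
  have x: "x \<in> Ob A" "Id A x \<noteq> 0"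
    using assms by (auto simp: connected_def)
  show "\<not> zero_object A x"
    using x by (simp add: zero_object_iff)
  show "indecomposable A x"
    unfolding indecomposable_def
  proof (intro conjI ballI impI x(1))
    fix y z assume yz: "y \<in> Ob A" "z \<in> Ob A" and "direct_sum A x y z"
    then obtain i j p q where m: "i \<in> Hom A y x" "j \<in> Hom A z x" "p \<in> Hom A x y" "q \<in> Hom A x z"
      and eq: "Comp A y x y p i = Id A y" "Comp A z x z q j = Id A z"
        "Comp A x y x i p + Comp A x z x j q = Id A x"
      unfolding direct_sum_def by blast
    note ob = x(1) yz
    let ?e = "Comp A x y x i p"
    have e: "?e \<in> Hom A x x"
      using ob m by (auto intro: Comp_in)
    have pe: "Comp A x x y p ?e = p"
      using ob m eq by (simp add: Comp_assoc[symmetric] Id_left)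
    have ee: "Comp A x x x ?e ?e = ?e"
      using Comp_assoc[of x x y x ?e p i] ob m e pe by simp
    show "zero_object A y \<or> zero_object A z"
    proof (cases "?e = 0")
      case True
      then have "p = 0"
        using pe Comp_zero_right[of x x y p] ob m by simp
      then have "Id A y = 0"
        using eq(1) Comp_zero_left[of y x y i] ob m by simp
      then show ?thesis
        using ob by (simp add: zero_object_iff)
    next
      case False
      then have "?e = Id A x"
        using assms e ee by (auto simp: connected_def)
      then have "Comp A x z x j q = 0"
        using eq(3) by simp
      moreover have "Comp A x x z q (Comp A x z x j q) = q"
        using ob m eq by (simp add: Comp_assoc[symmetric] Id_left)
      ultimately have "q = 0"
        using Comp_zero_right[of x x z q] ob m by simp
      then have "Id A z = 0"
        using eq(2) Comp_zero_left[of z x z j] ob m by simp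
      then show ?thesis
        using ob by (simp add: zero_object_iff)
    qed
  qed
qed

text \<open>A direct summand, stated without naming a complement.\<close>

definition retract :: "'o \<Rightarrow> 'o \<Rightarrow> bool" where
  "retract x y \<longleftrightarrow> (\<exists>i \<in> Hom A x y. \<exists>p \<in> Hom A y x. Comp A x y x p i = Id A x)"

lemma isomorphic_retract: "isomorphic A x y \<Longrightarrow> retract x y"
  unfolding isomorphic_def retract_def by blast

text \<open>The composite of \<open>p\<close> followed by \<open>i\<close> is a nonzero idempotent
  of a connected object, hence its identity.\<close>

lemma retract_isomorphic:
  assumes x: "x \<in> Ob A" "Id A x \<noteq> 0" and y: "connected y" and "retract x y"
  shows "isomorphic A x y"
proof -
  have ob: "x \<in> Ob A" "y \<in> Ob A"
    using x y by (auto simp: connected_def)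
  obtain i p where m: "i \<in> Hom A x y" "p \<in> Hom A y x" and pi: "Comp A x y x p i = Id A x"
    using assms(4) by (auto simp: retract_def)
  let ?e = "Comp A y x y i p"
  have e: "?e \<in> Hom A y y"
    using ob m by (auto intro: Comp_in)
  have pe: "Comp A y y x p ?e = p"
    using ob m pi by (simp add: Comp_assoc[symmetric] Id_left)
  have "Comp A y y y ?e ?e = ?e"
    using Comp_assoc[of y y x y ?e p i] ob m e pe by simp
  moreover have "?e \<noteq> 0"
  proof
    assume "?e = 0"
    then have "p = 0"
      using pe Comp_zero_right[of y y x p] ob m by simp
    then show False
      using pi x Comp_zero_left[of x y x i] ob m by simp
  qed
  ultimately have "?e = Id A y"
    using y e by (auto simp: connected_def)
  then show ?thesis
    unfolding isomorphic_def using m pi by blast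
qed

section \<open>Fitting's lemma\<close>

primrec pow :: "'o \<Rightarrow> 'm \<Rightarrow> nat \<Rightarrow> 'm" where
  "pow x a 0 = Id A x"
| "pow x a (Suc n) = Comp A x x x a (pow x a n)"

lemma pow_in: "x \<in> Ob A \<Longrightarrow> a \<in> Hom A x x \<Longrightarrow> pow x a n \<in> Hom A x x"
  by (induction n) (auto intro: Id_in Comp_in)

lemma pow_add:
  assumes "x \<in> Ob A" "a \<in> Hom A x x"
  shows "pow x a (i + j) = Comp A x x x (pow x a i) (pow x a j)"
  by (induction i) (use assms in \<open>simp_all add: Id_left pow_in Comp_assoc\<close>)

text \<open>If no power were a combination of higher ones, adding powers downwards would make
  arbitrarily many consecutive powers independent, against finite dimension.\<close>

lemma pow_dependent:
  assumes x: "x \<in> Ob A" and a: "a \<in> Hom A x x"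
  shows "\<exists>r. pow x a r \<in> span (pow x a ` {Suc r..})"
proof (rule ccontr)
  assume no: "\<not> ?thesis"
  have "independent (pow x a ` {r..<r + n}) \<and> card (pow x a ` {r..<r + n}) = n" for r n
  proof (induction n arbitrary: r)
    case (Suc n)
    let ?S = "pow x a ` {Suc r..<Suc r + n}"
    have "pow x a r \<notin> span ?S"
      using no span_mono[of ?S "pow x a ` {Suc r..}"] by fastforce
    moreover from this have "pow x a r \<notin> ?S"
      using span_base by blast
    moreover have "{r..<r + Suc n} = insert r {Suc r..<Suc r + n}"
      by auto
    then have "pow x a ` {r..<r + Suc n} = insert (pow x a r) ?S"
      by simp
    ultimately show ?case
      using Suc[of "Suc r"] by (simp add: independent_insert)
  qed (simp add: independent_empty)
  moreover obtain B where B: "finite B" "Hom A x x \<subseteq> span B"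
    using finite_span x by blast
  ultimately have "card (pow x a ` {0..<0 + Suc (card B)}) \<le> card B"
    using independent_span_bound[OF B(1), of "pow x a ` {0..<0 + Suc (card B)}"] pow_in[OF x a] by blast
  then show False
    using \<open>\<And>r n. independent (pow x a ` {r..<r + n}) \<and> card (pow x a ` {r..<r + n}) = n\<close>[of 0 "Suc (card B)"]
    by simp
qed

lemma Comp_span:
  assumes x: "x \<in> Ob A" and g: "g \<in> Hom A x x" and S: "S \<subseteq> Hom A x x" and v: "v \<in> span S"
    and T: "\<And>u. u \<in> S \<Longrightarrow> Comp A x x x g u \<in> span T"
  shows "Comp A x x x g v \<in> span T"
proof -
  have "v \<in> Hom A x x \<and> Comp A x x x g v \<in> span T"
    using v
  proof (rule span_induct)
    show "subspace {v. v \<in> Hom A x x \<and> Comp A x x x g v \<in> span T}"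
      using x g by (intro subspaceI)
        (simp_all add: Comp_zero_right span_zero Hom_add Comp_add_right span_add Hom_scale Comp_scale_right span_scale)
  qed (use S T in auto)
  then show ?thesis
    by simp
qed

text \<open>Fitting's lemma: some power of \<open>a\<close> is a combination of arbitrarily high powers of \<open>a\<close>, which
  yields an idempotent among the polynomials in \<open>a\<close>.\<close>

lemma nilpotent_or_unit:
  assumes c: "connected x" and a: "a \<in> Hom A x x"
  shows "(\<exists>n. pow x a n = 0) \<or> (\<exists>b\<in>Hom A x x. Comp A x x x a b = Id A x)"
proof -
  have x: "x \<in> Ob A"
    using c by (simp add: connected_def)
  let ?m = "Comp A x x x" and ?p = "pow x a"
  note pin = pow_in[OF x a] and padd = pow_add[OF x a]
  note assoc = Comp_assoc[OF x x x x] and cin = Comp_in[OF x x x]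
  obtain r where r: "?p r \<in> span (?p ` {Suc r..})"
    using pow_dependent[OF x a] by blast
  \<comment> \<open>The relation at \<open>r\<close>, multiplied by the power
    \<open>i - r\<close>.\<close>
  have shift: "?p i \<in> span (?p ` {Suc i..})" if i: "r \<le> i" for i
  proof -
    have "?m (?p (i - r)) (?p r) \<in> span (?p ` {Suc i..})"
    proof (rule Comp_span[OF x pin _ r])
      show "?m (?p (i - r)) u \<in> span (?p ` {Suc i..})" if u: "u \<in> ?p ` {Suc r..}" for u
      proof -
        obtain j where j: "Suc r \<le> j" "u = ?p j"
          using u by auto
        have "?m (?p (i - r)) u = ?p (i - r + j)"
          unfolding padd j(2) ..
        moreover have "i - r + j \<in> {Suc i..}"
          using i j(1) by auto
        ultimately show ?thesis
          by (metis imageI span_base)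
      qed
    qed (use pin in auto)
    then show ?thesis
      using i by (simp add: padd[symmetric])
  qed
  have high: "?p r \<in> span (?p ` {r + d..})" for d
  proof (induction d)
    case 0
    show ?case
      by (simp add: span_base)
  next
    case (Suc d)
    have "?p i \<in> span (?p ` {r + Suc d..})" if "r + d \<le> i" for i
      using shift[of i] that span_mono[of "?p ` {Suc i..}" "?p ` {r + Suc d..}"] by fastforce
    then have "?p ` {r + d..} \<subseteq> span (?p ` {r + Suc d..})"
      by auto
    then have "span (?p ` {r + d..}) \<subseteq> span (?p ` {r + Suc d..})"
      by (rule span_minimal) (rule subspace_span)
    then show ?case
      using Suc by blast
  qed
  have poly: "v \<in> Hom A x x \<and> ?m v (?p j) = ?m (?p j) v" if "v \<in> span (range ?p)" for v j
    using that
  proof (rule span_induct)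
    show "subspace {v. v \<in> Hom A x x \<and> ?m v (?p j) = ?m (?p j) v}"
      using x pin by (intro subspaceI)
        (simp_all add: Comp_zero_right Comp_zero_left Hom_add Comp_add_right Comp_add_left Hom_scale
          Comp_scale_right Comp_scale_left)
    have "?p i \<in> Hom A x x \<and> ?m (?p i) (?p j) = ?m (?p j) (?p i)" for i
      using pin by (simp add: padd[symmetric] add.commute)
    then show "\<And>v. v \<in> range ?p \<Longrightarrow> v \<in> Hom A x x \<and> ?m v (?p j) = ?m (?p j) v"
      by blast
  qed
  \<comment> \<open>The exponent 2r+1 is chosen for the candidate e = a * a^r * h: it gives a^r * e
    = a^(2r+1) * h = a^r, and then e * e = a * h * (a^r * e) = e. If e = 0 then a^r = 0; if e is the
    identity, \<open>a\<close> has a right inverse.\<close>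
  have "\<exists>h\<in>span (range ?p). ?p r = ?m (?p (r + Suc r)) h"
    using high[of "Suc r"]
  proof (rule span_induct)
    let ?s = "r + Suc r"
    define g where "g = ?p ?s"
    have g: "g \<in> Hom A x x"
      using pin by (simp only: g_def)
    let ?V = "{v. \<exists>h\<in>span (range ?p). v = ?m g h}"
    have "subspace ?V"
    proof (rule subspaceI)
      show "0 \<in> ?V"
        using x g by (auto intro!: bexI[of _ 0] simp: Comp_zero_right span_zero)
      show "u + v \<in> ?V" if uv: "u \<in> ?V" "v \<in> ?V" for u v
      proof -
        obtain h h' where h: "h \<in> span (range ?p)" "u = ?m g h" "h' \<in> span (range ?p)" "v = ?m g h'"
          using uv by blast
        then have "u + v = ?m g (h + h')"
          using x g poly by (simp add: Comp_add_right)
        then show ?thesis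
          using span_add[OF h(1,3)] by blast
      qed
      show "c *s u \<in> ?V" if u: "u \<in> ?V" for c u
      proof -
        obtain h where h: "h \<in> span (range ?p)" "u = ?m g h"
          using u by blast
        then have "c *s u = ?m g (c *s h)"
          using x g poly by (simp add: Comp_scale_right)
        then show ?thesis
          using span_scale[OF h(1)] by blast
      qed
    qed
    then show "subspace {v. \<exists>h\<in>span (range ?p). v = ?m (?p ?s) h}"
      by (simp only: g_def)
    show "\<exists>h\<in>span (range ?p). v = ?m (?p ?s) h" if v: "v \<in> ?p ` {?s..}" for v
    proof -
      obtain i where "?s \<le> i" "v = ?p i"
        using v by auto
      then have "v = ?m (?p ?s) (?p (i - ?s))"
        using padd[of ?s "i - ?s"] by simp
      then show ?thesis
        using span_base by blast
    qed
  qed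
  then obtain h where h: "h \<in> span (range ?p)" "?p r = ?m (?p (r + Suc r)) h"
    by blast
  have hin: "h \<in> Hom A x x" and hcomm: "?m h (?p j) = ?m (?p j) h" for j
    using poly[OF h(1)] by auto
  let ?b = "?m (?p r) h"
  have bin: "?b \<in> Hom A x x"
    using pin hin cin by blast
  let ?e = "?m a ?b"
  have ein: "?e \<in> Hom A x x"
    using a bin cin by blast
  have rr: "?p (r + Suc r) = ?m (?p r) (?m a (?p r))"
    by (simp only: padd pow.simps)
  have "?m (?p r) ?e = ?m (?m (?p r) (?m a (?p r))) h"
    unfolding assoc[OF hin cin[OF pin a] pin] assoc[OF hin pin a] ..
  then have re: "?m (?p r) ?e = ?p r"
    unfolding rr[symmetric] h(2)[symmetric] .
  have "?m ?e ?e = ?m a (?m (?m h (?p r)) ?e)"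
    unfolding hcomm by (rule assoc[OF ein bin a])
  also have "\<dots> = ?m a (?m h (?m (?p r) ?e))"
    unfolding assoc[OF ein pin hin] ..
  also have "\<dots> = ?e"
    unfolding re hcomm ..
  finally have "?e = 0 \<or> ?e = Id A x"
    using c ein by (auto simp: connected_def)
  then show ?thesis
  proof
    assume "?e = 0"
    then have "?p r = 0"
      using re Comp_zero_right[OF x x x pin[of r]] by simp
    then show ?thesis
      by blast
  qed (use bin in blast)
qed

section \<open>Local endomorphism rings\<close>

definition unit :: "'o \<Rightarrow> 'm \<Rightarrow> bool" where
  "unit x a \<longleftrightarrow> (\<exists>b\<in>Hom A x x. Comp A x x x a b = Id A x)"

lemma unit_leftD:
  assumes "x \<in> Ob A" "a \<in> Hom A x x" "u \<in> Hom A x x" "unit x (Comp A x x x a u)"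
  shows "unit x a"
  using assms unfolding unit_def by (auto simp: Comp_assoc intro: Comp_in)

text \<open>After multiplying by a right inverse of the sum, the two summands add up to the
  identity. If the first is not a unit it is nilpotent, and a finite geometric sum inverts the
  second. A right inverse is what Fitting's lemma supplies and what a retraction requires.\<close>

lemma unit_add:
  assumes c: "connected x" and ab: "a \<in> Hom A x x" "b \<in> Hom A x x" and u: "unit x (a + b)"
  shows "unit x a \<or> unit x b"
proof -
  have x: "x \<in> Ob A"
    using c by (simp add: connected_def)
  obtain v where v: "v \<in> Hom A x x" "Comp A x x x (a + b) v = Id A x"
    using u by (auto simp: unit_def)
  let ?c = "Comp A x x x a v" and ?d = "Comp A x x x b v"
  have cd: "?c \<in> Hom A x x" "?d \<in> Hom A x x"
    using x ab v by (auto intro: Comp_in)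
  have sum: "?c + ?d = Id A x"
    using Comp_add_left[OF x x x v(1) ab] v(2) by simp
  show ?thesis
  proof (cases "unit x ?c")
    case True
    then show ?thesis
      using unit_leftD x ab v by blast
  next
    case False
    then obtain n where n: "pow x ?c n = 0"
      using nilpotent_or_unit[OF c cd(1)] by (auto simp: unit_def)
    \<comment> \<open>\<open>s\<close> is the partial geometric sum 1 + c + ... + c^(n-1) for c =
      \<open>?c\<close>.\<close>
    have "\<exists>s\<in>Hom A x x. Comp A x x x ?d s = Id A x - pow x ?c n" for n
    proof (induction n)
      case 0
      show ?case
        using x cd by (intro bexI[of _ 0]) (simp_all add: Comp_zero_right)
    next
      case (Suc n)
      then obtain s where s: "s \<in> Hom A x x" "Comp A x x x ?d s = Id A x - pow x ?c n"
        by blast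
      have d: "?d = Id A x - ?c"
        using sum by (simp add: algebra_simps)
      have p: "pow x ?c n \<in> Hom A x x"
        by (rule pow_in[OF x cd(1)])
      have "Comp A x x x ?d (pow x ?c n) = pow x ?c n - pow x ?c (Suc n)"
        unfolding d using Comp_diff_left[OF x x x p Id_in[OF x] cd(1)] Id_left[OF x x p] by simp
      then have "Comp A x x x ?d (s + pow x ?c n) = Id A x - pow x ?c (Suc n)"
        using Comp_add_right[OF x x x s(1) p cd(2)] s(2) by simp
      then show ?case
        using Hom_add[OF x x s(1) p] by blast
    qed
    from this[of n] have "unit x ?d"
      using n by (simp add: unit_def)
    then show ?thesis
      using unit_leftD x ab v by blast
  qed
qed

lemma unit_sum:
  assumes c: "connected x" and "finite I" and f: "\<And>i. i \<in> I \<Longrightarrow> f i \<in> Hom A x x"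
    and u: "unit x (sum f I)"
  shows "\<exists>i\<in>I. unit x (f i)"
  using assms(2-)
proof (induction I)
  case empty
  then show ?case
    using c Comp_zero_left[of x x x] by (auto simp: unit_def connected_def)
next
  case (insert i I)
  have x: "x \<in> Ob A"
    using c by (simp add: connected_def)
  have "unit x (f i) \<or> unit x (sum f I)"
    using insert Hom_sum[OF x x, of I f] by (intro unit_add[OF c]) auto
  then show ?case
    using insert by auto
qed

text \<open>The core of the Krull-Schmidt argument: by locality one summand of the identity is a
  unit, and its right inverse can be absorbed into the inclusion.\<close>

lemma retract_sum:
  assumes c: "connected x" and "finite I" and y: "\<And>i. i \<in> I \<Longrightarrow> y i \<in> Ob A"
    and j: "\<And>i. i \<in> I \<Longrightarrow> j i \<in> Hom A x (y i)" and p: "\<And>i. i \<in> I \<Longrightarrow> p i \<in> Hom A (y i) x"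
    and eq: "(\<Sum>i\<in>I. Comp A x (y i) x (p i) (j i)) = Id A x"
  shows "\<exists>i\<in>I. retract x (y i)"
proof -
  have x: "x \<in> Ob A"
    using c by (simp add: connected_def)
  have "unit x (Id A x)"
    unfolding unit_def using x Id_in Id_left by blast
  then have "\<exists>i\<in>I. unit x (Comp A x (y i) x (p i) (j i))"
    using x y j p by (intro unit_sum[OF c \<open>finite I\<close>]) (auto simp: eq intro: Comp_in)
  then obtain i b where i: "i \<in> I" "b \<in> Hom A x x" "Comp A x x x (Comp A x (y i) x (p i) (j i)) b = Id A x"
    unfolding unit_def by blast
  have "Comp A x (y i) x (p i) (Comp A x x (y i) (j i) b) = Id A x"
    using i x y j p by (simp add: Comp_assoc)
  moreover have "Comp A x x (y i) (j i) b \<in> Hom A x (y i)"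
    using i x y j by (auto intro: Comp_in)
  ultimately show ?thesis
    unfolding retract_def using i(1) p by blast
qed

lemma retract_trans:
  assumes ob: "x \<in> Ob A" "y \<in> Ob A" "z \<in> Ob A" and "retract x y" "retract y z"
  shows "retract x z"
proof -
  obtain i p where i: "i \<in> Hom A x y" "p \<in> Hom A y x" "Comp A x y x p i = Id A x"
    using assms by (auto simp: retract_def)
  obtain j q where j: "j \<in> Hom A y z" "q \<in> Hom A z y" "Comp A y z y q j = Id A y"
    using assms by (auto simp: retract_def)
  have m: "Comp A x y z j i \<in> Hom A x z" "Comp A z y x p q \<in> Hom A z x"
    using ob i j by (auto intro: Comp_in)
  have "Comp A x z x (Comp A z y x p q) (Comp A x y z j i) =
      Comp A x y x p (Comp A x z y q (Comp A x y z j i))"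
    using ob i j m by (intro Comp_assoc) auto
  also have "Comp A x z y q (Comp A x y z j i) = Comp A x y y (Comp A y z y q j) i"
    using ob i j by (intro Comp_assoc[symmetric]) auto
  finally have "Comp A x z x (Comp A z y x p q) (Comp A x y z j i) = Id A x"
    using ob i j by (simp add: Id_left)
  then show ?thesis
    unfolding retract_def using m by blast
qed

text \<open>A decomposition of the identity of \<open>y\<close> is carried to \<open>x\<close> along
  the retraction; the \<open>z i\<close> need not be complementary summands of
  \<open>y\<close>.\<close>

lemma retract_through:
  assumes c: "connected x" and y: "y \<in> Ob A" and "retract x y" and "finite I"
    and z: "\<And>i. i \<in> I \<Longrightarrow> z i \<in> Ob A"
    and j: "\<And>i. i \<in> I \<Longrightarrow> j i \<in> Hom A y (z i)" and p: "\<And>i. i \<in> I \<Longrightarrow> p i \<in> Hom A (z i) y"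
    and eq: "(\<Sum>i\<in>I. Comp A y (z i) y (p i) (j i)) = Id A y"
  shows "\<exists>i\<in>I. retract x (z i)"
proof -
  have x: "x \<in> Ob A"
    using c by (simp add: connected_def)
  obtain u v where u: "u \<in> Hom A x y" "v \<in> Hom A y x" "Comp A x y x v u = Id A x"
    using assms(3) by (auto simp: retract_def)
  show ?thesis
  proof (rule retract_sum[OF c \<open>finite I\<close> z])
    have pj: "Comp A y (z i) y (p i) (j i) \<in> Hom A y y" if "i \<in> I" for i
      using that y z j p by (intro Comp_in)
    show "Comp A x y (z i) (j i) u \<in> Hom A x (z i)" "Comp A (z i) y x v (p i) \<in> Hom A (z i) x" if "i \<in> I" for i
      using that x y z j p u by (auto intro: Comp_in)
    have "Comp A x (z i) x (Comp A (z i) y x v (p i)) (Comp A x y (z i) (j i) u) =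
        Comp A x y x v (Comp A x y y (Comp A y (z i) y (p i) (j i)) u)" if "i \<in> I" for i
      using that x y z j p u by (simp add: Comp_assoc Comp_in)
    then have "(\<Sum>i\<in>I. Comp A x (z i) x (Comp A (z i) y x v (p i)) (Comp A x y (z i) (j i) u)) =
        (\<Sum>i\<in>I. Comp A x y x v (Comp A x y y (Comp A y (z i) y (p i) (j i)) u))"
      by (rule sum.cong[OF refl])
    also have "\<dots> = Comp A x y x v (\<Sum>i\<in>I. Comp A x y y (Comp A y (z i) y (p i) (j i)) u)"
      using x y z j p u by (intro Comp_sum_right[symmetric]) (simp_all add: Comp_in pj)
    also have "(\<Sum>i\<in>I. Comp A x y y (Comp A y (z i) y (p i) (j i)) u) = Comp A x y y (Id A y) u"
      unfolding eq[symmetric] using x y z j p u by (intro Comp_sum_left[symmetric]) (simp_all add: pj)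
    finally show "(\<Sum>i\<in>I. Comp A x (z i) x (Comp A (z i) y x v (p i)) (Comp A x y (z i) (j i) u)) = Id A x"
      using x y u by (simp add: Id_left)
  qed
qed

end

subsection \<open>Completions\<close>

context lin_cat
begin

abbreviation "K \<equiv> idempotent_completion A"

lemma idempotent_completion_simps:
  "(x, e) \<in> Ob K \<longleftrightarrow> x \<in> Ob A \<and> e \<in> Hom A x x \<and> Comp A x x x e e = e"
  "Hom K (x, e) (y, f) = {a \<in> Hom A x y. Comp A x x y a e = a \<and> Comp A x y y f a = a}"
  "Id K (x, e) = e"
  "Comp K (x, e) (y, f) (z, g) = Comp A x y z"
  by (simp_all add: idempotent_completion_def)

lemma lin_cat_idempotent_completion: "lin_cat scale K"
proof unfold_locales
  note simps = idempotent_completion_simps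
  fix X Y assume X: "X \<in> Ob K" and Y: "Y \<in> Ob K"
  obtain x e y f where xy: "X = (x, e)" "Y = (y, f)"
    by (cases X; cases Y)
  note ob = X[unfolded xy simps] Y[unfolded xy simps]
  show "subspace (Hom K X Y)"
    unfolding xy simps using ob
    by (intro subspaceI) (simp_all add: Comp_zero_left Comp_zero_right Hom_add Hom_scale
        Comp_add_left Comp_add_right Comp_scale_left Comp_scale_right)
  show "\<exists>B. finite B \<and> Hom K X Y \<subseteq> span B"
    unfolding xy simps using finite_span[of x y] ob by blast
  show "Id K X \<in> Hom K X X"
    unfolding xy simps using ob by simp
  fix a assume a: "a \<in> Hom K X Y"
  note a' = a[unfolded xy simps]
  show "Comp K X Y Y (Id K Y) a = a" "Comp K X X Y a (Id K X) = a"
    unfolding xy simps using a' by simp_all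
next
  note simps = idempotent_completion_simps
  fix X Y Z a b assume X: "X \<in> Ob K" and Y: "Y \<in> Ob K" and Z: "Z \<in> Ob K"
    and ab: "a \<in> Hom K X Y" "b \<in> Hom K Y Z"
  obtain x e y f z g where xyz: "X = (x, e)" "Y = (y, f)" "Z = (z, g)"
    by (cases X; cases Y; cases Z)
  note ob = X[unfolded xyz simps] Y[unfolded xyz simps] Z[unfolded xyz simps]
  note ab' = ab[unfolded xyz simps]
  show "Comp K X Y Z b a \<in> Hom K X Z"
    unfolding xyz simps using ob ab'
    by (simp add: Comp_in Comp_assoc) (simp add: Comp_assoc[symmetric])
  show "Comp K X Y Z (c *s b) a = c *s Comp K X Y Z b a" "Comp K X Y Z b (c *s a) = c *s Comp K X Y Z b a" for c
    unfolding xyz simps using ob ab' by (simp_all add: Comp_scale_left Comp_scale_right)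
  show "Comp K X Y Z (b + b') a = Comp K X Y Z b a + Comp K X Y Z b' a" if "b' \<in> Hom K Y Z" for b'
    using that unfolding xyz simps using ob ab' by (simp add: Comp_add_left)
  show "Comp K X Y Z b (a + a') = Comp K X Y Z b a + Comp K X Y Z b a'" if "a' \<in> Hom K X Y" for a'
    using that unfolding xyz simps using ob ab' by (simp add: Comp_add_right)
  fix W h assume W: "W \<in> Ob K" and h: "h \<in> Hom K W X"
  obtain w d where w: "W = (w, d)"
    by (cases W)
  show "Comp K W X Z (Comp K X Y Z b a) h = Comp K W Y Z b (Comp K W X Y a h)"
    using W h unfolding w xyz simps using ob ab' by (simp add: Comp_assoc)
qed

text \<open>In the idempotent completion an idempotent \<open>a\<close> of \<open>(x, f)\<close>
  splits off the summand \<open>(x, a)\<close>, with complement \<open>(x, f - a)\<close>.\<close>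

lemma indecomposable_connected:
  assumes ind: "indecomposable K X" and nz: "\<not> zero_object K X"
  shows "lin_cat.connected K X"
proof -
  interpret K: lin_cat scale K
    by (rule lin_cat_idempotent_completion)
  note simps = idempotent_completion_simps
  have X: "X \<in> Ob K"
    using ind by (simp add: indecomposable_def)
  obtain x f where xf: "X = (x, f)"
    by (cases X)
  note ob = X[unfolded xf simps]
  show ?thesis
    unfolding K.connected_def
  proof (intro conjI ballI impI X)
    show "Id K X \<noteq> 0"
      using nz X by (simp add: K.zero_object_iff)
    fix a assume a: "a \<in> Hom K X X" "Comp K X X X a a = a"
    note a' = a[unfolded xf simps]
    have Y: "(x, a) \<in> Ob K"
      using ob a' by (simp add: simps)
    have Z: "(x, f - a) \<in> Ob K"
      using ob a' by (simp add: simps Hom_diff Comp_diff_left Comp_diff_right)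
    have "direct_sum K X (x, a) (x, f - a)"
      unfolding direct_sum_def xf simps using ob a'
      by (intro bexI[of _ a] bexI[of _ "f - a"])
        (simp_all add: Hom_diff Comp_diff_left Comp_diff_right)
    then have "zero_object K (x, a) \<or> zero_object K (x, f - a)"
      using ind Y Z by (auto simp: indecomposable_def)
    then show "a = 0 \<or> a = Id K X"
      by (auto simp: K.zero_object_iff simps xf)
  qed
qed

section \<open>Matrices over a linear category\<close>

abbreviation "M \<equiv> additive_completion A"

lemma vector_space_matrix: "vector_space (\<lambda>c (X :: nat \<Rightarrow> nat \<Rightarrow> 'm) i j. c *s X i j)"
  by unfold_locales (auto simp: fun_eq_iff scale_right_distrib scale_left_distrib)

lemma additive_completion_simps:
  "xs \<in> Ob M \<longleftrightarrow> set xs \<subseteq> Ob A"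
  "Hom M xs ys = {a.
       (\<forall>i j. i < length ys \<and> j < length xs \<longrightarrow> a i j \<in> Hom A (xs ! j) (ys ! i)) \<and>
       (\<forall>i j. \<not> (i < length ys \<and> j < length xs) \<longrightarrow> a i j = 0)}"
  "Id M xs = (\<lambda>i j. if i = j \<and> i < length xs then Id A (xs ! i) else 0)"
  "Comp M xs ys zs b a = (\<lambda>i j.
       if i < length zs \<and> j < length xs
       then \<Sum>n<length ys. Comp A (xs ! j) (ys ! n) (zs ! i) (b i n) (a n j)
       else 0)"
  by (simp_all add: additive_completion_def)

lemma lin_cat_additive_completion: "lin_cat (\<lambda>c X i j. c *s X i j) M"
proof -
  note simps = additive_completion_simps
  interpret V: vector_space "\<lambda>c (X :: nat \<Rightarrow> nat \<Rightarrow> 'm) i j. c *s X i j"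
    by (rule vector_space_matrix)
  have nth: "xs ! i \<in> Ob A" if "set xs \<subseteq> Ob A" "i < length xs" for xs i
    using that nth_mem by blast
  show ?thesis
  proof unfold_locales
    fix xs ys assume X: "xs \<in> Ob M" and Y: "ys \<in> Ob M"
    have nx: "xs ! i \<in> Ob A" if "i < length xs" for i
      using nth[OF X[unfolded simps] that] .
    have ny: "ys ! i \<in> Ob A" if "i < length ys" for i
      using nth[OF Y[unfolded simps] that] .
    show "V.subspace (Hom M xs ys)"
      unfolding simps by (rule V.subspaceI) (simp_all add: nx ny Hom_add Hom_scale)
    show "\<exists>B. finite B \<and> Hom M xs ys \<subseteq> V.span B"
    proof -
      define B where "B i j = (SOME B. finite B \<and> Hom A (xs ! j) (ys ! i) \<subseteq> span B)" for i j
      have B: "finite (B i j) \<and> Hom A (xs ! j) (ys ! i) \<subseteq> span (B i j)" if "i < length ys" "j < length xs" for i j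
        unfolding B_def by (rule someI_ex) (rule finite_span[OF nx[OF that(2)] ny[OF that(1)]])
      \<comment> \<open>Matrices with a single entry: they carry the finite spanning sets of the
        entries to one for the matrices.\<close>
      define E where "E i j b = (\<lambda>i' j'. if i' = i \<and> j' = j then b else 0)" for i j :: nat and b :: 'm
      let ?S = "\<Union>i<length ys. \<Union>j<length xs. E i j ` B i j"
      have E: "E i j b \<in> V.span ?S" if ij: "i < length ys" "j < length xs" and b: "b \<in> span (B i j)" for i j b
        using b
      proof (rule span_induct)
        show "subspace {b. E i j b \<in> V.span ?S}"
        proof (rule subspaceI; clarsimp)
          have "E i j 0 = 0"
            by (auto simp: E_def fun_eq_iff)
          then show "E i j 0 \<in> V.span ?S"
            by (simp add: V.span_zero)
          have "E i j (b + b') = E i j b + E i j b'" for b b'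
            by (auto simp: E_def fun_eq_iff)
          then show "E i j (b + b') \<in> V.span ?S" if "E i j b \<in> V.span ?S" "E i j b' \<in> V.span ?S" for b b'
            using that by (simp add: V.span_add)
          have "E i j (c *s b) = (\<lambda>k l. c *s E i j b k l)" for b c
            by (auto simp: E_def fun_eq_iff)
          then show "E i j (c *s b) \<in> V.span ?S" if "E i j b \<in> V.span ?S" for b c
            using V.span_scale[OF that, of c] by simp
        qed
        show "E i j b \<in> V.span ?S" if "b \<in> B i j" for b
          using that ij by (intro V.span_base) blast
      qed
      have "a \<in> V.span ?S" if a: "a \<in> Hom M xs ys" for a
      proof -
        have "a = (\<Sum>i<length ys. \<Sum>j<length xs. E i j (a i j))"
        proof (intro ext)
          fix i' j'
          have "(\<Sum>i<length ys. \<Sum>j<length xs. E i j (a i j)) i' j' =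
            (\<Sum>i<length ys. \<Sum>j<length xs. E i j (a i j) i' j')"
            by (simp add: sum_fun_apply)
          also have "\<dots> = (\<Sum>i<length ys. if i = i' then (\<Sum>j<length xs. if j = j' then a i' j' else 0) else 0)"
            by (intro sum.cong refl) (auto simp: E_def intro!: sum.cong sum.neutral)
          also have "\<dots> = a i' j'"
            using a by (auto simp: simps)
          finally show "a i' j' = (\<Sum>i<length ys. \<Sum>j<length xs. E i j (a i j)) i' j'"
            by simp
        qed
        also have "\<dots> \<in> V.span ?S"
        proof (intro V.span_sum E)
          fix i j assume ij: "i \<in> {..<length ys}" "j \<in> {..<length xs}"
          then show ij: "i < length ys" "j < length xs"
            by auto
          then have "a i j \<in> Hom A (xs ! j) (ys ! i)"
            using a by (simp add: simps)
          then show "a i j \<in> span (B i j)"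
            using B[OF ij] by blast
        qed
        finally show ?thesis .
      qed
      moreover have "finite ?S"
        using B by auto
      ultimately show ?thesis
        by blast
    qed
    show "Id M xs \<in> Hom M xs xs"
      unfolding simps by (simp add: nx Id_in)
    fix a assume a: "a \<in> Hom M xs ys"
    note a' = a[unfolded simps]
    show "Comp M xs ys ys (Id M ys) a = a"
    proof (intro ext)
      fix i j
      have "Comp A (xs ! j) (ys ! n) (ys ! i) (if i = n \<and> i < length ys then Id A (ys ! i) else 0) (a n j) =
        (if n = i then a i j else 0)" if "i < length ys" "j < length xs" "n < length ys" for n
        using that a' by (simp add: nx ny Id_left Comp_zero_left)
      then show "Comp M xs ys ys (Id M ys) a i j = a i j"
        using a' unfolding simps by (auto cong: sum.cong_simp)
    qed
    show "Comp M xs xs ys a (Id M xs) = a"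
    proof (intro ext)
      fix i j
      have "Comp A (xs ! j) (xs ! n) (ys ! i) (a i n) (if n = j \<and> n < length xs then Id A (xs ! n) else 0) =
        (if n = j then a i j else 0)" if "i < length ys" "j < length xs" "n < length xs" for n
        using that a' by (simp add: nx ny Id_right Comp_zero_right)
      then show "Comp M xs xs ys a (Id M xs) i j = a i j"
        using a' unfolding simps by (auto cong: sum.cong_simp)
    qed
  next
    fix xs ys zs a b assume X: "xs \<in> Ob M" and Y: "ys \<in> Ob M" and Z: "zs \<in> Ob M"
      and ab: "a \<in> Hom M xs ys" "b \<in> Hom M ys zs"
    have nx: "xs ! i \<in> Ob A" if "i < length xs" for i
      using nth[OF X[unfolded simps] that] .
    have ny: "ys ! i \<in> Ob A" if "i < length ys" for i
      using nth[OF Y[unfolded simps] that] .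
    have nz: "zs ! i \<in> Ob A" if "i < length zs" for i
      using nth[OF Z[unfolded simps] that] .
    note ab' = ab[unfolded simps]
    show "Comp M xs ys zs b a \<in> Hom M xs zs"
      unfolding simps using ab' by (auto intro!: Hom_sum Comp_in nx ny nz)
    show "Comp M xs ys zs (\<lambda>i j. c *s b i j) a = (\<lambda>i j. c *s Comp M xs ys zs b a i j)" for c
      unfolding simps using ab' by (intro ext) (simp add: nx ny nz Comp_scale_left scale_sum_right)
    show "Comp M xs ys zs b (\<lambda>i j. c *s a i j) = (\<lambda>i j. c *s Comp M xs ys zs b a i j)" for c
      unfolding simps using ab' by (intro ext) (simp add: nx ny nz Comp_scale_right scale_sum_right)
    show "Comp M xs ys zs (b + b') a = Comp M xs ys zs b a + Comp M xs ys zs b' a" if "b' \<in> Hom M ys zs" for b'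
      using that ab' unfolding simps by (intro ext) (simp add: nx ny nz Comp_add_left sum.distrib)
    show "Comp M xs ys zs b (a + a') = Comp M xs ys zs b a + Comp M xs ys zs b a'" if "a' \<in> Hom M xs ys" for a'
      using that ab' unfolding simps by (intro ext) (simp add: nx ny nz Comp_add_right sum.distrib)
    fix ws h assume W: "ws \<in> Ob M" and h: "h \<in> Hom M ws xs"
    have nw: "ws ! i \<in> Ob A" if "i < length ws" for i
      using nth[OF W[unfolded simps] that] .
    note h' = h[unfolded simps]
    show "Comp M ws xs zs (Comp M xs ys zs b a) h = Comp M ws ys zs b (Comp M ws xs ys a h)"
    proof (intro ext)
      fix i j
      show "Comp M ws xs zs (Comp M xs ys zs b a) h i j = Comp M ws ys zs b (Comp M ws xs ys a h) i j"
      proof (cases "i < length zs \<and> j < length ws")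
        case True
        let ?c = "\<lambda>n k. Comp A (ws ! j) (ys ! k) (zs ! i) (b i k) (Comp A (ws ! j) (xs ! n) (ys ! k) (a k n) (h n j))"
        have "Comp M ws xs zs (Comp M xs ys zs b a) h i j =
          (\<Sum>n<length xs. Comp A (ws ! j) (xs ! n) (zs ! i)
            (\<Sum>k<length ys. Comp A (xs ! n) (ys ! k) (zs ! i) (b i k) (a k n)) (h n j))"
          unfolding simps using True by simp
        also have "\<dots> = (\<Sum>n<length xs. \<Sum>k<length ys. ?c n k)"
        proof (rule sum.cong[OF refl])
          fix n assume n: "n \<in> {..<length xs}"
          have "Comp A (ws ! j) (xs ! n) (zs ! i)
            (\<Sum>k<length ys. Comp A (xs ! n) (ys ! k) (zs ! i) (b i k) (a k n)) (h n j) =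
            (\<Sum>k<length ys. Comp A (ws ! j) (xs ! n) (zs ! i)
              (Comp A (xs ! n) (ys ! k) (zs ! i) (b i k) (a k n)) (h n j))"
            using n True ab' h' by (intro Comp_sum_left) (simp_all add: nx ny nz nw Comp_in)
          also have "\<dots> = (\<Sum>k<length ys. ?c n k)"
            using n True ab' h' by (intro sum.cong refl Comp_assoc) (simp_all add: nx ny nz nw)
          finally show "Comp A (ws ! j) (xs ! n) (zs ! i)
            (\<Sum>k<length ys. Comp A (xs ! n) (ys ! k) (zs ! i) (b i k) (a k n)) (h n j) =
            (\<Sum>k<length ys. ?c n k)" .
        qed
        also have "\<dots> = (\<Sum>k<length ys. \<Sum>n<length xs. ?c n k)"
          by (rule sum.swap)
        also have "\<dots> = (\<Sum>k<length ys. Comp A (ws ! j) (ys ! k) (zs ! i) (b i k)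
            (\<Sum>n<length xs. Comp A (ws ! j) (xs ! n) (ys ! k) (a k n) (h n j)))"
          using True ab' h' by (intro sum.cong refl Comp_sum_right[symmetric])
            (simp_all add: nx ny nz nw Comp_in)
        also have "\<dots> = Comp M ws ys zs b (Comp M ws xs ys a h) i j"
          unfolding simps using True by simp
        finally show ?thesis .
      qed (auto simp: simps)
    qed
  qed
qed

end

section \<open>Interpolation at \<open>t\<close>\<close>

definition scl :: "complex \<Rightarrow> lincomb \<Rightarrow> lincomb" where
  "scl c f = (\<lambda>p. c * f p)"

lemma scl_apply [simp]: "scl c f p = c * f p"
  by (simp add: scl_def)

lemma vector_space_scl: "vector_space scl"
  by unfold_locales (auto simp: fun_eq_iff algebra_simps)

locale interpolation =
  fixes t :: complex
  assumes t_nonzero: "t \<noteq> 0"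
begin

abbreviation "R \<equiv> Rep0 NCb_sharp t"

abbreviation cmp :: "nat \<Rightarrow> nat \<Rightarrow> nat \<Rightarrow> lincomb \<Rightarrow> lincomb \<Rightarrow> lincomb" where
  "cmp \<equiv> Comp R"

lemma Ob_R [simp]: "k \<in> Ob R"
  by (simp add: Rep0_def)

lemma Hom_R: "f \<in> Hom R k l \<longleftrightarrow> (\<forall>p. f p \<noteq> 0 \<longrightarrow> p \<in> NCb_sharp k l)"
  by (auto simp: Rep0_def)

lemma basis_apply: "basis p q = (if q = p then 1 else 0)"
  by (simp add: basis_def)

lemma Id_R: "Id R k = basis (id_part k)"
  by (simp add: Rep0_def)

lemma cmp_eq: "cmp k l m g f =
    (\<Sum>p\<in>NCb_sharp k l. \<Sum>q\<in>NCb_sharp l m. scl (g q * f p * t ^ loops q p) (basis (pcomp q p)))"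
  by (auto simp: Rep0_def fun_eq_iff sum_fun_apply mult.assoc)

lemma scl_simps:
  "scl c (scl d f) = scl (c * d) f" "scl 1 f = f" "scl 0 f = 0" "scl c 0 = 0"
  "scl c (f + g) = scl c f + scl c g" "scl (c + d) f = scl c f + scl d f" "scl c (sum h I) = (\<Sum>i\<in>I. scl c (h i))"
  by (auto simp: fun_eq_iff algebra_simps sum_fun_apply sum_distrib_left)

lemma cmp_add_left: "cmp k l m (g + g') f = cmp k l m g f + cmp k l m g' f"
  and cmp_add_right: "cmp k l m g (f + f') = cmp k l m g f + cmp k l m g f'"
  and cmp_scl_left: "cmp k l m (scl c g) f = scl c (cmp k l m g f)"
  and cmp_scl_right: "cmp k l m g (scl c f) = scl c (cmp k l m g f)"
  by (simp_all add: cmp_eq scl_simps sum.distrib[symmetric] algebra_simps)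

lemma cmp_zero: "cmp k l m 0 f = 0" "cmp k l m g 0 = 0"
  by (simp_all add: cmp_eq scl_simps)

lemma cmp_sum_left: "cmp k l m (sum g I) f = (\<Sum>i\<in>I. cmp k l m (g i) f)"
  and cmp_sum_right: "cmp k l m h (sum g I) = (\<Sum>i\<in>I. cmp k l m h (g i))"
  by (induction I rule: infinite_finite_induct) (simp_all add: cmp_zero cmp_add_left cmp_add_right)

lemma Hom_expand:
  assumes "f \<in> Hom R k l"
  shows "f = (\<Sum>p\<in>NCb_sharp k l. scl (f p) (basis p))"
proof
  fix q
  have "(\<Sum>p\<in>NCb_sharp k l. scl (f p) (basis p) q) = (\<Sum>p\<in>NCb_sharp k l. if p = q then f q else 0)"
    by (intro sum.cong) (auto simp: basis_def)
  then show "f q = (\<Sum>p\<in>NCb_sharp k l. scl (f p) (basis p)) q"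
    using assms by (auto simp: sum_fun_apply Hom_R)
qed

lemma basis_in_Hom: "basis p \<in> Hom R k l \<longleftrightarrow> p \<in> NCb_sharp k l"
  by (auto simp: Hom_R basis_def)

lemma cmp_basis:
  assumes p: "p \<in> NCb_sharp k l" and q: "q \<in> NCb_sharp l m"
  shows "cmp k l m (basis q) (basis p) = scl (t ^ loops q p) (basis (pcomp q p))"
proof -
  have "cmp k l m (basis q) (basis p) = (\<Sum>p'\<in>NCb_sharp k l. if p' = p then
      (\<Sum>q'\<in>NCb_sharp l m. if q' = q then scl (t ^ loops q p) (basis (pcomp q p)) else 0) else 0)"
    unfolding cmp_eq
  proof (rule sum.cong[OF refl])
    fix p' assume "p' \<in> NCb_sharp k l"
    show "(\<Sum>q'\<in>NCb_sharp l m. scl (basis q q' * basis p p' * t ^ loops q' p') (basis (pcomp q' p'))) =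
      (if p' = p then (\<Sum>q'\<in>NCb_sharp l m. if q' = q then scl (t ^ loops q p) (basis (pcomp q p)) else 0) else 0)"
    proof (cases "p' = p")
      case True
      then have "(\<Sum>q'\<in>NCb_sharp l m. scl (basis q q' * basis p p' * t ^ loops q' p') (basis (pcomp q' p'))) =
        (\<Sum>q'\<in>NCb_sharp l m. if q' = q then scl (t ^ loops q p) (basis (pcomp q p)) else 0)"
        by (intro sum.cong) (auto simp: basis_apply scl_simps)
      then show ?thesis
        using True by simp
    qed (simp add: basis_apply scl_simps)
  qed
  then show ?thesis
    using p q by simp
qed

lemma Hom_sum_R: "(\<And>i. i \<in> I \<Longrightarrow> f i \<in> Hom R k l) \<Longrightarrow> sum f I \<in> Hom R k l"
  unfolding Hom_R sum_fun_apply by (metis (no_types, lifting) sum.neutral)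

lemma cmp_in: "cmp k l m g f \<in> Hom R k m"
  unfolding cmp_eq
  by (intro Hom_sum_R) (auto simp: Hom_R basis_def pcomp_NCb_sharp split: if_splits)

text \<open>By bilinearity only basis elements matter, and for these \<open>loops_assoc\<close>
  matches the powers of \<open>t\<close>.\<close>

lemma cmp_assoc:
  assumes f: "f \<in> Hom R k l" and g: "g \<in> Hom R l m" and h: "h \<in> Hom R m n"
  shows "cmp k l n (cmp l m n h g) f = cmp k m n h (cmp k l m g f)"
proof -
  let ?C = NCb_sharp
  have basis: "cmp k l n (cmp l m n (basis r) (basis q)) (basis p) = cmp k m n (basis r) (cmp k l m (basis q) (basis p))"
    if "p \<in> ?C k l" "q \<in> ?C l m" "r \<in> ?C m n" for p q r
    using that loops_assoc[of p k l q m r n] pcomp_assoc[of p k l q m r n]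
    by (simp add: cmp_basis cmp_scl_left cmp_scl_right pcomp_NCb_sharp scl_simps NCb_sharp_P power_add[symmetric])
  let ?s = "\<lambda>f C. \<Sum>p\<in>C. scl (f p) (basis p)"
  have "cmp k l n (cmp l m n (?s h (?C m n)) (?s g (?C l m))) (?s f (?C k l)) =
      cmp k m n (?s h (?C m n)) (cmp k l m (?s g (?C l m)) (?s f (?C k l)))"
    unfolding cmp_sum_left cmp_sum_right cmp_scl_left cmp_scl_right
    by (auto simp: scl_simps basis sum.swap[of _ "?C k l"] ac_simps intro!: sum.cong)
  then show ?thesis
    using f g h by (simp add: Hom_expand[symmetric])
qed

sublocale R: lin_cat scl R
proof -
  interpret vector_space scl
    by (rule vector_space_scl)
  show "lin_cat scl R"
  proof unfold_locales
    fix k l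
    show "subspace (Hom R k l)"
      by (intro subspaceI) (simp_all add: Rep0_def)
    show "\<exists>B. finite B \<and> Hom R k l \<subseteq> span B"
    proof (intro exI conjI subsetI)
      fix f assume "f \<in> Hom R k l"
      moreover have "(\<Sum>p\<in>NCb_sharp k l. scl (f p) (basis p)) \<in> span (basis ` NCb_sharp k l)"
        by (intro span_sum span_scale span_base imageI)
      ultimately show "f \<in> span (basis ` NCb_sharp k l)"
        by (simp add: Hom_expand[symmetric])
    qed simp
    show "Id R k \<in> Hom R k k"
      by (simp add: Id_R basis_in_Hom id_part_NCb_sharp)
    fix f assume f: "f \<in> Hom R k l"
    have "cmp k l l (Id R l) (\<Sum>p\<in>NCb_sharp k l. scl (f p) (basis p)) = (\<Sum>p\<in>NCb_sharp k l. scl (f p) (basis p))"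
      unfolding cmp_sum_right cmp_scl_right Id_R
      by (intro sum.cong refl) (simp add: cmp_basis id_part_NCb_sharp NCb_sharp_P[THEN loops_id_left]
          NCb_sharp_P[THEN pcomp_id_left] scl_simps)
    then show "cmp k l l (Id R l) f = f"
      by (simp add: Hom_expand[OF f, symmetric])
    have "cmp k k l (\<Sum>p\<in>NCb_sharp k l. scl (f p) (basis p)) (Id R k) = (\<Sum>p\<in>NCb_sharp k l. scl (f p) (basis p))"
      unfolding cmp_sum_left cmp_scl_left Id_R
      by (intro sum.cong refl) (simp add: cmp_basis id_part_NCb_sharp NCb_sharp_P[THEN loops_id_right]
          NCb_sharp_P[THEN pcomp_id_right] scl_simps)
    then show "cmp k k l f (Id R k) = f"
      by (simp add: Hom_expand[OF f, symmetric])
  qed (simp_all add: cmp_in cmp_assoc cmp_add_left cmp_add_right cmp_scl_left cmp_scl_right)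
qed

sublocale M: lin_cat "\<lambda>c X i j. scl c (X i j)" "additive_completion R"
  by (rule R.lin_cat_additive_completion)

sublocale K: lin_cat "\<lambda>c X i j. scl c (X i j)" "RepB t"
  unfolding RepB_def Rep_def karoubi_def by (rule M.lin_cat_idempotent_completion)

lemma K_eq: "RepB t = M.K"
  by (simp add: RepB_def Rep_def karoubi_def)

section \<open>Images of idempotents as one-term objects\<close>

definition emb :: "lincomb \<Rightarrow> nat \<Rightarrow> nat \<Rightarrow> lincomb" where
  "emb f = (\<lambda>i j. if i = 0 \<and> j = 0 then f else 0)"

lemma emb_eq_iff [simp]: "emb f = emb g \<longleftrightarrow> f = g"
  by (auto simp: emb_def fun_eq_iff)

lemma emb_simps: "emb 0 = 0" "emb (f + g) = emb f + emb g" "emb (f - g) = emb f - emb g"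
  by (auto simp: emb_def fun_eq_iff)

lemma emb_sum: "emb (sum f I) = (\<Sum>i\<in>I. emb (f i))"
  by (induction I rule: infinite_finite_induct)
    (simp_all only: sum.infinite sum.empty sum.insert emb_simps not_False_eq_True)

lemma image_object_eq: "image_object k e = ([k], emb e)"
  by (simp add: image_object_def emb_def)

lemma Hom_M: "Hom (additive_completion R) [k] [l] = emb ` Hom R k l"
proof (intro equalityI subsetI)
  fix a assume a: "a \<in> Hom (additive_completion R) [k] [l]"
  then have "a = emb (a 0 0)"
    unfolding R.additive_completion_simps emb_def fun_eq_iff by auto
  then show "a \<in> emb ` Hom R k l"
    using a unfolding R.additive_completion_simps by auto
qed (auto simp: R.additive_completion_simps emb_def)

lemma Comp_M: "Comp (additive_completion R) [k] [l] [m] (emb g) (emb f) = emb (cmp k l m g f)"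
  unfolding R.additive_completion_simps by (auto simp: emb_def fun_eq_iff)

lemma image_object_Ob: "image_object k e \<in> Ob (RepB t) \<longleftrightarrow> e \<in> Hom R k k \<and> cmp k k k e e = e"
  unfolding K_eq image_object_eq M.idempotent_completion_simps
  by (auto simp: Hom_M Comp_M R.additive_completion_simps(1))

lemma image_object_Hom: "Hom (RepB t) (image_object k e) (image_object l f) =
    emb ` {a \<in> Hom R k l. cmp k k l a e = a \<and> cmp k l l f a = a}"
  unfolding K_eq image_object_eq M.idempotent_completion_simps
  by (auto simp: Hom_M Comp_M)

lemma image_object_Id: "Id (RepB t) (image_object k e) = emb e"
  unfolding K_eq image_object_eq M.idempotent_completion_simps ..

lemma image_object_Comp:
  "Comp (RepB t) (image_object k e) (image_object l f) (image_object m g) (emb b) (emb a) = emb (cmp k l m b a)"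
  unfolding K_eq image_object_eq M.idempotent_completion_simps by (simp add: Comp_M)

text \<open>A nonzero coefficient of a composite exhibits a factorization of the partition; this is
  how estimates of through-blocks enter the linear category.\<close>

lemma cmp_nonzeroE:
  assumes "cmp k l m g f r \<noteq> 0"
  obtains p q where "p \<in> NCb_sharp k l" "q \<in> NCb_sharp l m" "f p \<noteq> 0" "g q \<noteq> 0" "r = pcomp q p"
proof -
  obtain p where p: "p \<in> NCb_sharp k l"
    "(\<Sum>q\<in>NCb_sharp l m. scl (g q * f p * t ^ loops q p) (basis (pcomp q p)) r) \<noteq> 0"
    using assms unfolding cmp_eq sum_fun_apply by (metis (no_types, lifting) sum.neutral)
  then obtain q where "q \<in> NCb_sharp l m" "scl (g q * f p * t ^ loops q p) (basis (pcomp q p)) r \<noteq> 0"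
    by (metis (no_types, lifting) sum.neutral)
  then show thesis
    using p that by (auto simp: basis_def split: if_splits)
qed

subsection \<open>The idempotents of the reduced partitions\<close>

text \<open>The idempotent proportional to \<open>p_part k m\<close>, whose square is
  \<open>t ^ loops\<close> times itself.\<close>

definition eps :: "nat \<Rightarrow> nat list \<Rightarrow> lincomb" where
  "eps k m = scl (inverse (t ^ loops (p_part k m) (p_part k m))) (basis (p_part k m))"

definition E :: "nat \<Rightarrow> nat list \<Rightarrow> nat list \<times> (nat \<Rightarrow> nat \<Rightarrow> lincomb)" where
  "E k m = image_object k (eps k m)"

definition tb :: "nat \<Rightarrow> nat list \<Rightarrow> nat" where
  "tb k m = through_blocks (p_part k m)"

lemma p_part_C: "(k, m) \<in> index_pairs \<Longrightarrow> p_part k m \<in> NCb_sharp k k"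
  using p_part_NCb_sharp index_pairs_subset by blast

lemma p_part_idem:
  assumes "set m \<subseteq> {1..k}"
  shows "pcomp (p_part k m) (p_part k m) = p_part k m"
proof (rule P_eqI)
  note p = p_part_P[OF assms]
  show "pcomp (p_part k m) (p_part k m) \<in> P k k" "p_part k m \<in> P k k"
    using p pcomp_P by blast+
  fix x z :: "nat \<Rightarrow> bool"
  have "sat (p_part k m) x z" if "sat (p_part k m) x y" "sat (p_part k m) y z" for y
    using that unfolding sat_p_part by simp
  moreover have "sat (p_part k m) x x"
    by (simp add: sat_p_part)
  ultimately show "sat (pcomp (p_part k m) (p_part k m)) x z \<longleftrightarrow> sat (p_part k m) x z"
    unfolding sat_pcomp[OF p p] by metis
qed

context
  fixes k m assumes ind: "(k, m) \<in> index_pairs"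
begin

abbreviation "p \<equiv> p_part k m"

lemma p_C: "p \<in> NCb_sharp k k"
  by (rule p_part_C[OF ind])

lemma eps_in: "eps k m \<in> Hom R k k"
  unfolding eps_def by (rule R.Hom_scale) (simp_all add: basis_in_Hom p_C)

lemma cmp_p_p: "cmp k k k (basis p) (basis p) = scl (t ^ loops p p) (basis p)"
  by (simp add: cmp_basis p_C p_part_idem[OF index_pairs_subset[OF ind]])

lemma eps_idem: "cmp k k k (eps k m) (eps k m) = eps k m"
  unfolding eps_def cmp_scl_left cmp_scl_right cmp_p_p scl_simps using t_nonzero by simp

text \<open>Replacing \<open>p\<close> by the proportional idempotent turns the corner into a set of
  fixed points, given by linear equations.\<close>

lemma corner_eq: "corner t k p = {x \<in> Hom R k k. cmp k k k (eps k m) x = x \<and> cmp k k k x (eps k m) = x}"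
proof (intro equalityI subsetI)
  note b = basis_in_Hom[of p k k, THEN iffD2, OF p_C]
  have bb: "cmp k k k (eps k m) (basis p) = basis p" "cmp k k k (basis p) (eps k m) = basis p"
    unfolding eps_def cmp_scl_left cmp_scl_right cmp_p_p scl_simps using t_nonzero by (simp_all add: scl_simps)
  fix x assume "x \<in> corner t k p"
  then obtain y where y: "y \<in> Hom R k k" "x = cmp k k k (basis p) (cmp k k k y (basis p))"
    by (auto simp: corner_def)
  have "cmp k k k (eps k m) x = cmp k k k (cmp k k k (eps k m) (basis p)) (cmp k k k y (basis p))"
    unfolding y(2) using eps_in b cmp_in by (intro cmp_assoc[symmetric])
  moreover have "cmp k k k x (eps k m) = cmp k k k (basis p) (cmp k k k y (cmp k k k (basis p) (eps k m)))"
    unfolding y(2) using eps_in b y(1) cmp_in by (simp add: cmp_assoc)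
  ultimately show "x \<in> {x \<in> Hom R k k. cmp k k k (eps k m) x = x \<and> cmp k k k x (eps k m) = x}"
    using y cmp_in by (simp add: bb)
next
  let ?c = "inverse (t ^ loops p p)"
  fix x assume x: "x \<in> {x \<in> Hom R k k. cmp k k k (eps k m) x = x \<and> cmp k k k x (eps k m) = x}"
  then have "x = cmp k k k (eps k m) (cmp k k k x (eps k m))"
    by simp
  also have "\<dots> = cmp k k k (basis p) (cmp k k k (scl (?c * ?c) x) (basis p))"
    by (simp add: eps_def cmp_scl_left cmp_scl_right scl_simps)
  finally show "x \<in> corner t k p"
    using x by (auto simp: corner_def intro!: R.Hom_scale)
qed

text \<open>Elements of the corner are supported on composites \<open>pcomp p (pcomp q p)\<close>,
  and among these \<open>p_part_sandwich\<close> leaves only \<open>p\<close> without loss of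
  through-blocks. This is why the quotient by \<open>lower_ideal\<close> is one-dimensional.\<close>

lemma corner_support:
  assumes x: "x \<in> corner t k p" "x r \<noteq> 0"
  shows "through_blocks r \<le> tb k m \<and> (through_blocks r = tb k m \<longrightarrow> r = p)"
proof -
  have "cmp k k k (eps k m) (cmp k k k x (eps k m)) r \<noteq> 0"
    using x by (simp add: corner_eq)
  then obtain q' p' where 1: "q' \<in> NCb_sharp k k" "p' \<in> NCb_sharp k k" "cmp k k k x (eps k m) q' \<noteq> 0"
    "eps k m p' \<noteq> 0" "r = pcomp p' q'"
    by (rule cmp_nonzeroE)
  obtain p'' q where 2: "p'' \<in> NCb_sharp k k" "q \<in> NCb_sharp k k" "eps k m p'' \<noteq> 0" "x q \<noteq> 0" "q' = pcomp q p''"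
    by (rule cmp_nonzeroE[OF 1(3)])
  have p: "p' = p" "p'' = p"
    using 1(4) 2(3) by (auto simp: eps_def basis_def split: if_splits)
  have r: "r = pcomp p (pcomp q p)"
    using 1(5) 2(5) p by simp
  have "through_blocks r \<le> tb k m"
    unfolding r tb_def using pcomp_NCb_sharp[OF p_C 2(2)] p_C
    by (intro through_blocks_pcomp_le_left[of _ k k _ k]) (auto intro: NCb_sharp_P)
  then show ?thesis
    using p_part_sandwich[OF 2(2) ind ind p_C p_C r] by (auto simp: tb_def)
qed

lemma lower_ideal_iff:
  assumes "x \<in> corner t k p"
  shows "x \<in> lower_ideal t k p \<longleftrightarrow> x p = 0"
  using assms corner_support[OF assms] unfolding lower_ideal_def tb_def
  by (auto simp: le_less)

lemma eps_corner: "eps k m \<in> corner t k p"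
  by (simp add: corner_eq eps_in eps_idem)

lemma eps_p: "eps k m p = inverse (t ^ loops p p)"
  by (simp add: eps_def basis_def)

lemma corner_diff: "x \<in> corner t k p \<Longrightarrow> y \<in> corner t k p \<Longrightarrow> x - y \<in> corner t k p"
  by (simp add: corner_eq R.Hom_diff R.Comp_diff_left R.Comp_diff_right eps_in)

text \<open>If \<open>p\<close> is a composite of partitions from the two supports, both have at
  least as many through-blocks as \<open>p\<close>, hence equal \<open>p\<close>. So the coefficient
  at \<open>p\<close> is multiplicative up to the scalar.\<close>

lemma corner_mult_p:
  assumes "x \<in> corner t k p" "y \<in> corner t k p"
  shows "cmp k k k x y p = x p * y p * t ^ loops p p"
proof -
  have *: "scl (x q * y q' * t ^ loops q q') (basis (pcomp q q')) p =
      (if q' = p then if q = p then x p * y p * t ^ loops p p else 0 else 0)"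
    if q: "q \<in> NCb_sharp k k" "q' \<in> NCb_sharp k k" for q q'
  proof (cases "x q \<noteq> 0 \<and> y q' \<noteq> 0 \<and> pcomp q q' = p")
    case True
    have "tb k m \<le> through_blocks q" "tb k m \<le> through_blocks q'"
      using True through_blocks_pcomp_le_left[OF NCb_sharp_P[OF q(2)] NCb_sharp_P[OF q(1)]]
        through_blocks_pcomp_le_right[OF NCb_sharp_P[OF q(2)] NCb_sharp_P[OF q(1)]] by (auto simp: tb_def)
    then have "q = p" "q' = p"
      using True corner_support[OF assms(1), of q] corner_support[OF assms(2), of q'] by auto
    then show ?thesis
      using True by (simp add: basis_def)
  next
    case False
    then show ?thesis
      using p_part_idem[OF index_pairs_subset[OF ind]] by (auto simp: basis_def)
  qed
  have "cmp k k k x y p = (\<Sum>q'\<in>NCb_sharp k k. \<Sum>q\<in>NCb_sharp k k.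
      if q' = p then if q = p then x p * y p * t ^ loops p p else 0 else 0)"
    unfolding cmp_eq sum_fun_apply by (intro sum.cong refl *)
  also have "\<dots> = (\<Sum>q'\<in>NCb_sharp k k. if q' = p then x p * y p * t ^ loops p p else 0)"
    by (rule sum.cong[OF refl]) (simp add: p_C)
  also have "\<dots> = x p * y p * t ^ loops p p"
    using p_C by simp
  finally show ?thesis .
qed

text \<open>The coefficient c of an idempotent at \<open>p\<close> satisfies c = c * c *
  \<open>t ^ loops p p\<close>, so if nonzero it agrees with that of \<open>eps k m\<close>.\<close>

lemma idempotent_p:
  assumes "e \<in> corner t k p" "cmp k k k e e = e" "e p \<noteq> 0"
  shows "e - eps k m \<in> lower_ideal t k p"
proof -
  have "e p = e p * e p * t ^ loops p p"
    using corner_mult_p[OF assms(1,1)] assms(2) by simp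
  then have "e p * t ^ loops p p = 1"
    using assms(3) by simp
  then have "e p = inverse (t ^ loops p p)"
    by (simp add: field_simps inverse_eq_divide t_nonzero)
  then show ?thesis
    using lower_ideal_iff[OF corner_diff[OF assms(1) eps_corner]] eps_p by simp
qed

lemma lifted_iff:
  "lifted_idempotent t k p e \<longleftrightarrow> primitive_idempotent t k (corner t k p) e \<and> e p \<noteq> 0"
proof -
  have eps: "(\<lambda>q. inverse (t ^ loops p p) * basis p q) = eps k m"
    by (simp add: eps_def scl_def)
  have "e p \<noteq> 0" if "e \<in> corner t k p" "e - eps k m \<in> lower_ideal t k p"
    using lower_ideal_iff[OF corner_diff[OF that(1) eps_corner]] that(2) eps_p t_nonzero by simp
  then show ?thesis
    unfolding lifted_idempotent_def eps using idempotent_p by (auto simp: primitive_idempotent_def)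
qed

text \<open>Among the idempotents of the corner with nonzero coefficient at \<open>p\<close>, take
  one whose own corner has least dimension. In an orthogonal decomposition into nonzero parts each
  part has a smaller corner, so both coefficients at \<open>p\<close> vanish, and with them their
  sum.\<close>

lemma lifted_exists: "\<exists>e. lifted_idempotent t k p e"
proof -
  let ?S = "{e \<in> corner t k p. cmp k k k e e = e \<and> e p \<noteq> 0}"
  let ?V = "\<lambda>e. {x \<in> Hom R k k. cmp k k k e x = x \<and> cmp k k k x e = x}"
  have "eps k m \<in> ?S"
    by (simp add: eps_corner eps_idem eps_p t_nonzero)
  then obtain e where e: "e \<in> ?S" and least: "\<And>e'. e' \<in> ?S \<Longrightarrow> R.dim (?V e) \<le> R.dim (?V e')"
    using ex_has_least_nat[of "\<lambda>e. e \<in> ?S" "eps k m" "\<lambda>e. R.dim (?V e)"] by blast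
  have hom: "x \<in> Hom R k k" if "x \<in> corner t k p" for x
    using that by (simp add: corner_eq)
  have main: "e1 p = 0"
    if c: "e1 \<in> corner t k p" "e2 \<in> corner t k p" and i: "cmp k k k e1 e1 = e1" "cmp k k k e2 e2 = e2"
      and o: "cmp k k k e1 e2 = 0" "cmp k k k e2 e1 = 0" and s: "e = e1 + e2" and n: "e2 \<noteq> 0" for e1 e2
  proof (rule ccontr)
    assume "e1 p \<noteq> 0"
    then have e1: "e1 \<in> ?S"
      using c i by simp
    note h = hom[OF c(1)] hom[OF c(2)]
    have ee1: "cmp k k k e e1 = e1" "cmp k k k e1 e = e1" "cmp k k k e e2 = e2" "cmp k k k e2 e = e2"
      unfolding s cmp_add_left cmp_add_right i o by simp_all
    have he: "e \<in> Hom R k k"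
      using e hom by blast
    have "?V e1 \<subseteq> ?V e"
    proof (clarsimp, intro conjI)
      fix x assume x: "x \<in> Hom R k k" "cmp k k k e1 x = x" "cmp k k k x e1 = x"
      show "cmp k k k e x = x"
        using cmp_assoc[OF x(1) h(1) he] ee1 x by simp
      show "cmp k k k x e = x"
        using cmp_assoc[OF he h(1) x(1)] ee1 x by simp
    qed
    moreover have "e2 \<in> ?V e" "e2 \<notin> ?V e1"
      using h ee1 o n by auto
    ultimately have psub: "?V e1 \<subset> ?V e"
      by blast
    have "R.subspace (?V e1)"
      by (intro R.subspaceI) (simp_all add: cmp_zero cmp_add_left cmp_add_right cmp_scl_left cmp_scl_right
          R.Hom_add R.Hom_scale)
    moreover obtain B where "finite B" "?V e \<subseteq> R.span B"
      using R.finite_span[of k k] by auto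
    ultimately have "R.dim (?V e1) < R.dim (?V e)"
      using R.dim_psubset psub by blast
    then show False
      using least[OF e1] by simp
  qed
  have "e1 = 0 \<or> e2 = 0" if c: "e1 \<in> corner t k p" "e2 \<in> corner t k p"
    and "cmp k k k e1 e1 = e1" "cmp k k k e2 e2 = e2" "cmp k k k e1 e2 = 0" "cmp k k k e2 e1 = 0"
      "e = e1 + e2" for e1 e2
  proof (rule ccontr)
    assume "\<not> ?thesis"
    then have "e1 p = 0" "e2 p = 0"
      using main[of e1 e2] main[of e2 e1] that by (auto simp: add.commute)
    then show False
      using e that by simp
  qed
  then have "primitive_idempotent t k (corner t k p) e"
    unfolding primitive_idempotent_def using e by auto
  then show ?thesis
    using lifted_iff e by blast
qed

lemma E_Ob: "E k m \<in> Ob (RepB t)"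
  by (simp add: E_def image_object_Ob eps_in eps_idem)

context
  fixes e assumes e: "lifted_idempotent t k p e"
begin

lemma lifted_corner: "e \<in> corner t k p" "e \<in> Hom R k k" "cmp k k k e e = e" "e p \<noteq> 0"
  "cmp k k k (eps k m) e = e" "cmp k k k e (eps k m) = e"
  using e unfolding lifted_iff primitive_idempotent_def by (auto simp: corner_eq)

lemma lifted_Ob: "image_object k e \<in> Ob (RepB t)"
  by (simp add: image_object_Ob lifted_corner)

text \<open>An idempotent endomorphism \<open>a\<close> of the image lies in the corner and
  decomposes \<open>e\<close> orthogonally into \<open>a\<close> and \<open>e - a\<close>, so
  primitivity applies.\<close>

lemma lifted_connected: "K.connected (image_object k e)"
  unfolding K.connected_def
proof (intro conjI ballI impI)
  show "Id (RepB t) (image_object k e) \<noteq> 0"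
    using lifted_corner(4) by (auto simp: image_object_Id emb_simps(1)[symmetric])
  fix b assume "b \<in> Hom (RepB t) (image_object k e) (image_object k e)"
    "Comp (RepB t) (image_object k e) (image_object k e) (image_object k e) b b = b"
  then obtain a where a: "b = emb a" "a \<in> Hom R k k" "cmp k k k a e = a" "cmp k k k e a = a" "cmp k k k a a = a"
    by (auto simp: image_object_Hom image_object_Comp)
  have c: "a \<in> corner t k p"
    using cmp_assoc[OF a(2) lifted_corner(2) eps_in] cmp_assoc[OF eps_in lifted_corner(2) a(2)] a lifted_corner
    by (simp add: corner_eq)
  have "e - a \<in> corner t k p"
    by (rule corner_diff[OF lifted_corner(1) c])
  moreover have "cmp k k k (e - a) (e - a) = e - a" "cmp k k k a (e - a) = 0" "cmp k k k (e - a) a = 0"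
    using a lifted_corner by (simp_all add: R.Comp_diff_left R.Comp_diff_right R.Hom_diff)
  moreover have "primitive_idempotent t k (corner t k p) e"
    using e by (simp add: lifted_iff)
  ultimately have "a = 0 \<or> e - a = 0"
    using c a(5) unfolding primitive_idempotent_def by (metis add_diff_cancel_left' diff_add_cancel add.commute)
  then show "b = 0 \<or> b = Id (RepB t) (image_object k e)"
    by (auto simp: a(1) image_object_Id emb_simps)
qed (rule lifted_Ob)

lemma lifted_retract: "K.retract (image_object k e) (E k m)"
  unfolding K.retract_def E_def image_object_Hom image_object_Id
  using lifted_corner eps_in
  by (intro bexI[of _ "emb e"]) (auto simp: image_object_Comp)

text \<open>If \<open>e\<close> factors through \<open>E n s\<close>, its nonzero coefficient at
  \<open>p\<close> yields a partition \<open>q\<close> through which \<open>p\<close> factors and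
  which is itself sandwiched between \<open>p_part n s\<close> and \<open>p\<close>. Its number of
  through-blocks lies between \<open>tb k m\<close> and \<open>tb n s\<close>; if these agree,
  \<open>p_part_sandwich\<close> identifies the pairs.\<close>

lemma retract_lifted:
  assumes r: "K.retract (image_object k e) (E n s)" and s: "(n, s) \<in> index_pairs"
  shows "tb k m < tb n s \<or> (n = k \<and> s = m)"
proof -
  let ?p = "p_part n s"
  note sC = p_part_C[OF s]
  obtain a b where a: "a \<in> Hom R k n" "cmp k k n a e = a" "cmp k n n (eps n s) a = a"
    and b: "b \<in> Hom R n k" and ba: "cmp k n k b a = e"
    using r unfolding K.retract_def E_def image_object_Hom image_object_Id
    by (auto simp: image_object_Comp)
  have "cmp k k n a (eps k m) = a"
    using cmp_assoc[OF eps_in lifted_corner(2) a(1)] a lifted_corner by simp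
  then have a': "cmp k n n (eps n s) (cmp k k n a (eps k m)) = a"
    using a by simp
  have "cmp k n k b a p \<noteq> 0"
    using lifted_corner(4) ba by simp
  then obtain q q' where q: "q \<in> NCb_sharp k n" "q' \<in> NCb_sharp n k" "a q \<noteq> 0" "p = pcomp q' q"
    by (rule cmp_nonzeroE)
  have "cmp k n n (eps n s) (cmp k k n a (eps k m)) q \<noteq> 0"
    using q a' by simp
  then obtain u u' where 1: "u \<in> NCb_sharp k n" "u' \<in> NCb_sharp n n" "cmp k k n a (eps k m) u \<noteq> 0"
    "eps n s u' \<noteq> 0" "q = pcomp u' u"
    by (rule cmp_nonzeroE)
  obtain v v' where 2: "v \<in> NCb_sharp k k" "v' \<in> NCb_sharp k n" "eps k m v \<noteq> 0" "a v' \<noteq> 0" "u = pcomp v' v"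
    by (rule cmp_nonzeroE[OF 1(3)])
  have "u' = ?p" "v = p"
    using 1(4) 2(3) by (auto simp: eps_def basis_def split: if_splits)
  then have qq: "q = pcomp ?p (pcomp v' p)"
    using 1(5) 2(5) by simp
  have "tb k m \<le> through_blocks q"
    unfolding tb_def q(4)
    by (rule through_blocks_pcomp_le_right[OF NCb_sharp_P[OF q(1)] NCb_sharp_P[OF q(2)]])
  moreover have "through_blocks q \<le> tb n s"
    unfolding qq tb_def
    by (rule through_blocks_pcomp_le_left[OF NCb_sharp_P[OF pcomp_NCb_sharp[OF p_C 2(2)]] NCb_sharp_P[OF sC]])
  ultimately show ?thesis
    using p_part_sandwich[OF 2(2) s ind sC p_C qq] unfolding tb_def by linarith
qed

end

end

text \<open>The difference between \<open>eps k m\<close> and a lifted idempotent is a combination of partitions with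
  fewer through-blocks, each of which factors through a smaller reduced partition.\<close>

lemma retract_E_cases:
  assumes ind: "(k, m) \<in> index_pairs" and e: "lifted_idempotent t k (p_part k m) e"
    and X: "K.connected X" and r: "K.retract X (E k m)"
  shows "K.retract X (image_object k e) \<or>
    (\<exists>n s. (n, s) \<in> index_pairs \<and> tb n s < tb k m \<and> K.retract X (E n s))"
proof -
  note lc = lifted_corner[OF ind e]
  note ein = eps_in[OF ind] and eidem = eps_idem[OF ind]
  let ?d = "eps k m - e"
  have dc: "?d \<in> corner t k (p_part k m)"
    by (rule corner_diff[OF ind eps_corner[OF ind] lc(1)])
  have "e - eps k m \<in> lower_ideal t k (p_part k m)"
    by (rule idempotent_p[OF ind lc(1,3,4)])
  then have low: "through_blocks q < tb k m" if "?d q \<noteq> 0" for q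
    using that by (auto simp: lower_ideal_def tb_def)
  have dH: "?d \<in> Hom R k k"
    by (intro R.Hom_diff ein lc(2)) simp_all
  define S where "S = {q \<in> NCb_sharp k k. ?d q \<noteq> 0}"
  have "\<exists>n s g h. (n, s) \<in> index_pairs \<and> tb n s < tb k m \<and> g \<in> Hom R n k \<and> h \<in> Hom R k n \<and>
      scl (?d q) (basis q) = cmp k n k g (cmp k n n (eps n s) h)" if q: "q \<in> S" for q
  proof -
    obtain n s a b where *: "(n, s) \<in> index_pairs" "a \<in> NCb_sharp n k" "b \<in> NCb_sharp k n"
      "q = pcomp a (pcomp (p_part n s) b)" "through_blocks (p_part n s) \<le> through_blocks q"
      using factorization[of q k k] q by (auto simp: S_def)
    note pC = p_part_C[OF *(1)]
    let ?c = "inverse (t ^ loops (p_part n s) (p_part n s)) * t ^ loops (p_part n s) b *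
      t ^ loops a (pcomp (p_part n s) b)"
    have "cmp k n k (basis a) (cmp k n n (eps n s) (basis b)) = scl ?c (basis q)"
      using * pC by (simp add: eps_def cmp_scl_left cmp_scl_right cmp_basis scl_simps pcomp_NCb_sharp mult.assoc)
    \<comment> \<open>The powers of \<open>t\<close> produced by the loops are divided out.\<close>
    then have "cmp k n k (scl (?d q / ?c) (basis a)) (cmp k n n (eps n s) (basis b)) = scl (?d q) (basis q)"
      using t_nonzero by (simp add: cmp_scl_left scl_simps)
    moreover have "tb n s < tb k m"
      using *(5) low[of q] q by (simp add: S_def tb_def)
    moreover have "scl (?d q / ?c) (basis a) \<in> Hom R n k" "basis b \<in> Hom R k n"
      using * by (auto intro!: R.Hom_scale simp: basis_in_Hom)
    ultimately show ?thesis
      using *(1) by metis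
  qed
  then obtain n s g h where f: "\<And>q. q \<in> S \<Longrightarrow> (n q, s q) \<in> index_pairs \<and> tb (n q) (s q) < tb k m \<and>
      g q \<in> Hom R (n q) k \<and> h q \<in> Hom R k (n q) \<and>
      scl (?d q) (basis q) = cmp k (n q) k (g q) (cmp k (n q) (n q) (eps (n q) (s q)) (h q))"
    by metis
  \<comment> \<open>\<open>None\<close> indexes the image of \<open>e\<close>, and
    \<open>Some q\<close> the smaller object through which the term at \<open>q\<close>
    factors.\<close>
  define y where "y i = (case i of None \<Rightarrow> image_object k e | Some q \<Rightarrow> E (n q) (s q))" for i
  \<comment> \<open>The factors \<open>eps k m\<close> make the maps start or end at
    \<open>E k m\<close>; they do not change the sum, because the remainder lies in the
    corner.\<close>
  define j where "j i = (case i of None \<Rightarrow> emb e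
    | Some q \<Rightarrow> emb (cmp k k (n q) (cmp k (n q) (n q) (eps (n q) (s q)) (h q)) (eps k m)))" for i
  define u where "u i = (case i of None \<Rightarrow> emb e
    | Some q \<Rightarrow> emb (cmp (n q) k k (eps k m) (cmp (n q) (n q) k (g q) (eps (n q) (s q)))))" for i
  have "\<exists>i\<in>insert None (Some ` S). K.retract X (y i)"
  proof (rule K.retract_through[OF X E_Ob[OF ind] r])
    show "finite (insert None (Some ` S))"
      by (simp add: S_def)
    fix i assume i: "i \<in> insert None (Some ` S)"
    show "y i \<in> Ob (RepB t)"
      using i f E_Ob lifted_Ob[OF ind e] by (auto simp: y_def)
    show "j i \<in> Hom (RepB t) (E k m) (y i)"
    proof (cases i)
      case None
      then show ?thesis
        using lc by (simp add: j_def y_def E_def image_object_Hom)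
    next
      case (Some q)
      then have fq: "(n q, s q) \<in> index_pairs" "h q \<in> Hom R k (n q)"
        using i f by auto
      note e' = eps_in[OF fq(1)] eps_idem[OF fq(1)]
      let ?x = "cmp k (n q) (n q) (eps (n q) (s q)) (h q)"
      have x: "?x \<in> Hom R k (n q)" "cmp k (n q) (n q) (eps (n q) (s q)) ?x = ?x"
        using cmp_in cmp_assoc[OF fq(2) e'(1) e'(1)] e'(2) by simp_all
      have "cmp k k (n q) (cmp k k (n q) ?x (eps k m)) (eps k m) = cmp k k (n q) ?x (eps k m)"
        using cmp_assoc[OF ein ein x(1)] eidem by simp
      moreover have "cmp k (n q) (n q) (eps (n q) (s q)) (cmp k k (n q) ?x (eps k m)) = cmp k k (n q) ?x (eps k m)"
        using cmp_assoc[OF ein x(1) e'(1)] x(2) by simp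
      ultimately show ?thesis
        using cmp_in Some by (simp add: j_def y_def E_def image_object_Hom)
    qed
    show "u i \<in> Hom (RepB t) (y i) (E k m)"
    proof (cases i)
      case None
      then show ?thesis
        using lc by (simp add: u_def y_def E_def image_object_Hom)
    next
      case (Some q)
      then have fq: "(n q, s q) \<in> index_pairs" "g q \<in> Hom R (n q) k"
        using i f by auto
      note e' = eps_in[OF fq(1)] eps_idem[OF fq(1)]
      let ?x = "cmp (n q) (n q) k (g q) (eps (n q) (s q))"
      have x: "?x \<in> Hom R (n q) k" "cmp (n q) (n q) k ?x (eps (n q) (s q)) = ?x"
        using cmp_in cmp_assoc[OF e'(1) e'(1) fq(2)] e'(2) by simp_all
      have "cmp (n q) k k (eps k m) (cmp (n q) k k (eps k m) ?x) = cmp (n q) k k (eps k m) ?x"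
        using cmp_assoc[OF x(1) ein ein] eidem by simp
      moreover have "cmp (n q) (n q) k (cmp (n q) k k (eps k m) ?x) (eps (n q) (s q)) = cmp (n q) k k (eps k m) ?x"
        using cmp_assoc[OF e'(1) x(1) ein] x(2) by simp
      ultimately show ?thesis
        using cmp_in Some by (simp add: u_def y_def E_def image_object_Hom)
    qed
  next
    let ?C = "\<lambda>i. Comp (RepB t) (E k m) (y i) (E k m) (u i) (j i)"
    have None: "?C None = emb e"
      using lc by (simp add: u_def j_def y_def E_def image_object_Comp)
    have Some: "?C (Some q) = emb (cmp k k k (eps k m) (cmp k k k (scl (?d q) (basis q)) (eps k m)))" if q: "q \<in> S" for q
    proof -
      have fq: "(n q, s q) \<in> index_pairs" "g q \<in> Hom R (n q) k" "h q \<in> Hom R k (n q)"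
        "scl (?d q) (basis q) = cmp k (n q) k (g q) (cmp k (n q) (n q) (eps (n q) (s q)) (h q))"
        using f[OF q] by auto
      note e' = eps_in[OF fq(1)] eps_idem[OF fq(1)]
      let ?e = "eps (n q) (s q)"
      let ?x = "cmp k (n q) (n q) ?e (h q)" and ?y = "cmp (n q) (n q) k (g q) ?e"
      have xx: "cmp k (n q) k ?y ?x = cmp k (n q) k (g q) ?x"
        using cmp_assoc[OF cmp_in e'(1) fq(2), of k _ "?e" "h q"] cmp_assoc[OF fq(3) e'(1) e'(1)] e'(2) by simp
      have "cmp k (n q) k (cmp (n q) k k (eps k m) ?y) (cmp k k (n q) ?x (eps k m)) =
          cmp k k k (eps k m) (cmp k (n q) k ?y (cmp k k (n q) ?x (eps k m)))"
        by (intro cmp_assoc ein cmp_in)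
      also have "cmp k (n q) k ?y (cmp k k (n q) ?x (eps k m)) = cmp k k k (cmp k (n q) k ?y ?x) (eps k m)"
        by (intro cmp_assoc[symmetric] ein cmp_in)
      finally show ?thesis
        unfolding fq(4) xx by (simp add: u_def j_def y_def E_def image_object_Comp xx)
    qed
    have "(\<Sum>i\<in>insert None (Some ` S). ?C i) = ?C None + (\<Sum>i\<in>Some ` S. ?C i)"
      by (rule sum.insert) (auto simp: S_def)
    also have "(\<Sum>i\<in>Some ` S. ?C i) = (\<Sum>q\<in>S. ?C (Some q))"
      by (simp add: sum.reindex)
    also have "\<dots> = (\<Sum>q\<in>S. emb (cmp k k k (eps k m) (cmp k k k (scl (?d q) (basis q)) (eps k m))))"
      by (rule sum.cong[OF refl Some])
    also have "\<dots> = emb (cmp k k k (eps k m) (cmp k k k (\<Sum>q\<in>S. scl (?d q) (basis q)) (eps k m)))"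
      by (simp only: emb_sum cmp_sum_left cmp_sum_right)
    also have "(\<Sum>q\<in>S. scl (?d q) (basis q)) = (\<Sum>q\<in>NCb_sharp k k. scl (?d q) (basis q))"
      by (intro sum.mono_neutral_left) (auto simp: S_def scl_simps)
    also have "\<dots> = ?d"
      by (rule Hom_expand[OF dH, symmetric])
    also have "cmp k k k (eps k m) (cmp k k k ?d (eps k m)) = ?d"
      using dc by (simp add: corner_eq[OF ind])
    finally have "(\<Sum>i\<in>insert None (Some ` S). ?C i) = emb (e + ?d)"
      unfolding None emb_simps(2) .
    moreover have "e + ?d = eps k m"
      by (simp only: add_diff_eq add_diff_cancel_left')
    ultimately show "(\<Sum>i\<in>insert None (Some ` S). ?C i) = Id (RepB t) (E k m)"
      by (simp only: E_def image_object_Id)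
  qed
  then show ?thesis
    using f by (auto simp: y_def)
qed

section \<open>Classification of the indecomposable objects\<close>

lemma index_pairs_Nil: "(k, []) \<in> index_pairs"
  by (simp add: index_pairs_def)

lemma eps_Nil: "eps k [] = Id R k"
  by (simp add: eps_def p_part_Nil Id_R loops_id_right[OF id_part_P] scl_simps)

text \<open>For an object \<open>(xs, f)\<close>, the n-th row and column of \<open>f\<close> are
  maps to and from the n-th entry of \<open>xs\<close>. Idempotency of \<open>f\<close> says that
  their composites sum to the identity, so locality selects one entry.\<close>

lemma retract_E_Nil:
  assumes X: "K.connected X"
  shows "\<exists>k. K.retract X (E k [])"
proof -
  note simps = M.idempotent_completion_simps R.additive_completion_simps
  obtain xs f where Xf: "X = (xs, f)"
    by (cases X)
  have "X \<in> Ob (RepB t)"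
    using X by (simp add: K.connected_def)
  then have f: "f \<in> Hom (additive_completion R) xs xs" "Comp (additive_completion R) xs xs xs f f = f"
    unfolding K_eq Xf M.idempotent_completion_simps by auto
  have fin: "f i j \<in> Hom R (xs ! j) (xs ! i)" if "i < length xs" "j < length xs" for i j
    using f(1) that unfolding R.additive_completion_simps by simp
  have f0: "f i j = 0" if "\<not> (i < length xs \<and> j < length xs)" for i j
    using f(1) that unfolding R.additive_completion_simps by blast
  have ff: "(\<Sum>n<length xs. cmp (xs ! j) (xs ! n) (xs ! i) (f i n) (f n j)) = f i j"
    if "i < length xs" "j < length xs" for i j
    using fun_cong[OF fun_cong[OF f(2)], of i j] that unfolding R.additive_completion_simps by simp
  define row where "row n = (\<lambda>i j :: nat. if i = (0::nat) then f n j else 0)" for n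
  define col where "col n = (\<lambda>i j :: nat. if j = (0::nat) then f i n else 0)" for n
  have "\<exists>n\<in>{..<length xs}. K.retract X (E (xs ! n) [])"
  proof (rule K.retract_sum[OF X])
    fix n assume "n \<in> {..<length xs}"
    then have n: "n < length xs"
      by simp
    show "E (xs ! n) [] \<in> Ob (RepB t)"
      by (rule E_Ob[OF index_pairs_Nil])
    show "row n \<in> Hom (RepB t) X (E (xs ! n) [])"
      unfolding K_eq Xf E_def image_object_eq simps eps_Nil
      using n fin f0 ff[OF n]
      by (auto simp: row_def emb_def fun_eq_iff R.Id_left)
    show "col n \<in> Hom (RepB t) (E (xs ! n) []) X"
      unfolding K_eq Xf E_def image_object_eq simps eps_Nil
      using n fin f0 ff[OF _ n]
      by (auto simp: col_def emb_def fun_eq_iff R.Id_right)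
  next
    show "(\<Sum>n\<in>{..<length xs}. Comp (RepB t) X (E (xs ! n) []) X (col n) (row n)) = Id (RepB t) X"
    proof (rule ext, rule ext)
      fix i j
      have "Comp (RepB t) X (E (xs ! n) []) X (col n) (row n) i j =
        (if i < length xs \<and> j < length xs then cmp (xs ! j) (xs ! n) (xs ! i) (f i n) (f n j) else 0)" for n
        unfolding K_eq Xf E_def image_object_eq simps by (simp add: col_def row_def)
      then show "(\<Sum>n\<in>{..<length xs}. Comp (RepB t) X (E (xs ! n) []) X (col n) (row n)) i j = Id (RepB t) X i j"
        unfolding sum_fun_apply[of _ _ i] sum_fun_apply[of _ _ j] K_eq Xf M.idempotent_completion_simps
        using ff[of i j] f0[of i j] by (cases "i < length xs \<and> j < length xs") auto
    qed
  qed simp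
  then show ?thesis
    by blast
qed

lemma connected_classification:
  assumes X: "K.connected X"
  shows "\<exists>k m e. (k, m) \<in> index_pairs \<and> lifted_idempotent t k (p_part k m) e \<and>
    isomorphic (RepB t) X (image_object k e)"
proof -
  have *: ?thesis if "(k, m) \<in> index_pairs" "K.retract X (E k m)" for k m
    using that
  proof (induction "tb k m" arbitrary: k m rule: less_induct)
    case less
    obtain e where e: "lifted_idempotent t k (p_part k m) e"
      using lifted_exists[OF less.prems(1)] by blast
    from retract_E_cases[OF less.prems(1) e X less.prems(2)] show ?case
    proof
      assume "K.retract X (image_object k e)"
      then have "isomorphic (RepB t) X (image_object k e)"
        using X by (intro K.retract_isomorphic lifted_connected[OF less.prems(1) e]) (auto simp: K.connected_def)
      then show ?thesis
        using less.prems(1) e by blast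
    qed (use less.hyps in blast)
  qed
  obtain k where "K.retract X (E k [])"
    using retract_E_Nil[OF X] by blast
  then show ?thesis
    by (rule *[OF index_pairs_Nil])
qed

text \<open>The image of \<open>e\<close> is a retract of \<open>E k m\<close>, hence of the image
  of \<open>e'\<close> or of a smaller \<open>E n s\<close>; the latter contradicts
  \<open>retract_lifted\<close>.\<close>

lemma lifted_unique:
  assumes ind: "(k, m) \<in> index_pairs" and e: "lifted_idempotent t k (p_part k m) e"
    and e': "lifted_idempotent t k (p_part k m) e'"
  shows "isomorphic (RepB t) (image_object k e) (image_object k e')"
proof -
  note c = lifted_connected[OF ind e]
  have "K.retract (image_object k e) (image_object k e')"
    using retract_E_cases[OF ind e' c lifted_retract[OF ind e]] retract_lifted[OF ind e]
    by (metis less_asym less_irrefl)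
  then show ?thesis
    using c by (intro K.retract_isomorphic lifted_connected[OF ind e']) (auto simp: K.connected_def)
qed

text \<open>Each image is a retract of the other's \<open>E\<close>, so unless the pairs agree both
  numbers of through-blocks would be strictly smaller than the other.\<close>

lemma lifted_isomorphic_imp_eq:
  assumes ind: "(k, m) \<in> index_pairs" "(n, s) \<in> index_pairs"
    and e: "lifted_idempotent t k (p_part k m) e" "lifted_idempotent t n (p_part n s) f"
    and iso: "isomorphic (RepB t) (image_object k e) (image_object n f)"
  shows "k = n \<and> m = s"
proof -
  note ob = lifted_Ob[OF ind(1) e(1)] lifted_Ob[OF ind(2) e(2)] E_Ob[OF ind(1)] E_Ob[OF ind(2)]
  have "K.retract (image_object k e) (E n s)"
    by (rule K.retract_trans[OF ob(1,2,4) K.isomorphic_retract[OF iso] lifted_retract[OF ind(2) e(2)]])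
  moreover have "K.retract (image_object n f) (E k m)"
    by (rule K.retract_trans[OF ob(2,1,3) K.isomorphic_retract[OF K.isomorphic_sym[OF iso]]
          lifted_retract[OF ind(1) e(1)]])
  ultimately show ?thesis
    using retract_lifted[OF ind(1) e(1) _ ind(2)] retract_lifted[OF ind(2) e(2) _ ind(1)] by fastforce
qed

text \<open>By uniqueness up to isomorphism the union in \<open>phi\<close> runs over a single
  class.\<close>

lemma phi_eq:
  assumes ind: "(k, m) \<in> index_pairs" and e: "lifted_idempotent t k (p_part k m) e"
  shows "phi t (k, m) = iso_rel (RepB t) `` {image_object k e}"
proof -
  let ?c = "\<lambda>e'. iso_rel (RepB t) `` {image_object k e'}"
  have *: "?c e' = ?c e" if e': "lifted_idempotent t k (p_part k m) e'" for e'
    using lifted_unique[OF ind e' e] lifted_Ob[OF ind e] lifted_Ob[OF ind e']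
    by (intro equiv_class_eq[OF K.equiv_iso_rel]) (simp add: iso_rel_def)
  have "{?c e' |e'. lifted_idempotent t k (p_part k m) e'} = {?c e}"
  proof (intro equalityI subsetI)
    fix c assume "c \<in> {?c e' |e'. lifted_idempotent t k (p_part k m) e'}"
    then obtain e' where "c = ?c e'" "lifted_idempotent t k (p_part k m) e'"
      by (elim CollectE exE conjE)
    then show "c \<in> {?c e}"
      by (simp only: * singleton_iff)
  next
    fix c assume "c \<in> {?c e}"
    then have "c = ?c e"
      by (rule singletonD)
    then show "c \<in> {?c e' |e'. lifted_idempotent t k (p_part k m) e'}"
      using e by (intro CollectI exI conjI)
  qed
  then show ?thesis
    unfolding phi_def by simp
qed

lemma bij_betw_phi: "bij_betw (phi t) index_pairs (indecomposable_classes (RepB t))"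
  unfolding bij_betw_def
proof
  show "inj_on (phi t) index_pairs"
  proof (rule inj_onI, clarify)
    fix k m n s assume ind: "(k, m) \<in> index_pairs" "(n, s) \<in> index_pairs" and eq: "phi t (k, m) = phi t (n, s)"
    obtain e f where e: "lifted_idempotent t k (p_part k m) e" "lifted_idempotent t n (p_part n s) f"
      using lifted_exists ind by blast
    have "(image_object k e, image_object n f) \<in> iso_rel (RepB t)"
      using eq lifted_Ob[OF ind(2) e(2)] unfolding phi_eq[OF ind(1) e(1)] phi_eq[OF ind(2) e(2)]
      by (intro eq_equiv_class[OF _ K.equiv_iso_rel])
    then show "k = n \<and> m = s"
      using lifted_isomorphic_imp_eq[OF ind e] by (simp add: iso_rel_def)
  qed
  show "phi t ` index_pairs = indecomposable_classes (RepB t)"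
  proof (intro equalityI subsetI)
    fix c assume "c \<in> phi t ` index_pairs"
    then obtain k m where ind: "(k, m) \<in> index_pairs" "c = phi t (k, m)"
      by auto
    obtain e where e: "lifted_idempotent t k (p_part k m) e"
      using lifted_exists ind by blast
    show "c \<in> indecomposable_classes (RepB t)"
      using K.connected_indecomposable[OF lifted_connected[OF ind(1) e]] lifted_Ob[OF ind(1) e]
      unfolding ind(2) phi_eq[OF ind(1) e] indecomposable_classes_def by blast
  next
    fix c assume "c \<in> indecomposable_classes (RepB t)"
    then obtain X where X: "X \<in> Ob (RepB t)" "indecomposable (RepB t) X" "\<not> zero_object (RepB t) X"
      "c = iso_rel (RepB t) `` {X}"
      by (auto simp: indecomposable_classes_def)
    have "K.connected X"
      using M.indecomposable_connected X unfolding K_eq by blast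
    then obtain k m e where *: "(k, m) \<in> index_pairs" "lifted_idempotent t k (p_part k m) e"
      "isomorphic (RepB t) X (image_object k e)"
      using connected_classification by blast
    have "c = phi t (k, m)"
      unfolding X(4) phi_eq[OF *(1,2)] using * X(1) lifted_Ob[OF *(1,2)]
      by (intro equiv_class_eq[OF K.equiv_iso_rel]) (simp add: iso_rel_def)
    then show "c \<in> phi t ` index_pairs"
      using *(1) by blast
  qed
qed

end

theorem lemma5p8:
  fixes t :: complex
  assumes "t \<noteq> 0"
  shows "bij_betw (phi t) index_pairs (indecomposable_classes (RepB t))"
proof -
  interpret interpolation t
    by unfold_locales (rule assms)
  show ?thesis
    by (rule bij_betw_phi)
qed

end
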